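(* Let $(\mathbb{I},\mathbf{p})$ be a box-like self-affine random iterated function system that satisfies the uniform open rectangle condition and is of the separated type, with $\alpha_M(e)=|\pi_xf(e,\Delta)|$ for all $e\in W_i$ and all $i\in\Lambda$. Let $F_\omega$ be the associated $1$-variable random box-like carpet. Assume further that (1) there exists $\eta\in(0,1)$ such that $\alpha_m(e)=\eta$ for all $e\in W_i$ and all $i\in\Lambda$; (2) $s^x(F_\omega)=\sum_{i\in\Lambda}p_i\,s^x(F_{i,i,\dots})$ for $\mu$-almost every $\omega$; (3) $$\mathbb{E}\Big(\log\sum_{e\in W_{\omega_1}}\alpha_M(e)^{s^x(F_\omega)}\Big)=\mathbb{E}\Big(\log\sum_{e\in W_{\omega_1}}\alpha_M(e)^{s^x(F_{\omega_1,\omega_1,\dots})}\Big).$$ Then, for $\mu$-almost every $\omega$, $$\dim_BF_\omega=\sum_{i\in\Lambda}p_i\dim_BF_{i,i,\dots}=\mathbb{E}(\dim_BF_{\omega_1,\omega_1,\dots}).$$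
   Context: Box-like RIFS: $\Lambda=\{1,\dots,N\}$; $\mathbb{I}=\{\mathbb{I}_i\}_{i\in\Lambda}$ is a finite collection of finite iterated function systems $\mathbb{I}_i=\{f_i^1,\dots,f_i^{\#\mathbb{I}_i}\}$, and $\mathbf{p}=(p_i)_{i\in\Lambda}$ is a probability vector with all $p_i>0$. Each $f_i^j:\mathbb{R}^2\to\mathbb{R}^2$ has the form $f_i^j(\mathbf{x})=\begin{pmatrix}a_i^j&0\\0&b_i^j\end{pmatrix}\mathbf{Q}_i^j\mathbf{x}+(u_i^j,v_i^j)^{\top}$ with $0<a_i^j,b_i^j<1$, $\mathbf{Q}_i^j$ equal to some $\begin{pmatrix}\pm1&0\\0&\pm1\end{pmatrix}$ or $\begin{pmatrix}0&\pm1\\\pm1&0\end{pmatrix}$ (signs independent), and $f_i^j(\Delta)\subset\Delta$ where $\Delta=[0,1]^2$. Standing assumption: every $\mathbb{I}_i$ contains at least one map and at least one $\mathbb{I}_i$ contains at least two maps. Separated: $(\mathbb{I},\mathbf{p})$ is non-separated if among all the matrices $\mathbf{Q}_i^j$ ($i\in\Lambda$, $1\le j\le\#\mathbb{I}_i$) at least one is of the diagonal form and at least one is of the off-diagonal form; otherwise it is separated. Uniform open rectangle condition (UORC): for every $i\in\Lambda$ and $j\ne k$, $f_i^j((0,1)^2)\cap f_i^k((0,1)^2)=\varnothing$. Words: to each map $f_i^j$ associate a distinct symbol $e_i^j$, and let $W_i=\{e_i^1,\dots,e_i^{\#\mathbb{I}_i}\}$. For a finite word $e=e_1\cdots e_n$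 of symbols, $f(e,\cdot)=f_{e_1}\circ\cdots\circ f_{e_n}$. For $\omega\in\Lambda^{\mathbb{N}}$, $\mathbf{C}_\omega^k=W_{\omega_1}W_{\omega_2}\cdots W_{\omega_k}$ is the set of words $e_1\cdots e_k$ with $e_m\in W_{\omega_m}$. The $1$-variable carpet is $F_\omega=\bigcap_{k\ge1}\bigcup_{e\in\mathbf{C}_\omega^k}f(e,\Delta)$; $F_{i,i,\dots}$ is the carpet of the constant sequence $(i,i,\dots)$, i.e. the deterministic attractor of $\mathbb{I}_i$. $\mu$ is the Bernoulli measure on $\Lambda^{\mathbb{N}}$ induced by $\mathbf{p}$ and $\mathbb{E}$ is expectation with respect to $\mu$. $\pi_x,\pi_y$ are the orthogonal projections of $\mathbb{R}^2$ onto the coordinate axes and $|\cdot|$ denotes length of an interval. $\alpha_M(e)$ and $\alpha_m(e)$ are the maximum and minimum of $|\pi_xf(e,\Delta)|,|\pi_yf(e,\Delta)|$. $s^x(F)=\dim_B(\pi_xF)$ (the box-counting dimension of $\pi_xF$; for $F=F_\omega$ it exists and is constant for $\mu$-almost every $\omega$).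
   Formalization: The condition that the maximum side is the x-side is assumed for all finite words, not only single symbols. This is equivalent if all matrices are diagonal; if all are off-diagonal, the symbol condition alone makes the claim false, and the word condition with (1) forces all a_i^j to be equal. *)

theory Defs
  imports "HOL-Probability.Probability"
begin

section \<open>Box-counting dimension\<close>

definition covering_number :: "real \<Rightarrow> 'a::metric_space set \<Rightarrow> nat" where
  "covering_number \<delta> F =
     Inf {card C | C. finite C \<and> F \<subseteq> \<Union>C \<and> (\<forall>A\<in>C. bounded A \<and> diameter A \<le> \<delta>)}"

definition box_quotient :: "'a::metric_space set \<Rightarrow> real \<Rightarrow> real" where
  "box_quotient F \<delta> = ln (real (covering_number \<delta> F)) / - ln \<delta>"

definition has_box_dim :: "'a::metric_space set \<Rightarrow> real \<Rightarrow> bool" where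
  "has_box_dim F s \<longleftrightarrow> (box_quotient F \<longlongrightarrow> s) (at_right 0)"

text \<open>Meaningful only if the limit exists, i.e. if \<open>has_box_dim F s\<close> for some \<open>s\<close>.\<close>

definition box_dim :: "'a::metric_space set \<Rightarrow> real" where
  "box_dim F = Lim (at_right 0) (box_quotient F)"

lemma has_box_dim_imp_box_dim: "has_box_dim F s \<Longrightarrow> box_dim F = s"
  unfolding has_box_dim_def box_dim_def by (rule tendsto_Lim) simp


section \<open>Box-like random iterated function systems\<close>

text \<open>
  The index set \<open>\<Lambda>\<close> is a finite type \<open>'i\<close>. The maps of the \<open>i\<close>-th system are numbered
  \<open>1, \<dots>, num_maps \<I> i\<close>, and the symbol of the \<open>j\<close>-th map of the \<open>i\<close>-th system is the
  pair \<open>(i, j)\<close>, so that symbols of different maps are distinct by construction.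
\<close>

record 'i rifs =
  num_maps :: "'i \<Rightarrow> nat"
  ratio_x :: "'i \<times> nat \<Rightarrow> real"
  ratio_y :: "'i \<times> nat \<Rightarrow> real"
  orient :: "'i \<times> nat \<Rightarrow> real^2^2"
  transl :: "'i \<times> nat \<Rightarrow> real^2"

definition symbols :: "'i rifs \<Rightarrow> 'i \<Rightarrow> ('i \<times> nat) set" where
  "symbols \<I> i = {(i, j) | j. 1 \<le> j \<and> j \<le> num_maps \<I> i}"

definition mat2 :: "real \<Rightarrow> real \<Rightarrow> real \<Rightarrow> real \<Rightarrow> real^2^2" where
  "mat2 a b c d = vector [vector [a, b], vector [c, d]]"

definition diagonal_signs :: "(real^2^2) set" where
  "diagonal_signs = {mat2 s 0 0 t | s t. s \<in> {-1, 1} \<and> t \<in> {-1, 1}}"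

definition antidiagonal_signs :: "(real^2^2) set" where
  "antidiagonal_signs = {mat2 0 s t 0 | s t. s \<in> {-1, 1} \<and> t \<in> {-1, 1}}"

definition rifs_map :: "'i rifs \<Rightarrow> 'i \<times> nat \<Rightarrow> real^2 \<Rightarrow> real^2" where
  "rifs_map \<I> e x = (mat2 (ratio_x \<I> e) 0 0 (ratio_y \<I> e) ** orient \<I> e) *v x + transl \<I> e"

abbreviation unit_square :: "(real^2) set" where
  "unit_square \<equiv> cbox 0 1"

definition box_like_rifs :: "'i::finite rifs \<Rightarrow> 'i pmf \<Rightarrow> bool" where
  "box_like_rifs \<I> p \<longleftrightarrow>
     (\<forall>i. pmf p i > 0) \<and>
     (\<forall>i. num_maps \<I> i \<ge> 1) \<and> (\<exists>i. num_maps \<I> i \<ge> 2) \<and>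
     (\<forall>i. \<forall>e\<in>symbols \<I> i.
        0 < ratio_x \<I> e \<and> ratio_x \<I> e < 1 \<and> 0 < ratio_y \<I> e \<and> ratio_y \<I> e < 1 \<and>
        orient \<I> e \<in> diagonal_signs \<union> antidiagonal_signs \<and>
        rifs_map \<I> e ` unit_square \<subseteq> unit_square)"

definition non_separated :: "'i rifs \<Rightarrow> bool" where
  "non_separated \<I> \<longleftrightarrow>
     (\<exists>i. \<exists>e\<in>symbols \<I> i. orient \<I> e \<in> diagonal_signs) \<and>
     (\<exists>i. \<exists>e\<in>symbols \<I> i. orient \<I> e \<in> antidiagonal_signs)"

definition separated :: "'i rifs \<Rightarrow> bool" where
  "separated \<I> \<longleftrightarrow> \<not> non_separated \<I>"

definition UORC :: "'i rifs \<Rightarrow> bool" where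
  "UORC \<I> \<longleftrightarrow>
     (\<forall>i. \<forall>e\<in>symbols \<I> i. \<forall>e'\<in>symbols \<I> i. e \<noteq> e' \<longrightarrow>
        rifs_map \<I> e ` box 0 1 \<inter> rifs_map \<I> e' ` box 0 1 = {})"


section \<open>Words and 1-variable carpets\<close>

text \<open>Sequences \<open>\<omega>\<close> are indexed from \<open>0\<close>, so \<open>\<omega> 0\<close> is \<open>\<omega>\<^sub>1\<close>.\<close>

definition word_map :: "'i rifs \<Rightarrow> ('i \<times> nat) list \<Rightarrow> real^2 \<Rightarrow> real^2" where
  "word_map \<I> w = foldr (\<lambda>e g. rifs_map \<I> e \<circ> g) w id"

definition words :: "'i rifs \<Rightarrow> (nat \<Rightarrow> 'i) \<Rightarrow> nat \<Rightarrow> ('i \<times> nat) list set" where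
  "words \<I> \<omega> k = {w. length w = k \<and> (\<forall>m<k. w ! m \<in> symbols \<I> (\<omega> m))}"

definition carpet :: "'i rifs \<Rightarrow> (nat \<Rightarrow> 'i) \<Rightarrow> (real^2) set" where
  "carpet \<I> \<omega> = (\<Inter>k\<in>{1..}. \<Union>w\<in>words \<I> \<omega> k. word_map \<I> w ` unit_square)"

definition proj_x :: "(real^2) set \<Rightarrow> real set" where
  "proj_x A = (\<lambda>x. x $ 1) ` A"

definition proj_y :: "(real^2) set \<Rightarrow> real set" where
  "proj_y A = (\<lambda>x. x $ 2) ` A"

definition length_x :: "'i rifs \<Rightarrow> ('i \<times> nat) list \<Rightarrow> real" where
  "length_x \<I> w = measure lborel (proj_x (word_map \<I> w ` unit_square))"

definition length_y :: "'i rifs \<Rightarrow> ('i \<times> nat) list \<Rightarrow> real" where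
  "length_y \<I> w = measure lborel (proj_y (word_map \<I> w ` unit_square))"

definition alpha_max :: "'i rifs \<Rightarrow> ('i \<times> nat) list \<Rightarrow> real" where
  "alpha_max \<I> w = max (length_x \<I> w) (length_y \<I> w)"

definition alpha_min :: "'i rifs \<Rightarrow> ('i \<times> nat) list \<Rightarrow> real" where
  "alpha_min \<I> w = min (length_x \<I> w) (length_y \<I> w)"

text \<open>
  The Bernoulli measure is completed, so that expectations of functions that are determined only
  up to null sets, such as functions of the dimension of \<open>carpet \<I> \<omega>\<close>, do not depend on a
  Borel measurable representative (a Bochner integral of a non-measurable function is 0 by
  convention).
\<close>

definition bernoulli_measure :: "'i::finite pmf \<Rightarrow> (nat \<Rightarrow> 'i) measure" where
  "bernoulli_measure p = completion (\<Pi>\<^sub>M n\<in>UNIV. measure_pmf p)"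

definition sx :: "(real^2) set \<Rightarrow> real" where
  "sx F = box_dim (proj_x F)"


section \<open>Dominance of the horizontal direction\<close>

text \<open>
  The requirement \<open>\<alpha>\<^sub>M(e) = |\<pi>\<^sub>x f(e, \<Delta>)|\<close> is imposed on all finite words \<open>e\<close>. If no map
  interchanges the axes, this is equivalent to the requirement on the individual symbols
  \<open>e \<in> W\<^sub>i\<close> (lemma \<open>x_dominant_iff_letters\<close> below). A system in which all maps interchange
  the axes is also separated, but there the condition on symbols does not control the shape of the
  rectangles of longer words, and with it alone the averaging formula for the dimension fails:
  take two equally likely systems, one consisting of the 100 maps with ratios \<open>(1/10, 1/10)\<close>
  onto the cells of a 10 by 10 grid, the other of 10 maps with ratios \<open>(1/5, 1/10)\<close>, one in each
  of 10 rows, cyclically occupying 5 columns. All horizontal and vertical projections are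
  \<open>[0, 1]\<close>, the almost sure dimension is \<open>2 log 1000 / log 5000\<close>, but the mean of the two
  deterministic dimensions is \<open>1 + log 10 / log 50\<close>.
\<close>

definition x_dominant :: "'i rifs \<Rightarrow> bool" where
  "x_dominant \<I> \<longleftrightarrow>
     (\<forall>w. set w \<subseteq> (\<Union>i. symbols \<I> i) \<longrightarrow> alpha_max \<I> w = length_x \<I> w)"

lemma mat2_mult_vec: "(mat2 a b c d ** mat2 a' b' c' d') *v x =
    vector [(a * a' + b * c') * x $ 1 + (a * b' + b * d') * x $ 2,
            (c * a' + d * c') * x $ 1 + (c * b' + d * d') * x $ 2]"
  by (simp add: vec_eq_iff forall_2 mat2_def matrix_matrix_mult_def matrix_vector_mult_def sum_2)

lemma measure_affine_interval:
  fixes A :: real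
  assumes "0 < \<bar>A\<bar>"
  shows "measure lborel ((\<lambda>t. A * t + c) ` {0..1}) = \<bar>A\<bar>"
  using assms by (subst image_affinity_atLeastAtMost) (auto simp: abs_if)

lemma proj_image_unit_square:
  assumes "\<And>x. f x $ 1 = A * x $ 1 + c" "\<And>x. f x $ 2 = B * x $ 2 + d"
  shows "proj_x (f ` unit_square) = (\<lambda>t. A * t + c) ` {0..1}"
    and "proj_y (f ` unit_square) = (\<lambda>t. B * t + d) ` {0..1}"
proof -
  have proj: "(\<lambda>x. x $ i) ` unit_square = {0..1::real}" for i :: 2
  proof
    show "(\<lambda>x. x $ i) ` unit_square \<subseteq> {0..1::real}"
      by (auto simp: mem_box_cart)
    show "{0..1::real} \<subseteq> (\<lambda>x. x $ i) ` unit_square"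
    proof
      fix t :: real assume "t \<in> {0..1}"
      then have "(\<chi> k. t) \<in> unit_square" by (auto simp: mem_box_cart)
      then show "t \<in> (\<lambda>x. x $ i) ` unit_square" by (intro image_eqI[where x = "\<chi> k. t"]) auto
    qed
  qed
  have "proj_x (f ` unit_square) = (\<lambda>t. A * t + c) ` (\<lambda>x. x $ 1) ` unit_square"
    unfolding proj_x_def image_image assms ..
  then show "proj_x (f ` unit_square) = (\<lambda>t. A * t + c) ` {0..1}"
    by (simp only: proj)
  have "proj_y (f ` unit_square) = (\<lambda>t. B * t + d) ` (\<lambda>x. x $ 2) ` unit_square"
    unfolding proj_y_def image_image assms ..
  then show "proj_y (f ` unit_square) = (\<lambda>t. B * t + d) ` {0..1}"
    by (simp only: proj)
qed

lemma word_map_diagonal: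
  assumes "\<forall>e\<in>set w. orient \<I> e \<in> diagonal_signs \<and> 0 < ratio_x \<I> e \<and> 0 < ratio_y \<I> e"
  shows "\<exists>A B c d. \<bar>A\<bar> = prod_list (map (ratio_x \<I>) w) \<and> \<bar>B\<bar> = prod_list (map (ratio_y \<I>) w) \<and>
           (\<forall>x. word_map \<I> w x $ 1 = A * x $ 1 + c \<and> word_map \<I> w x $ 2 = B * x $ 2 + d)"
  using assms
proof (induction w)
  case Nil
  then show ?case
    by (intro exI[of _ 1] exI[of _ 0]) (simp add: word_map_def)
next
  case (Cons e w)
  then obtain A B c d where IH: "\<bar>A\<bar> = prod_list (map (ratio_x \<I>) w)"
      "\<bar>B\<bar> = prod_list (map (ratio_y \<I>) w)"
      "\<And>x. word_map \<I> w x $ 1 = A * x $ 1 + c" "\<And>x. word_map \<I> w x $ 2 = B * x $ 2 + d"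
    by auto
  from Cons.prems obtain s t where st: "orient \<I> e = mat2 s 0 0 t" "\<bar>s\<bar> = 1" "\<bar>t\<bar> = 1"
    and pos: "0 < ratio_x \<I> e" "0 < ratio_y \<I> e"
    by (auto simp: diagonal_signs_def)
  have "word_map \<I> (e # w) x = rifs_map \<I> e (word_map \<I> w x)" for x
    by (simp add: word_map_def)
  then have "word_map \<I> (e # w) x $ 1
        = (ratio_x \<I> e * s * A) * x $ 1 + (ratio_x \<I> e * s * c + transl \<I> e $ 1)"
      "word_map \<I> (e # w) x $ 2
        = (ratio_y \<I> e * t * B) * x $ 2 + (ratio_y \<I> e * t * d + transl \<I> e $ 2)" for x
    by (simp_all add: rifs_map_def st mat2_mult_vec IH algebra_simps)
  moreover have "\<bar>ratio_x \<I> e * s * A\<bar> = prod_list (map (ratio_x \<I>) (e # w))"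
      "\<bar>ratio_y \<I> e * t * B\<bar> = prod_list (map (ratio_y \<I>) (e # w))"
    using pos by (simp_all add: abs_mult st IH)
  ultimately show ?case by blast
qed

lemma lengths_diagonal:
  assumes "\<forall>e\<in>set w. orient \<I> e \<in> diagonal_signs \<and> 0 < ratio_x \<I> e \<and> 0 < ratio_y \<I> e"
  shows "length_x \<I> w = prod_list (map (ratio_x \<I>) w)"
    and "length_y \<I> w = prod_list (map (ratio_y \<I>) w)"
proof -
  obtain A B c d where *: "\<bar>A\<bar> = prod_list (map (ratio_x \<I>) w)"
      "\<bar>B\<bar> = prod_list (map (ratio_y \<I>) w)"
      "\<And>x. word_map \<I> w x $ 1 = A * x $ 1 + c" "\<And>x. word_map \<I> w x $ 2 = B * x $ 2 + d"
    using word_map_diagonal[OF assms] by blast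
  have "0 < \<bar>A\<bar>" "0 < \<bar>B\<bar>"
    unfolding *(1,2) using assms by (induction w) auto
  then show "length_x \<I> w = prod_list (map (ratio_x \<I>) w)"
    and "length_y \<I> w = prod_list (map (ratio_y \<I>) w)"
    unfolding length_x_def length_y_def proj_image_unit_square[OF *(3,4)] *(1,2)[symmetric]
    using measure_affine_interval by blast+
qed

lemma x_dominant_iff_letters:
  assumes "box_like_rifs \<I> p" and "\<forall>i. \<forall>e\<in>symbols \<I> i. orient \<I> e \<in> diagonal_signs"
  shows "x_dominant \<I> \<longleftrightarrow> (\<forall>i. \<forall>e\<in>symbols \<I> i. alpha_max \<I> [e] = length_x \<I> [e])"
proof
  assume X: "x_dominant \<I>"
  show "\<forall>i. \<forall>e\<in>symbols \<I> i. alpha_max \<I> [e] = length_x \<I> [e]"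
  proof (intro allI ballI)
    fix i e assume "e \<in> symbols \<I> i"
    then have "set [e] \<subseteq> (\<Union>i. symbols \<I> i)" by auto
    with X show "alpha_max \<I> [e] = length_x \<I> [e]" unfolding x_dominant_def by blast
  qed
next
  assume L: "\<forall>i. \<forall>e\<in>symbols \<I> i. alpha_max \<I> [e] = length_x \<I> [e]"
  have D: "\<forall>e\<in>set w. orient \<I> e \<in> diagonal_signs \<and> 0 < ratio_x \<I> e \<and> 0 < ratio_y \<I> e"
    if "set w \<subseteq> (\<Union>i. symbols \<I> i)" for w
    using that assms unfolding box_like_rifs_def by blast
  have le: "ratio_y \<I> e \<le> ratio_x \<I> e" if "e \<in> symbols \<I> i" for e i
  proof -
    have "length_y \<I> [e] \<le> length_x \<I> [e]"
      using L that by (metis alpha_max_def max.cobounded2)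
    moreover have "set [e] \<subseteq> (\<Union>i. symbols \<I> i)" using that by auto
    ultimately show ?thesis using lengths_diagonal[OF D] by simp
  qed
  show "x_dominant \<I>"
    unfolding x_dominant_def
  proof (intro allI impI)
    fix w assume w: "set w \<subseteq> (\<Union>i. symbols \<I> i)"
    have "0 \<le> prod_list (map (ratio_y \<I>) w) \<and>
          prod_list (map (ratio_y \<I>) w) \<le> prod_list (map (ratio_x \<I>) w)"
      using w D[OF w]
    proof (induction w)
      case (Cons e w)
      then have "ratio_y \<I> e \<le> ratio_x \<I> e" using le[of e] by (metis UN_E list.set_intros(1) subsetD)
      with Cons show ?case by (auto intro!: mult_mono simp: less_imp_le)
    qed simp
    then show "alpha_max \<I> w = length_x \<I> w"
      using lengths_diagonal[OF D[OF w]] by (simp add: alpha_max_def)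
  qed
qed

end

theory Submission
  imports Defs "HOL-Real_Asymp.Real_Asymp"
begin

text \<open>
  If no map interchanges the axes, all cylinders of level \<open>k\<close> have height \<open>\<eta>\<^sup>k\<close>, and at that
  scale a cylinder of width \<open>a\<close> needs as many boxes as the projection of the shifted carpet at
  scale \<open>\<eta>\<^sup>k / a\<close>, about \<open>(a / \<eta>\<^sup>k)\<^sup>s\<close> with \<open>s\<close> the dimension of the projection. Summing over the
  cylinders, which are essentially disjoint by the UORC, factorises over the letters, and the
  strong law of large numbers gives \<open>dim F\<^sub>\<omega> = s + E log (\<Sum>\<^sub>e \<alpha>\<^sub>M(e)\<^sup>s) / (- log \<eta>)\<close>, with the
  analogous formula for constant sequences; the hypotheses then say that the formula
  averages. The projected counts must be controlled uniformly along the orbit of the shift: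
  by the maximal ergodic inequality the times at which the control fails are sparse, and
  passing to a nearby good time changes the counts by a subexponential factor only.
  If every map interchanges the axes, all cylinders are nearly squares.
\<close>

section \<open>Grid counts and box dimension\<close>

text \<open>At level \<open>k\<close> the projection enters through \<open>shift k \<omega>\<close>,
  at every scale \<open>n \<le> Suc k\<close>. The dimension of the projection for \<omega> itself
  says nothing about the speed of convergence there, and deleting the prefix of length
  \<open>k\<close> would cost a factor exponential in \<open>k\<close>. Only prefixes of length
  \<open>\<epsilon> * real k\<close> are affordable, so what is needed is a good time in every
  window of that relative length, with a threshold \<open>M\<close> common to all windows. An upper
  bound on the frequency of bad times gives this.

  Counts run over words, the image of the origin standing for the whole cylinder, instead of over
  points of the carpet. They then depend on finitely many coordinates, hence are measurable, and
  prefixes act on them by concatenation. The price is bounded factors, which vanish once logarithms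
  are divided by the level.\<close>

lemma card_image_le_mult:
  assumes "finite (g ` A)" "\<And>y. y \<in> g ` A \<Longrightarrow> finite (f ` {x\<in>A. g x = y}) \<and> card (f ` {x\<in>A. g x = y}) \<le> C"
  shows "card (f ` A) \<le> C * card (g ` A)"
proof -
  have "f ` A = (\<Union>y\<in>g ` A. f ` {x\<in>A. g x = y})" by auto
  then have "card (f ` A) \<le> (\<Sum>y\<in>g ` A. card (f ` {x\<in>A. g x = y}))"
    using card_UN_le[OF assms(1), of "\<lambda>y. f ` {x\<in>A. g x = y}"] by simp
  also have "\<dots> \<le> (\<Sum>y\<in>g ` A. C)" using assms(2) by (intro sum_mono) auto
  finally show ?thesis by (simp add: mult.commute)
qed

text \<open>Double counting of the pairs \<open>(v, q)\<close> with \<open>q \<in> S v\<close>. It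
  turns bounded overlap of the sets \<open>S v\<close> into lower bounds on counts.\<close>

lemma sum_card_le_mult:
  assumes "finite V" "\<And>v. v \<in> V \<Longrightarrow> finite (S v)"
    and "\<And>q. q \<in> (\<Union>v\<in>V. S v) \<Longrightarrow> card {v\<in>V. q \<in> S v} \<le> C"
  shows "(\<Sum>v\<in>V. card (S v)) \<le> C * card (\<Union>v\<in>V. S v)"
proof -
  let ?U = "\<Union>v\<in>V. S v"
  have fin: "finite ?U" using assms(1,2) by auto
  have "(\<Sum>v\<in>V. card (S v)) = (\<Sum>v\<in>V. card {q\<in>?U. q \<in> S v})"
    by (intro sum.cong refl arg_cong[where f = card]) auto
  also have "\<dots> = (\<Sum>q\<in>?U. card {v\<in>V. q \<in> S v})"
    by (rule sum_multicount_gen[OF assms(1) fin]) auto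
  also have "\<dots> \<le> (\<Sum>q\<in>?U. C)" using assms(3) by (intro sum_mono) auto
  finally show ?thesis by (simp add: mult.commute)
qed

lemma floor_divide_diff_le:
  fixes x y \<delta> :: real
  assumes "0 < \<delta>" "\<bar>x - y\<bar> \<le> of_int q * \<delta>"
  shows "\<bar>\<lfloor>x / \<delta>\<rfloor> - \<lfloor>y / \<delta>\<rfloor>\<bar> \<le> q"
proof -
  have "\<bar>x / \<delta> - y / \<delta>\<bar> = \<bar>x - y\<bar> / \<delta>"
    using assms(1) by (metis abs_divide abs_of_pos diff_divide_distrib)
  also have "\<dots> \<le> of_int q" using assms by (simp add: divide_le_eq)
  finally show ?thesis by linarith
qed

lemma abs_diff_le_if_floor_eq:
  fixes x y \<delta> :: real
  assumes "0 < \<delta>" "\<lfloor>x / \<delta>\<rfloor> = \<lfloor>y / \<delta>\<rfloor>"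
  shows "\<bar>x - y\<bar> \<le> \<delta>"
proof -
  have "\<bar>x / \<delta> - y / \<delta>\<bar> \<le> 1" using assms(2) by linarith
  moreover have "\<bar>x / \<delta> - y / \<delta>\<bar> = \<bar>x - y\<bar> / \<delta>"
    using assms(1) by (metis abs_divide abs_of_pos diff_divide_distrib)
  ultimately show ?thesis using assms(1) by (simp add: divide_le_eq)
qed

lemma card_int_le_if_close:
  fixes S :: "int set"
  assumes "\<And>a b. a \<in> S \<Longrightarrow> b \<in> S \<Longrightarrow> \<bar>a - b\<bar> \<le> int q"
  shows "finite S \<and> card S \<le> 2 * q + 1"
proof (cases "S = {}")
  case False
  then obtain a where a: "a \<in> S" by blast
  have "S \<subseteq> {a - int q..a + int q}" using assms[OF _ a] by force
  then show ?thesis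
    using card_mono[of "{a - int q..a + int q}" S] finite_subset[of S "{a - int q..a + int q}"] by auto
qed simp

lemma card_int_prod_le_if_close:
  fixes S :: "(int \<times> int) set"
  assumes "\<And>a b. a \<in> S \<Longrightarrow> b \<in> S \<Longrightarrow> \<bar>fst a - fst b\<bar> \<le> int q \<and> \<bar>snd a - snd b\<bar> \<le> int q"
  shows "finite S \<and> card S \<le> (2 * q + 1)\<^sup>2"
proof -
  have 1: "finite (fst ` S) \<and> card (fst ` S) \<le> 2 * q + 1"
    using assms by (intro card_int_le_if_close) auto
  have 2: "finite (snd ` S) \<and> card (snd ` S) \<le> 2 * q + 1"
    using assms by (intro card_int_le_if_close) auto
  have sub: "S \<subseteq> fst ` S \<times> snd ` S" by force
  then have "card S \<le> card (fst ` S) * card (snd ` S)"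
    using 1 2 by (metis card_cartesian_product card_mono finite_SigmaI)
  also have "\<dots> \<le> (2 * q + 1)\<^sup>2"
    unfolding power2_eq_square using 1 2 by (intro mult_mono) auto
  finally show ?thesis using sub 1 2 finite_subset by blast
qed

lemma card_grid_le:
  fixes f :: "'a \<Rightarrow> real"
  assumes "0 < \<delta>" "finite (\<kappa> ` J)"
    and "\<And>i j. i \<in> J \<Longrightarrow> j \<in> J \<Longrightarrow> \<kappa> i = \<kappa> j \<Longrightarrow> \<bar>f i - f j\<bar> \<le> real q * \<delta>"
  shows "card ((\<lambda>i. \<lfloor>f i / \<delta>\<rfloor>) ` J) \<le> (2 * q + 1) * card (\<kappa> ` J)"
  using assms by (intro card_image_le_mult card_int_le_if_close) (auto intro!: floor_divide_diff_le)

definition cell :: "real \<Rightarrow> real^2 \<Rightarrow> int \<times> int" where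
  "cell \<delta> x = (\<lfloor>x $ 1 / \<delta>\<rfloor>, \<lfloor>x $ 2 / \<delta>\<rfloor>)"

lemma abs_diff_le_if_cell_eq:
  assumes "0 < \<delta>" "cell \<delta> x = cell \<delta> y"
  shows "\<bar>x $ i - y $ i\<bar> \<le> \<delta>"
  using assms abs_diff_le_if_floor_eq[OF assms(1)] exhaust_2[of i] by (auto simp: cell_def)

lemma card_cell_le:
  fixes f :: "'a \<Rightarrow> real^2"
  assumes "0 < \<delta>" "finite (\<kappa> ` J)"
    and "\<And>i j k. i \<in> J \<Longrightarrow> j \<in> J \<Longrightarrow> \<kappa> i = \<kappa> j \<Longrightarrow> \<bar>f i $ k - f j $ k\<bar> \<le> real q * \<delta>"
  shows "card ((\<lambda>i. cell \<delta> (f i)) ` J) \<le> (2 * q + 1)\<^sup>2 * card (\<kappa> ` J)"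
  using assms
  by (intro card_image_le_mult card_int_prod_le_if_close) (auto simp: cell_def intro!: floor_divide_diff_le)

lemma finite_grid:
  assumes "\<And>i. i \<in> J \<Longrightarrow> \<bar>f i\<bar> \<le> (R::real)" "0 < \<delta>"
  shows "finite ((\<lambda>i. \<lfloor>f i / \<delta>\<rfloor>) ` J)"
proof (rule finite_subset)
  show "(\<lambda>i. \<lfloor>f i / \<delta>\<rfloor>) ` J \<subseteq> {\<lfloor>- R / \<delta>\<rfloor>..\<lfloor>R / \<delta>\<rfloor>}"
  proof (rule image_subsetI)
    fix i assume "i \<in> J"
    from assms(1)[OF this] have "- R / \<delta> \<le> f i / \<delta>" "f i / \<delta> \<le> R / \<delta>"
      using assms(2) by (auto simp: field_simps abs_le_iff)
    then show "\<lfloor>f i / \<delta>\<rfloor> \<in> {\<lfloor>- R / \<delta>\<rfloor>..\<lfloor>R / \<delta>\<rfloor>}"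
      by (auto intro: floor_mono)
  qed
qed simp

lemma finite_cell:
  assumes "\<And>i k. i \<in> J \<Longrightarrow> \<bar>f i $ k\<bar> \<le> R" "0 < \<delta>"
  shows "finite ((\<lambda>i. cell \<delta> (f i)) ` J)"
proof (rule finite_subset)
  show "(\<lambda>i. cell \<delta> (f i)) ` J \<subseteq> ((\<lambda>i. \<lfloor>f i $ 1 / \<delta>\<rfloor>) ` J) \<times> ((\<lambda>i. \<lfloor>f i $ 2 / \<delta>\<rfloor>) ` J)"
    by (auto simp: cell_def)
  show "finite (((\<lambda>i. \<lfloor>f i $ 1 / \<delta>\<rfloor>) ` J) \<times> ((\<lambda>i. \<lfloor>f i $ 2 / \<delta>\<rfloor>) ` J))"
    using assms by (intro finite_cartesian_product finite_grid) auto
qed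

section \<open>Covering numbers compared with grid counts\<close>

lemma covering_number_le:
  assumes "finite C" "F \<subseteq> \<Union>C" "\<And>A. A \<in> C \<Longrightarrow> bounded A \<and> diameter A \<le> \<delta>"
  shows "covering_number \<delta> F \<le> card C"
  unfolding covering_number_def using assms by (intro cInf_lower) auto

lemma ex_cover:
  fixes F :: "'a::euclidean_space set"
  assumes "bounded F" "0 < \<delta>"
  shows "\<exists>C. finite C \<and> F \<subseteq> \<Union>C \<and> (\<forall>A\<in>C. bounded A \<and> diameter A \<le> \<delta>)"
proof -
  have "compact (closure F)" using assms by simp
  then obtain k where k: "finite k" "closure F \<subseteq> (\<Union>x\<in>k. ball x (\<delta> / 2))"
    using \<open>0 < \<delta>\<close> unfolding compact_eq_totally_bounded by (meson half_gt_zero)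
  show ?thesis
  proof (intro exI conjI ballI)
    show "finite ((\<lambda>x. ball x (\<delta> / 2)) ` k)" using k by simp
    show "F \<subseteq> \<Union>((\<lambda>x. ball x (\<delta> / 2)) ` k)" using k closure_subset by blast
    fix A assume "A \<in> (\<lambda>x. ball x (\<delta> / 2)) ` k"
    then obtain x where A: "A = ball x (\<delta> / 2)" by blast
    show "bounded A" by (simp add: A)
    show "diameter A \<le> \<delta>" unfolding A
    proof (rule diameter_le)
      fix y z assume "y \<in> ball x (\<delta> / 2)" "z \<in> ball x (\<delta> / 2)"
      then show "norm (y - z) \<le> \<delta>"
        using dist_triangle2[of y z x] by (simp add: dist_commute dist_norm[symmetric])
    qed (use \<open>0 < \<delta>\<close> in auto)
  qed
qed

lemma covering_number_attained:
  fixes F :: "'a::euclidean_space set"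
  assumes "bounded F" "0 < \<delta>"
  obtains C where "finite C" "F \<subseteq> \<Union>C" "\<And>A. A \<in> C \<Longrightarrow> bounded A \<and> diameter A \<le> \<delta>"
    "covering_number \<delta> F = card C"
proof -
  let ?S = "{card C | C. finite C \<and> F \<subseteq> \<Union>C \<and> (\<forall>A\<in>C. bounded A \<and> diameter A \<le> \<delta>)}"
  have "?S \<noteq> {}" using ex_cover[OF assms] by blast
  then have "covering_number \<delta> F \<in> ?S" unfolding covering_number_def by (rule Inf_nat_def1)
  then show ?thesis using that by blast
qed

lemma covering_number_antimono:
  fixes F :: "'a::euclidean_space set"
  assumes "bounded F" "0 < \<delta>" "\<delta> \<le> \<delta>'"
  shows "covering_number \<delta>' F \<le> covering_number \<delta> F"
proof -
  obtain C where "finite C" "F \<subseteq> \<Union>C" "\<And>A. A \<in> C \<Longrightarrow> bounded A \<and> diameter A \<le> \<delta>"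
    "covering_number \<delta> F = card C"
    using covering_number_attained[OF assms(1,2)] by metis
  then show ?thesis using covering_number_le[of C F \<delta>'] assms(3) by fastforce
qed

lemma covering_number_pos:
  fixes F :: "'a::euclidean_space set"
  assumes "bounded F" "0 < \<delta>" "F \<noteq> {}"
  shows "0 < covering_number \<delta> F"
proof -
  obtain C where "finite C" "F \<subseteq> \<Union>C" "covering_number \<delta> F = card C"
    using covering_number_attained[OF assms(1,2)] by metis
  then show ?thesis using assms(3) by (auto simp: card_gt_0_iff)
qed

text \<open>Each point chooses one member of an optimal cover; the choice is the label
  \<open>\<kappa>\<close> expected by \<open>card_grid_le\<close> and
  \<open>card_cell_le\<close>.\<close>

lemma cover_index:
  fixes F :: "'a::euclidean_space set"
  assumes "bounded F" "0 < \<delta>"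
  obtains \<kappa> :: "'a \<Rightarrow> 'a set" where "finite (\<kappa> ` F)" "card (\<kappa> ` F) \<le> covering_number \<delta> F"
    "\<forall>x\<in>F. \<forall>y\<in>F. \<kappa> x = \<kappa> y \<longrightarrow> dist x y \<le> \<delta>"
proof -
  obtain C where C: "finite C" "F \<subseteq> \<Union>C" "\<And>A. A \<in> C \<Longrightarrow> bounded A \<and> diameter A \<le> \<delta>"
    "covering_number \<delta> F = card C"
    using covering_number_attained[OF assms(1,2)] by metis
  define \<kappa> where "\<kappa> x = (SOME A. A \<in> C \<and> x \<in> A)" for x
  have \<kappa>: "\<kappa> x \<in> C \<and> x \<in> \<kappa> x" if "x \<in> F" for x
    unfolding \<kappa>_def by (rule someI_ex) (use that C(2) in auto)
  show ?thesis
  proof (rule that[of \<kappa>])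
    show "finite (\<kappa> ` F)" using \<kappa> C(1) by (meson finite_subset image_subsetI)
    show "card (\<kappa> ` F) \<le> covering_number \<delta> F"
      unfolding C(4) using \<kappa> C(1) by (intro card_mono) auto
    show "\<forall>x\<in>F. \<forall>y\<in>F. \<kappa> x = \<kappa> y \<longrightarrow> dist x y \<le> \<delta>"
    proof (intro ballI impI)
      fix x y assume "x \<in> F" "y \<in> F" "\<kappa> x = \<kappa> y"
      then show "dist x y \<le> \<delta>"
        using \<kappa>[of x] \<kappa>[of y] C(3) diameter_bounded_bound by (metis order_trans)
    qed
  qed
qed

text \<open>The covering scale is \<open>2 * \<delta>\<close> because a planar cell of side \<delta>
  has diameter greater than \<delta>, but at most \<open>2 * \<delta>\<close>; using it on the line
  as well lets one criterion serve both cases. The factor 5 is \<open>2 * 2 + 1\<close>: within a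
  set of diameter \<open>2 * \<delta>\<close> grid indices differ by at most 2.\<close>

lemma covering_number_grid_bounds:
  fixes F :: "real set"
  assumes "bounded F" "0 < \<delta>"
  shows "covering_number (2 * \<delta>) F \<le> card ((\<lambda>x. \<lfloor>x / \<delta>\<rfloor>) ` F)"
    and "card ((\<lambda>x. \<lfloor>x / \<delta>\<rfloor>) ` F) \<le> 5 * covering_number (2 * \<delta>) F"
proof -
  obtain R where R: "\<And>x. x \<in> F \<Longrightarrow> \<bar>x\<bar> \<le> R" using assms(1) by (auto simp: bounded_iff)
  let ?K = "(\<lambda>x. \<lfloor>x / \<delta>\<rfloor>) ` F"
  let ?A = "\<lambda>k. {x. \<lfloor>x / \<delta>\<rfloor> = k}"
  have fin: "finite ?K" by (rule finite_grid[OF R assms(2)])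
  have "covering_number (2 * \<delta>) F \<le> card (?A ` ?K)"
  proof (rule covering_number_le)
    fix A assume "A \<in> ?A ` ?K"
    then obtain k where A: "A = ?A k" by blast
    have d: "dist x y \<le> \<delta>" if "x \<in> A" "y \<in> A" for x y
      using that abs_diff_le_if_floor_eq[OF assms(2)] by (auto simp: A dist_real_def)
    then have "bounded A" unfolding bounded_def by (metis equals0I)
    moreover have "diameter A \<le> \<delta>"
      using d assms(2) by (intro diameter_le) (auto simp: dist_norm)
    ultimately show "bounded A \<and> diameter A \<le> 2 * \<delta>" using assms(2) by simp
  qed (use fin in auto)
  also have "\<dots> \<le> card ?K" using fin by (rule card_image_le)
  finally show "covering_number (2 * \<delta>) F \<le> card ?K" .
  have d2: "0 < 2 * \<delta>" using assms(2) by simp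
  obtain \<kappa> :: "real \<Rightarrow> real set" where \<kappa>: "finite (\<kappa> ` F)" "card (\<kappa> ` F) \<le> covering_number (2 * \<delta>) F"
    "\<forall>x\<in>F. \<forall>y\<in>F. \<kappa> x = \<kappa> y \<longrightarrow> dist x y \<le> 2 * \<delta>"
    by (rule cover_index[OF assms(1) d2])
  have "card ?K \<le> (2 * 2 + 1) * card (\<kappa> ` F)"
    by (rule card_grid_le[OF assms(2) \<kappa>(1)]) (use \<kappa>(3) in \<open>auto simp: dist_real_def\<close>)
  then show "card ?K \<le> 5 * covering_number (2 * \<delta>) F" using \<kappa>(2) by simp
qed

lemma covering_number_cell_bounds:
  fixes F :: "(real^2) set"
  assumes "bounded F" "0 < \<delta>"
  shows "covering_number (2 * \<delta>) F \<le> card (cell \<delta> ` F)"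
    and "card (cell \<delta> ` F) \<le> 25 * covering_number (2 * \<delta>) F"
proof -
  obtain R where R: "\<And>x. x \<in> F \<Longrightarrow> norm x \<le> R" using assms(1) by (auto simp: bounded_iff)
  have R': "\<bar>x $ i\<bar> \<le> R" if "x \<in> F" for x i
    using R[OF that] component_le_norm_cart[of x i] by simp
  let ?K = "cell \<delta> ` F"
  let ?A = "\<lambda>k. {x. cell \<delta> x = k}"
  have fin: "finite ?K" by (rule finite_cell[OF R' assms(2)])
  have "covering_number (2 * \<delta>) F \<le> card (?A ` ?K)"
  proof (rule covering_number_le)
    fix A assume "A \<in> ?A ` ?K"
    then obtain k where A: "A = ?A k" by blast
    have d: "dist x y \<le> 2 * \<delta>" if "x \<in> A" "y \<in> A" for x y
    proof -
      have "dist x y \<le> (\<Sum>i\<in>UNIV. \<bar>(x - y) $ i\<bar>)" unfolding dist_norm by (rule norm_le_l1_cart)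
      also have "\<dots> \<le> (\<Sum>i\<in>(UNIV::2 set). \<delta>)"
        using that abs_diff_le_if_cell_eq[OF assms(2), of x y]
        by (intro sum_mono) (auto simp: A)
      finally show ?thesis by simp
    qed
    then have "bounded A" unfolding bounded_def by (metis equals0I)
    moreover have "diameter A \<le> 2 * \<delta>"
      using d assms(2) by (intro diameter_le) (auto simp: dist_norm)
    ultimately show "bounded A \<and> diameter A \<le> 2 * \<delta>" by simp
  qed (use fin in auto)
  also have "\<dots> \<le> card ?K" using fin by (rule card_image_le)
  finally show "covering_number (2 * \<delta>) F \<le> card ?K" .
  have d2: "0 < 2 * \<delta>" using assms(2) by simp
  obtain \<kappa> :: "real^2 \<Rightarrow> (real^2) set" where \<kappa>: "finite (\<kappa> ` F)" "card (\<kappa> ` F) \<le> covering_number (2 * \<delta>) F"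
    "\<forall>x\<in>F. \<forall>y\<in>F. \<kappa> x = \<kappa> y \<longrightarrow> dist x y \<le> 2 * \<delta>"
    by (rule cover_index[OF assms(1) d2])
  have "card ?K \<le> (2 * 2 + 1)\<^sup>2 * card (\<kappa> ` F)"
  proof (intro card_cell_le[OF assms(2) \<kappa>(1)])
    fix x y k assume "x \<in> F" "y \<in> F" "\<kappa> x = \<kappa> y"
    with \<kappa>(3) have "dist x y \<le> 2 * \<delta>" by blast
    then show "\<bar>x $ k - y $ k\<bar> \<le> real 2 * \<delta>"
      using component_le_norm_cart[of "x - y" k] by (simp add: dist_norm)
  qed
  then show "card ?K \<le> 25 * covering_number (2 * \<delta>) F" using \<kappa>(2) by simp
qed

section \<open>Box dimension along a geometric sequence of scales\<close>

lemma Lim_null_comparison_iff: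
  fixes f g h :: "nat \<Rightarrow> real"
  assumes "h \<longlonglongrightarrow> 0" "\<And>k. \<bar>f k - g k\<bar> \<le> h k"
  shows "f \<longlonglongrightarrow> d \<longleftrightarrow> g \<longlonglongrightarrow> d"
proof -
  have "(\<lambda>k. f k - g k) \<longlonglongrightarrow> 0"
    by (rule Lim_null_comparison[OF _ assms(1)]) (use assms(2) in simp)
  then show ?thesis using Lim_transform Lim_transform2 by blast
qed

lemma tendsto_div_nat_affine:
  fixes f :: "nat \<Rightarrow> real"
  assumes "(\<lambda>k. f k / (real k * L)) \<longlonglongrightarrow> d" "0 < L"
  shows "(\<lambda>k. f k / (real k * L + b)) \<longlonglongrightarrow> d"
proof -
  have "(\<lambda>k. (real k * L) / (real k * L + b)) \<longlonglongrightarrow> 1"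
    using assms(2) by real_asymp
  from tendsto_mult[OF assms(1) this]
  have "(\<lambda>k. f k / (real k * L) * ((real k * L) / (real k * L + b))) \<longlonglongrightarrow> d" by simp
  moreover have "\<forall>\<^sub>F k in sequentially. f k / (real k * L) * ((real k * L) / (real k * L + b)) = f k / (real k * L + b)"
    by (rule eventually_mono[OF eventually_gt_at_top[of 0]]) (use assms(2) in auto)
  ultimately show ?thesis by (rule Lim_transform_eventually)
qed

text \<open>The covering number is monotone in the scale, and between consecutive members of the
  sequence the logarithm of the scale moves by a constant; so the sequence decides the limit. The
  factor \<open>C\<close> disappears in the division by \<open>real k\<close>.\<close>

lemma has_box_dim_iff_seq:
  fixes F :: "'a::euclidean_space set" and N :: "nat \<Rightarrow> nat"
  assumes F: "bounded F" "F \<noteq> {}" and r: "0 < r" "r < 1"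
    and N: "\<And>k. covering_number (2 * r ^ k) F \<le> N k" "\<And>k. N k \<le> C * covering_number (2 * r ^ k) F"
  shows "has_box_dim F d \<longleftrightarrow> (\<lambda>k. ln (N k) / (real k * - ln r)) \<longlonglongrightarrow> d"
proof -
  define L where "L = - ln r"
  have L: "0 < L" using r by (simp add: L_def ln_less_zero)
  have cov: "0 < covering_number (2 * r ^ k) F" for k
    using F r by (intro covering_number_pos) auto
  have C: "0 < C" using N(2)[of 0] N(1)[of 0] cov[of 0] by (intro Nat.gr0I) simp
  have lnN: "ln (N k) - ln C \<le> ln (covering_number (2 * r ^ k) F)"
    "ln (covering_number (2 * r ^ k) F) \<le> ln (N k)" for k
  proof -
    have "real (N k) \<le> real C * real (covering_number (2 * r ^ k) F)"
      using N(2)[of k] by (metis of_nat_le_iff of_nat_mult)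
    moreover have "0 < real (N k)" using N(1)[of k] cov[of k] by linarith
    ultimately have "ln (N k) \<le> ln (real C * real (covering_number (2 * r ^ k) F))"
      by (metis ln_mono)
    then show "ln (N k) - ln C \<le> ln (covering_number (2 * r ^ k) F)"
      using C cov[of k] by (simp add: ln_mult)
    show "ln (covering_number (2 * r ^ k) F) \<le> ln (N k)"
      using N(1)[of k] cov[of k] by simp
  qed
  have ln2r: "- ln (2 * r ^ k) = real k * L - ln 2" for k
    using r by (simp add: ln_mult ln_realpow L_def)
  let ?c = "\<lambda>k. ln (real (covering_number (2 * r ^ k) F))"
  have iff: "(\<lambda>k. ln (N k) / (real k * L)) \<longlonglongrightarrow> d \<longleftrightarrow> (\<lambda>k. ?c k / (real k * L)) \<longlonglongrightarrow> d"
  proof (rule Lim_null_comparison_iff)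
    show "(\<lambda>k. ln C / (real k * L)) \<longlonglongrightarrow> 0" using L by real_asymp
    show "\<bar>ln (N k) / (real k * L) - ?c k / (real k * L)\<bar> \<le> ln C / (real k * L)" for k
    proof -
      have "\<bar>ln (N k) / (real k * L) - ?c k / (real k * L)\<bar> = \<bar>ln (N k) - ?c k\<bar> / (real k * L)"
        using L by (simp add: abs_divide abs_mult flip: diff_divide_distrib)
      also have "\<dots> \<le> ln C / (real k * L)" using lnN[of k] L by (intro divide_right_mono) auto
      finally show ?thesis .
    qed
  qed
  show ?thesis unfolding L_def[symmetric] iff
  proof
    assume "has_box_dim F d"
    then have lim: "(box_quotient F \<longlongrightarrow> d) (at_right 0)" by (simp add: has_box_dim_def)
    have "filterlim (\<lambda>k. 2 * r ^ k) (at_right 0) sequentially"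
      unfolding filterlim_at using r LIMSEQ_realpow_zero[of r]
      by (auto intro!: tendsto_mult_right_zero)
    from filterlim_compose[OF lim this]
    have "(\<lambda>k. ?c k / (real k * L - ln 2)) \<longlonglongrightarrow> d"
      by (simp add: box_quotient_def ln2r)
    then have "(\<lambda>k. ?c k / (real k * L - ln 2) * ((real k * L - ln 2) / (real k * L))) \<longlonglongrightarrow> d * 1"
      by (rule tendsto_mult) (use L in real_asymp)
    moreover have "\<forall>\<^sub>F k in sequentially. real k * L > ln 2" using L by real_asymp
    then have "\<forall>\<^sub>F k in sequentially. ?c k / (real k * L - ln 2) * ((real k * L - ln 2) / (real k * L))
         = ?c k / (real k * L)"
      by eventually_elim auto
    ultimately have "(\<lambda>k. ?c k / (real k * L)) \<longlonglongrightarrow> d * 1"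
      by (rule Lim_transform_eventually)
    then show "(\<lambda>k. ?c k / (real k * L)) \<longlonglongrightarrow> d" by simp
  next
    assume lim: "(\<lambda>k. ?c k / (real k * L)) \<longlonglongrightarrow> d"
    \<comment> \<open>For \<open>0 < \<delta> < 1\<close> this index brackets the scale: \<open>2 *
      r ^ Suc (\<kappa> \<delta>) \<le> \<delta> \<le> 2 * r ^ \<kappa> \<delta>\<close>.\<close>
    define \<kappa> where "\<kappa> \<delta> = nat \<lfloor>(ln 2 - ln \<delta>) / L\<rfloor>" for \<delta> :: real
    have \<kappa>lim: "filterlim \<kappa> sequentially (at_right 0)"
      unfolding \<kappa>_def using L by real_asymp
    \<comment> \<open>Numerator and denominator are taken at opposite ends of the bracket: with
      \<open>k = \<kappa> \<delta>\<close>, the denominator here is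
      \<open>- ln (2 * r ^ Suc k)\<close>, and in \<open>up\<close> it is
      \<open>- ln (2 * r ^ k)\<close>. The constant shifts do not change the limit.\<close>
    have lo: "((\<lambda>\<delta>. ?c (\<kappa> \<delta>) / (real (\<kappa> \<delta>) * L + (L - ln 2))) \<longlongrightarrow> d) (at_right 0)"
      by (rule filterlim_compose[OF tendsto_div_nat_affine[OF lim L] \<kappa>lim])
    have up: "((\<lambda>\<delta>. ?c (Suc (\<kappa> \<delta>)) / (real (Suc (\<kappa> \<delta>)) * L + (- L - ln 2))) \<longlongrightarrow> d) (at_right 0)"
      by (rule filterlim_compose[OF LIMSEQ_Suc[OF tendsto_div_nat_affine[OF lim L]] \<kappa>lim])
    have bnd: "?c (\<kappa> \<delta>) / (real (\<kappa> \<delta>) * L + (L - ln 2)) \<le> box_quotient F \<delta> \<and>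
        box_quotient F \<delta> \<le> ?c (Suc (\<kappa> \<delta>)) / (real (Suc (\<kappa> \<delta>)) * L + (- L - ln 2))"
      if \<delta>: "0 < \<delta> \<and> \<delta> < 1" and big: "ln 2 < real (\<kappa> \<delta>) * L" for \<delta>
    proof -
      define k where "k = \<kappa> \<delta>"
      have "0 \<le> ln 2 - ln \<delta>" using \<delta> ln_le_cancel_iff[of \<delta> 2] by simp
      then have nonneg: "0 \<le> (ln 2 - ln \<delta>) / L" using L by simp
      have k: "real k \<le> (ln 2 - ln \<delta>) / L" "(ln 2 - ln \<delta>) / L < real k + 1"
        using nonneg unfolding k_def \<kappa>_def by linarith+
      then have k': "real k * L \<le> ln 2 - ln \<delta>" "ln 2 - ln \<delta> < (real k + 1) * L"
        using L by (simp_all add: field_simps)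
      have "ln \<delta> \<le> ln (2 * r ^ k)" using k' ln2r[of k] by linarith
      then have d1: "\<delta> \<le> 2 * r ^ k" using \<delta> r by simp
      have "ln (2 * r ^ Suc k) \<le> ln \<delta>" using k' ln2r[of "Suc k"] by (simp add: algebra_simps)
      then have d2: "2 * r ^ Suc k \<le> \<delta>" using \<delta> r by (subst (asm) ln_le_cancel_iff) auto
      have c1: "covering_number (2 * r ^ k) F \<le> covering_number \<delta> F"
        using d1 \<delta> F by (intro covering_number_antimono) auto
      have c2: "covering_number \<delta> F \<le> covering_number (2 * r ^ Suc k) F"
        using d2 r F by (intro covering_number_antimono) auto
      have l1: "?c k \<le> ln (covering_number \<delta> F)" using c1 cov[of k] by simp
      have l2: "ln (covering_number \<delta> F) \<le> ?c (Suc k)" using c1 c2 cov[of k] by simp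
      have l0: "0 \<le> ?c k" using cov[of k] by simp
      have pos: "0 < - ln \<delta>" using \<delta> by (simp add: ln_less_zero)
      have "?c k / (real k * L + (L - ln 2)) \<le> ln (covering_number \<delta> F) / - ln \<delta>"
      proof (intro frac_le)
        show "- ln \<delta> \<le> real k * L + (L - ln 2)" using k' by (simp add: algebra_simps)
      qed (use l0 l1 pos in auto)
      moreover have "ln (covering_number \<delta> F) / - ln \<delta> \<le> ?c (Suc k) / (real (Suc k) * L + (- L - ln 2))"
      proof (intro frac_le)
        show "real (Suc k) * L + (- L - ln 2) \<le> - ln \<delta>" using k' by (simp add: algebra_simps)
        show "0 < real (Suc k) * L + (- L - ln 2)" using big by (simp add: algebra_simps k_def)
      qed (use l0 l1 l2 in auto)
      ultimately show ?thesis by (simp add: box_quotient_def k_def)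
    qed
    have "\<forall>\<^sub>F k in sequentially. ln 2 < real k * L" using L by real_asymp
    then have ev: "\<forall>\<^sub>F \<delta> in at_right 0. ln 2 < real (\<kappa> \<delta>) * L"
      by (rule eventually_compose_filterlim[OF _ \<kappa>lim])
    have "\<forall>\<^sub>F \<delta> in at_right (0::real). 0 < \<delta> \<and> \<delta> < 1"
      by (auto simp: eventually_at_right_field intro: exI[of _ 1])
    then have ev': "\<forall>\<^sub>F \<delta> in at_right 0. ?c (\<kappa> \<delta>) / (real (\<kappa> \<delta>) * L + (L - ln 2)) \<le> box_quotient F \<delta> \<and>
        box_quotient F \<delta> \<le> ?c (Suc (\<kappa> \<delta>)) / (real (Suc (\<kappa> \<delta>)) * L + (- L - ln 2))"
      by (rule eventually_mono[OF eventually_conj[OF _ ev]]) (use bnd in blast)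
    show "has_box_dim F d" unfolding has_box_dim_def
      by (rule tendsto_sandwich[OF _ _ lo up]) (use ev' in \<open>auto elim: eventually_mono\<close>)
  qed
qed

section \<open>Words and cylinders\<close>

lemma word_map_Nil [simp]: "word_map \<I> [] x = x"
  by (simp add: word_map_def)

lemma word_map_Cons [simp]: "word_map \<I> (e # w) x = rifs_map \<I> e (word_map \<I> w x)"
  by (simp add: word_map_def)

lemma word_map_append: "word_map \<I> (v @ w) x = word_map \<I> v (word_map \<I> w x)"
  by (induction v) auto

definition shift :: "nat \<Rightarrow> (nat \<Rightarrow> 'i) \<Rightarrow> nat \<Rightarrow> 'i" where
  "shift d \<omega> = (\<lambda>n. \<omega> (d + n))"

lemma shift_shift [simp]: "shift d (shift e \<omega>) = shift (e + d) \<omega>"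
  by (simp add: shift_def add.assoc)

lemma shift_0 [simp]: "shift 0 \<omega> = \<omega>"
  by (simp add: shift_def)

lemma shift_const [simp]: "shift d (\<lambda>_. i) = (\<lambda>_. i)"
  by (simp add: shift_def)

lemma append_in_words:
  assumes "v \<in> words \<I> \<omega> d" "u \<in> words \<I> (shift d \<omega>) N"
  shows "v @ u \<in> words \<I> \<omega> (d + N)"
proof -
  have len: "length v = d" "length u = N" using assms by (auto simp: words_def)
  have "(v @ u) ! m \<in> symbols \<I> (\<omega> m)" if "m < d + N" for m
  proof (cases "m < d")
    case False
    then have "u ! (m - d) \<in> symbols \<I> (shift d \<omega> (m - d))" using assms(2) that by (auto simp: words_def)
    then show ?thesis using False len by (simp add: shift_def nth_append)
  qed (use assms(1) len in \<open>auto simp: words_def nth_append\<close>)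
  then show ?thesis using len by (auto simp: words_def)
qed

lemma take_in_words:
  assumes "w \<in> words \<I> \<omega> (d + N)"
  shows "take d w \<in> words \<I> \<omega> d" "drop d w \<in> words \<I> (shift d \<omega>) N"
  using assms by (auto simp: words_def shift_def)

lemma words_Suc: "words \<I> \<omega> (Suc k) = (\<lambda>(w, e). w @ [e]) ` (words \<I> \<omega> k \<times> symbols \<I> (\<omega> k))"
proof (intro equalityI subsetI)
  fix w assume w: "w \<in> words \<I> \<omega> (Suc k)"
  then have "w = take k w @ [w ! k]" by (auto simp: words_def take_Suc_conv_app_nth[symmetric])
  moreover have "take k w \<in> words \<I> \<omega> k" "w ! k \<in> symbols \<I> (\<omega> k)" using w by (auto simp: words_def)
  ultimately show "w \<in> (\<lambda>(w, e). w @ [e]) ` (words \<I> \<omega> k \<times> symbols \<I> (\<omega> k))" by force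
qed (auto simp: words_def nth_append less_Suc_eq)

lemma words_0 [simp]: "words \<I> \<omega> 0 = {[]}"
  by (auto simp: words_def)

lemma symbols_eq_image: "symbols \<I> i = Pair i ` {1..num_maps \<I> i}"
  by (auto simp: symbols_def)

lemma finite_symbols [simp]: "finite (symbols \<I> i)"
  by (simp add: symbols_eq_image)

lemma finite_words [simp]: "finite (words \<I> \<omega> k)"
  by (induction k) (auto simp: words_Suc)

lemma set_word_subset: "w \<in> words \<I> \<omega> k \<Longrightarrow> set w \<subseteq> (\<Union>i. symbols \<I> i)"
  unfolding words_def by (force simp: subset_iff in_set_conv_nth simp del: split_paired_All split_paired_Ex)

lemma sum_words_prod:
  fixes g :: "'i \<times> nat \<Rightarrow> real"
  shows "(\<Sum>w\<in>words \<I> \<omega> k. prod_list (map g w)) = (\<Prod>j<k. \<Sum>e\<in>symbols \<I> (\<omega> j). g e)"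
proof (induction k)
  case (Suc k)
  have "inj_on (\<lambda>(w, e). w @ [e]) (words \<I> \<omega> k \<times> symbols \<I> (\<omega> k))" by (auto simp: inj_on_def)
  then have "(\<Sum>w\<in>words \<I> \<omega> (Suc k). prod_list (map g w))
      = (\<Sum>(w, e)\<in>words \<I> \<omega> k \<times> symbols \<I> (\<omega> k). prod_list (map g w) * g e)"
    by (subst words_Suc, subst sum.reindex) (auto simp: case_prod_beta intro!: sum.cong)
  also have "\<dots> = (\<Sum>w\<in>words \<I> \<omega> k. prod_list (map g w)) * (\<Sum>e\<in>symbols \<I> (\<omega> k). g e)"
    by (simp add: sum.cartesian_product[symmetric] sum_product)
  finally show ?case using Suc by simp
qed simp

lemma zero_in_unit_square: "(0::real^2) \<in> unit_square"
  by (simp add: mem_box_cart)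

section \<open>Cylinders of a box-like system and their points in the carpet\<close>

context
  fixes \<I> :: "'i::finite rifs" and p :: "'i pmf"
  assumes box: "box_like_rifs \<I> p"
begin

lemma symbols_ne: "symbols \<I> i \<noteq> {}"
  using box by (auto simp: symbols_eq_image box_like_rifs_def)

lemma words_ne: "words \<I> \<omega> k \<noteq> {}"
  by (induction k) (auto simp: words_Suc symbols_ne)

lemma card_symbols_pos: "0 < card (symbols \<I> i)"
  using symbols_ne by (simp add: card_gt_0_iff)

lemma rifs_map_unit_square: "e \<in> symbols \<I> i \<Longrightarrow> x \<in> unit_square \<Longrightarrow> rifs_map \<I> e x \<in> unit_square"
  using box unfolding box_like_rifs_def by blast

lemma word_map_unit_square:
  "w \<in> words \<I> \<omega> k \<Longrightarrow> x \<in> unit_square \<Longrightarrow> word_map \<I> w x \<in> unit_square"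
proof -
  have "set w \<subseteq> (\<Union>i. symbols \<I> i) \<Longrightarrow> x \<in> unit_square \<Longrightarrow> word_map \<I> w x \<in> unit_square" for w
    by (induction w) (auto simp del: mem_box_cart intro: rifs_map_unit_square)
  then show "w \<in> words \<I> \<omega> k \<Longrightarrow> x \<in> unit_square \<Longrightarrow> word_map \<I> w x \<in> unit_square"
    using set_word_subset by blast
qed

lemma rifs_map_coords:
  assumes "e \<in> symbols \<I> i"
  obtains A B c d where "A \<noteq> 0" "B \<noteq> 0"
    "(\<forall>x. rifs_map \<I> e x $ 1 = A * x $ 1 + c \<and> rifs_map \<I> e x $ 2 = B * x $ 2 + d) \<or>
     (\<forall>x. rifs_map \<I> e x $ 1 = A * x $ 2 + c \<and> rifs_map \<I> e x $ 2 = B * x $ 1 + d)"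
proof -
  have pos: "0 < ratio_x \<I> e" "0 < ratio_y \<I> e"
    and "orient \<I> e \<in> diagonal_signs \<union> antidiagonal_signs"
    using box assms unfolding box_like_rifs_def by blast+
  then consider s t where "orient \<I> e = mat2 s 0 0 t" "s \<noteq> 0" "t \<noteq> 0"
    | s t where "orient \<I> e = mat2 0 s t 0" "s \<noteq> 0" "t \<noteq> 0"
    by (auto simp: diagonal_signs_def antidiagonal_signs_def)
  then show ?thesis
  proof cases
    case 1
    then show ?thesis using pos
      by (intro that[of "ratio_x \<I> e * s" "ratio_y \<I> e * t"]) (auto simp: rifs_map_def mat2_mult_vec)
  next
    case 2
    then show ?thesis using pos
      by (intro that[of "ratio_x \<I> e * s" "ratio_y \<I> e * t"]) (auto simp: rifs_map_def mat2_mult_vec)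
  qed
qed

lemma inj_rifs_map:
  assumes "e \<in> symbols \<I> i"
  shows "inj (rifs_map \<I> e)"
proof (rule injI)
  fix x y assume eq: "rifs_map \<I> e x = rifs_map \<I> e y"
  obtain A B c d where *: "A \<noteq> 0" "B \<noteq> 0"
    "(\<forall>x. rifs_map \<I> e x $ 1 = A * x $ 1 + c \<and> rifs_map \<I> e x $ 2 = B * x $ 2 + d) \<or>
     (\<forall>x. rifs_map \<I> e x $ 1 = A * x $ 2 + c \<and> rifs_map \<I> e x $ 2 = B * x $ 1 + d)"
    using rifs_map_coords[OF assms] by blast
  have "rifs_map \<I> e x $ 1 = rifs_map \<I> e y $ 1" "rifs_map \<I> e x $ 2 = rifs_map \<I> e y $ 2"
    using eq by simp_all
  then show "x = y" using * by (auto simp: vec_eq_iff forall_2)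
qed

text \<open>The UORC speaks of open squares, whereas \<open>box_like_rifs\<close> controls the
  closed one. The bridge is that in each coordinate the map is affine with nonzero slope, so if the
  endpoints of the unit interval stay in it, interior points go to interior points.\<close>

lemma rifs_map_box:
  assumes "e \<in> symbols \<I> i" "x \<in> box 0 1"
  shows "rifs_map \<I> e x \<in> box 0 1"
proof -
  have aff: "0 < A * t + c \<and> A * t + c < 1"
    if "A \<noteq> 0" "0 \<le> c" "c \<le> 1" "0 \<le> A + c" "A + c \<le> 1" "0 < t" "t < 1" for A t c :: real
  proof (cases "0 < A")
    case True
    then have "0 < A * t" "A * t < A" using that by auto
    then show ?thesis using that by linarith
  next
    case False
    then have "A * t < 0" "A < A * t" using that by (auto simp: mult_less_0_iff)
    then show ?thesis using that by linarith
  qed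
  obtain A B c d where *: "A \<noteq> 0" "B \<noteq> 0"
    "(\<forall>x. rifs_map \<I> e x $ 1 = A * x $ 1 + c \<and> rifs_map \<I> e x $ 2 = B * x $ 2 + d) \<or>
     (\<forall>x. rifs_map \<I> e x $ 1 = A * x $ 2 + c \<and> rifs_map \<I> e x $ 2 = B * x $ 1 + d)"
    using rifs_map_coords[OF assms(1)] by blast
  have "rifs_map \<I> e 0 \<in> unit_square" "rifs_map \<I> e 1 \<in> unit_square"
    by (rule rifs_map_unit_square[OF assms(1)], simp add: mem_box_cart)+
  then have "0 \<le> c" "c \<le> 1" "0 \<le> A + c" "A + c \<le> 1" "0 \<le> d" "d \<le> 1" "0 \<le> B + d" "B + d \<le> 1"
    using *(3) by (auto simp: mem_box_cart forall_2)
  with *(1,2) have "0 < A * t + c \<and> A * t + c < 1 \<and> 0 < B * t + d \<and> B * t + d < 1"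
    if "0 < t" "t < 1" for t using that aff by blast
  then show ?thesis using *(3) assms(2) by (auto simp: mem_box_cart forall_2)
qed

lemma word_map_box:
  "w \<in> words \<I> \<omega> k \<Longrightarrow> x \<in> box 0 1 \<Longrightarrow> word_map \<I> w x \<in> box 0 1"
proof -
  have "set w \<subseteq> (\<Union>i. symbols \<I> i) \<Longrightarrow> x \<in> box 0 1 \<Longrightarrow> word_map \<I> w x \<in> box 0 1" for w
    by (induction w) (auto simp del: mem_box_cart intro: rifs_map_box)
  then show "w \<in> words \<I> \<omega> k \<Longrightarrow> x \<in> box 0 1 \<Longrightarrow> word_map \<I> w x \<in> box 0 1"
    using set_word_subset by blast
qed

text \<open>Injectivity strips a common first letter. Where the first letters differ they belong to
  the same system \<open>\<omega> 0\<close>, because both words follow the same \<omega>, and the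
  UORC of that system applies.\<close>

lemma word_map_disjoint:
  assumes "UORC \<I>" "v \<in> words \<I> \<omega> k" "w \<in> words \<I> \<omega> k" "v \<noteq> w"
  shows "word_map \<I> v ` box 0 1 \<inter> word_map \<I> w ` box 0 1 = {}"
  using assms(2-4)
proof (induction k arbitrary: \<omega> v w)
  case (Suc k)
  have split: "\<exists>e u. z = e # u \<and> e \<in> symbols \<I> (\<omega> 0) \<and> u \<in> words \<I> (shift 1 \<omega>) k"
    if "z \<in> words \<I> \<omega> (Suc k)" for z
    using that take_in_words(2)[of z \<I> \<omega> 1 k] by (cases z) (auto simp: words_def)
  obtain e v' where v: "v = e # v'" "e \<in> symbols \<I> (\<omega> 0)" "v' \<in> words \<I> (shift 1 \<omega>) k"
    using split[OF Suc.prems(1)] by blast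
  obtain e' w' where w: "w = e' # w'" "e' \<in> symbols \<I> (\<omega> 0)" "w' \<in> words \<I> (shift 1 \<omega>) k"
    using split[OF Suc.prems(2)] by blast
  show ?case
  proof (cases "e = e'")
    case True
    then have "word_map \<I> v' ` box 0 1 \<inter> word_map \<I> w' ` box 0 1 = {}"
      using v w Suc.prems(3) by (intro Suc.IH) auto
    then show ?thesis using True v(1) w(1) inj_rifs_map[OF v(2)]
      by (auto simp: image_iff dest: injD)
  next
    case False
    then have "rifs_map \<I> e ` box 0 1 \<inter> rifs_map \<I> e' ` box 0 1 = {}"
      using assms(1) v(2) w(2) unfolding UORC_def by blast
    moreover have "word_map \<I> v ` box 0 1 \<subseteq> rifs_map \<I> e ` box 0 1"
      using v word_map_box[OF v(3)] by auto
    moreover have "word_map \<I> w ` box 0 1 \<subseteq> rifs_map \<I> e' ` box 0 1"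
      using w word_map_box[OF w(3)] by auto
    ultimately show ?thesis by blast
  qed
qed auto

lemma continuous_word_map: "continuous_on UNIV (word_map \<I> w)"
proof (induction w)
  case (Cons e w)
  have "continuous_on UNIV (rifs_map \<I> e)"
    unfolding rifs_map_def[abs_def]
    by (intro continuous_on_add matrix_vector_mult_linear_continuous_on continuous_on_const)
  then have "continuous_on UNIV (rifs_map \<I> e \<circ> word_map \<I> w)"
    using Cons by (meson continuous_on_compose continuous_on_subset top_greatest)
  then show ?case by (simp add: comp_def)
qed simp

text \<open>Every cylinder meets the carpet, which is why counts may run over all words. The word is
  continued by arbitrary letters to an infinite address, and the nested compact rectangles along
  that address have a common point.\<close>

lemma carpet_point:
  assumes "w \<in> words \<I> \<omega> N"
  shows "\<exists>x\<in>unit_square. word_map \<I> w x \<in> carpet \<I> \<omega>"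
proof -
  define e where "e m = (if m < N then w ! m else (SOME e. e \<in> symbols \<I> (\<omega> m)))" for m
  have e: "e m \<in> symbols \<I> (\<omega> m)" for m
  proof (cases "m < N")
    case False
    have "(SOME e. e \<in> symbols \<I> (\<omega> m)) \<in> symbols \<I> (\<omega> m)"
      by (rule someI_ex) (use symbols_ne[of "\<omega> m"] in blast)
    then show ?thesis using False by (simp add: e_def)
  qed (use assms in \<open>auto simp: e_def words_def\<close>)
  define K where "K m = word_map \<I> (map e [0..<m]) ` unit_square" for m
  have "\<Inter>(range K) \<noteq> {}"
  proof (rule compact_nest)
    show "compact (K m)" for m
      unfolding K_def by (intro compact_continuous_image compact_cbox)
        (use continuous_word_map continuous_on_subset in blast)
    show "K m \<noteq> {}" for m by (auto simp: K_def interval_eq_empty_cart)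
    have "K (Suc m) \<subseteq> K m" for m
      using rifs_map_unit_square[OF e] by (auto simp: K_def word_map_append simp del: mem_box_cart)
    then show "K n \<subseteq> K m" if "m \<le> n" for m n
      using that by (rule lift_Suc_antimono_le)
  qed
  then obtain z where z: "\<And>m. z \<in> K m" by blast
  have ew: "map e [0..<k] \<in> words \<I> \<omega> k" for k using e by (auto simp: words_def)
  have "z \<in> carpet \<I> \<omega>" unfolding carpet_def
  proof (intro INT_I UN_I)
    show "map e [0..<k] \<in> words \<I> \<omega> k" for k by (rule ew)
    show "z \<in> word_map \<I> (map e [0..<k]) ` unit_square" for k using z[of k] by (simp add: K_def)
  qed
  moreover have "map e [0..<N] = w"
    using assms by (intro nth_equalityI) (auto simp: words_def e_def)
  ultimately show ?thesis using z[of N] by (auto simp: K_def simp del: mem_box_cart)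
qed

lemma carpet_subset_cylinders: "carpet \<I> \<omega> \<subseteq> (\<Union>w\<in>words \<I> \<omega> N. word_map \<I> w ` unit_square)"
\<comment> \<open>\<open>carpet\<close> intersects over levels from 1 on, so level 0 has to be
  recovered from level 1.\<close>
proof (cases "N = 0")
  case True
  have "carpet \<I> \<omega> \<subseteq> (\<Union>w\<in>words \<I> \<omega> 1. word_map \<I> w ` unit_square)"
    unfolding carpet_def by blast
  also have "\<dots> \<subseteq> unit_square" using word_map_unit_square by blast
  finally show ?thesis using True by auto
next
  case False
  show ?thesis unfolding carpet_def by (rule INF_lower) (use False in auto)
qed

lemma carpet_subset_unit_square: "carpet \<I> \<omega> \<subseteq> unit_square"
  using carpet_subset_cylinders[of \<omega> 0] by simp

lemma carpet_ne: "carpet \<I> \<omega> \<noteq> {}"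
  using carpet_point[of "[]" \<omega> 0] by auto

lemma bounded_carpet: "bounded (carpet \<I> \<omega>)"
  using bounded_subset[OF bounded_cbox carpet_subset_unit_square] .

lemma bounded_proj_x_carpet: "bounded (proj_x (carpet \<I> \<omega>))"
  unfolding proj_x_def using bounded_carpet by (rule bounded_component_cart)

lemma carpet_address:
  obtains a b where "\<forall>x\<in>carpet \<I> \<omega>. a x \<in> words \<I> \<omega> N \<and> b x \<in> unit_square \<and> x = word_map \<I> (a x) (b x)"
proof -
  have "\<forall>x\<in>carpet \<I> \<omega>. \<exists>ab. fst ab \<in> words \<I> \<omega> N \<and> snd ab \<in> unit_square \<and> x = word_map \<I> (fst ab) (snd ab)"
    using carpet_subset_cylinders[of \<omega> N] by fastforce
  then obtain f where "\<forall>x\<in>carpet \<I> \<omega>. fst (f x) \<in> words \<I> \<omega> N \<and> snd (f x) \<in> unit_square \<and> x = word_map \<I> (fst (f x)) (snd (f x))"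
    by (metis (no_types, lifting))
  then show ?thesis by (intro that[of "fst \<circ> f" "snd \<circ> f"]) auto
qed

lemma carpet_section:
  obtains b where "\<forall>w\<in>words \<I> \<omega> N. b w \<in> unit_square \<and> word_map \<I> w (b w) \<in> carpet \<I> \<omega>"
proof -
  have "\<forall>w\<in>words \<I> \<omega> N. \<exists>x. x \<in> unit_square \<and> word_map \<I> w x \<in> carpet \<I> \<omega>"
    using carpet_point by blast
  from bchoice[OF this] show ?thesis using that by blast
qed

text \<open>The corner \<open>word_map \<I> w 0\<close> need not lie in the carpet, but the cylinder
  of \<open>w\<close> contains a carpet point and is small. Points whose substitutes share a cell
  are within \<open>3 * \<delta>\<close> in each coordinate, one \<delta> for the cell and one for
  each displacement; hence \<open>49 = (2 * 3 + 1)\<^sup>2\<close>.\<close>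

lemma carpet_cells:
  assumes \<delta>: "0 < \<delta>"
    and close: "\<And>w x y k. w \<in> words \<I> \<omega> N \<Longrightarrow> x \<in> unit_square \<Longrightarrow> y \<in> unit_square \<Longrightarrow>
      \<bar>word_map \<I> w x $ k - word_map \<I> w y $ k\<bar> \<le> \<delta>"
  shows "card (cell \<delta> ` carpet \<I> \<omega>) \<le> 49 * card ((\<lambda>w. cell \<delta> (word_map \<I> w 0)) ` words \<I> \<omega> N)"
    and "card ((\<lambda>w. cell \<delta> (word_map \<I> w 0)) ` words \<I> \<omega> N) \<le> 49 * card (cell \<delta> ` carpet \<I> \<omega>)"
proof -
  let ?W = "(\<lambda>w. cell \<delta> (word_map \<I> w 0)) ` words \<I> \<omega> N"
  have finF: "finite (cell \<delta> ` carpet \<I> \<omega>)"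
    using carpet_subset_unit_square \<delta> by (intro finite_cell[where R = 1]) (force simp: mem_box_cart)+
  obtain a b where ab: "\<forall>x\<in>carpet \<I> \<omega>. a x \<in> words \<I> \<omega> N \<and> b x \<in> unit_square \<and> x = word_map \<I> (a x) (b x)"
    using carpet_address[of \<omega> N] by blast
  have sub: "(\<lambda>x. cell \<delta> (word_map \<I> (a x) 0)) ` carpet \<I> \<omega> \<subseteq> ?W" using ab by blast
  have "card ((\<lambda>x. cell \<delta> x) ` carpet \<I> \<omega>) \<le> (2 * 3 + 1)\<^sup>2 * card ((\<lambda>x. cell \<delta> (word_map \<I> (a x) 0)) ` carpet \<I> \<omega>)"
  proof (rule card_cell_le[OF \<delta>])
    show "finite ((\<lambda>x. cell \<delta> (word_map \<I> (a x) 0)) ` carpet \<I> \<omega>)" using sub by (rule finite_subset) simp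
    fix x y k assume "x \<in> carpet \<I> \<omega>" "y \<in> carpet \<I> \<omega>"
      "cell \<delta> (word_map \<I> (a x) 0) = cell \<delta> (word_map \<I> (a y) 0)"
    then have "\<bar>word_map \<I> (a x) 0 $ k - word_map \<I> (a y) 0 $ k\<bar> \<le> \<delta>" "\<bar>x $ k - word_map \<I> (a x) 0 $ k\<bar> \<le> \<delta>"
      "\<bar>y $ k - word_map \<I> (a y) 0 $ k\<bar> \<le> \<delta>"
      using abs_diff_le_if_cell_eq[OF \<delta>] close ab zero_in_unit_square by metis+
    then show "\<bar>x $ k - y $ k\<bar> \<le> real 3 * \<delta>" by linarith
  qed
  also have "\<dots> \<le> (2 * 3 + 1)\<^sup>2 * card ?W" using sub by (intro mult_left_mono card_mono) auto
  finally show "card (cell \<delta> ` carpet \<I> \<omega>) \<le> 49 * card ?W" by simp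
  obtain c where c: "\<forall>w\<in>words \<I> \<omega> N. c w \<in> unit_square \<and> word_map \<I> w (c w) \<in> carpet \<I> \<omega>"
    using carpet_section[of \<omega> N] by blast
  have sub: "(\<lambda>w. cell \<delta> (word_map \<I> w (c w))) ` words \<I> \<omega> N \<subseteq> cell \<delta> ` carpet \<I> \<omega>" using c by blast
  have "card ?W \<le> (2 * 3 + 1)\<^sup>2 * card ((\<lambda>w. cell \<delta> (word_map \<I> w (c w))) ` words \<I> \<omega> N)"
  proof (rule card_cell_le[OF \<delta>])
    fix v w k assume "v \<in> words \<I> \<omega> N" "w \<in> words \<I> \<omega> N"
      "cell \<delta> (word_map \<I> v (c v)) = cell \<delta> (word_map \<I> w (c w))"
    then have "\<bar>word_map \<I> v (c v) $ k - word_map \<I> w (c w) $ k\<bar> \<le> \<delta>" "\<bar>word_map \<I> v 0 $ k - word_map \<I> v (c v) $ k\<bar> \<le> \<delta>"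
      "\<bar>word_map \<I> w 0 $ k - word_map \<I> w (c w) $ k\<bar> \<le> \<delta>"
      using abs_diff_le_if_cell_eq[OF \<delta>] close c zero_in_unit_square by metis+
    then show "\<bar>word_map \<I> v 0 $ k - word_map \<I> w 0 $ k\<bar> \<le> real 3 * \<delta>" by linarith
  qed simp
  also have "\<dots> \<le> (2 * 3 + 1)\<^sup>2 * card (cell \<delta> ` carpet \<I> \<omega>)" using sub finF by (intro mult_left_mono card_mono) auto
  finally show "card ?W \<le> 49 * card (cell \<delta> ` carpet \<I> \<omega>)" by simp
qed

lemma proj_x_carpet_cells:
  assumes \<delta>: "0 < \<delta>"
    and close: "\<And>w x y. w \<in> words \<I> \<omega> N \<Longrightarrow> x \<in> unit_square \<Longrightarrow> y \<in> unit_square \<Longrightarrow>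
      \<bar>word_map \<I> w x $ 1 - word_map \<I> w y $ 1\<bar> \<le> \<delta>"
  shows "card ((\<lambda>t. \<lfloor>t / \<delta>\<rfloor>) ` proj_x (carpet \<I> \<omega>)) \<le> 7 * card ((\<lambda>w. \<lfloor>word_map \<I> w 0 $ 1 / \<delta>\<rfloor>) ` words \<I> \<omega> N)"
    and "card ((\<lambda>w. \<lfloor>word_map \<I> w 0 $ 1 / \<delta>\<rfloor>) ` words \<I> \<omega> N) \<le> 7 * card ((\<lambda>t. \<lfloor>t / \<delta>\<rfloor>) ` proj_x (carpet \<I> \<omega>))"
proof -
  let ?W = "(\<lambda>w. \<lfloor>word_map \<I> w 0 $ 1 / \<delta>\<rfloor>) ` words \<I> \<omega> N"
  let ?F = "(\<lambda>x. \<lfloor>x $ 1 / \<delta>\<rfloor>) ` carpet \<I> \<omega>"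
  have F: "(\<lambda>t. \<lfloor>t / \<delta>\<rfloor>) ` proj_x (carpet \<I> \<omega>) = ?F" by (simp add: proj_x_def image_image)
  have finF: "finite ?F"
    using carpet_subset_unit_square \<delta> by (intro finite_grid[where R = 1]) (force simp: mem_box_cart)+
  obtain a b where ab: "\<forall>x\<in>carpet \<I> \<omega>. a x \<in> words \<I> \<omega> N \<and> b x \<in> unit_square \<and> x = word_map \<I> (a x) (b x)"
    using carpet_address[of \<omega> N] by blast
  have sub: "(\<lambda>x. \<lfloor>word_map \<I> (a x) 0 $ 1 / \<delta>\<rfloor>) ` carpet \<I> \<omega> \<subseteq> ?W" using ab by blast
  have "card ?F \<le> (2 * 3 + 1) * card ((\<lambda>x. \<lfloor>word_map \<I> (a x) 0 $ 1 / \<delta>\<rfloor>) ` carpet \<I> \<omega>)"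
  proof (rule card_grid_le[OF \<delta>])
    show "finite ((\<lambda>x. \<lfloor>word_map \<I> (a x) 0 $ 1 / \<delta>\<rfloor>) ` carpet \<I> \<omega>)" using sub by (rule finite_subset) simp
    fix x y assume "x \<in> carpet \<I> \<omega>" "y \<in> carpet \<I> \<omega>"
      "\<lfloor>word_map \<I> (a x) 0 $ 1 / \<delta>\<rfloor> = \<lfloor>word_map \<I> (a y) 0 $ 1 / \<delta>\<rfloor>"
    then have "\<bar>word_map \<I> (a x) 0 $ 1 - word_map \<I> (a y) 0 $ 1\<bar> \<le> \<delta>" "\<bar>x $ 1 - word_map \<I> (a x) 0 $ 1\<bar> \<le> \<delta>"
      "\<bar>y $ 1 - word_map \<I> (a y) 0 $ 1\<bar> \<le> \<delta>"
      using abs_diff_le_if_floor_eq[OF \<delta>] close ab zero_in_unit_square by metis+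
    then show "\<bar>x $ 1 - y $ 1\<bar> \<le> real 3 * \<delta>" by linarith
  qed
  also have "\<dots> \<le> (2 * 3 + 1) * card ?W" using sub by (intro mult_left_mono card_mono) auto
  finally show "card ((\<lambda>t. \<lfloor>t / \<delta>\<rfloor>) ` proj_x (carpet \<I> \<omega>)) \<le> 7 * card ?W" by (simp add: F)
  obtain c where c: "\<forall>w\<in>words \<I> \<omega> N. c w \<in> unit_square \<and> word_map \<I> w (c w) \<in> carpet \<I> \<omega>"
    using carpet_section[of \<omega> N] by blast
  have sub: "(\<lambda>w. \<lfloor>word_map \<I> w (c w) $ 1 / \<delta>\<rfloor>) ` words \<I> \<omega> N \<subseteq> ?F" using c by blast
  have "card ?W \<le> (2 * 3 + 1) * card ((\<lambda>w. \<lfloor>word_map \<I> w (c w) $ 1 / \<delta>\<rfloor>) ` words \<I> \<omega> N)"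
  proof (rule card_grid_le[OF \<delta>])
    fix v w assume "v \<in> words \<I> \<omega> N" "w \<in> words \<I> \<omega> N"
      "\<lfloor>word_map \<I> v (c v) $ 1 / \<delta>\<rfloor> = \<lfloor>word_map \<I> w (c w) $ 1 / \<delta>\<rfloor>"
    then have "\<bar>word_map \<I> v (c v) $ 1 - word_map \<I> w (c w) $ 1\<bar> \<le> \<delta>" "\<bar>word_map \<I> v 0 $ 1 - word_map \<I> v (c v) $ 1\<bar> \<le> \<delta>"
      "\<bar>word_map \<I> w 0 $ 1 - word_map \<I> w (c w) $ 1\<bar> \<le> \<delta>"
      using abs_diff_le_if_floor_eq[OF \<delta>] close c zero_in_unit_square by metis+
    then show "\<bar>word_map \<I> v 0 $ 1 - word_map \<I> w 0 $ 1\<bar> \<le> real 3 * \<delta>" by linarith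
  qed simp
  also have "\<dots> \<le> (2 * 3 + 1) * card ?F" using sub finF by (intro mult_left_mono card_mono) auto
  finally show "card ?W \<le> 7 * card ((\<lambda>t. \<lfloor>t / \<delta>\<rfloor>) ` proj_x (carpet \<I> \<omega>))" by (simp add: F)
qed

end

section \<open>Rectangles with disjoint interiors that meet one grid cell\<close>

lemma half_lattice_point:
  fixes A c \<delta> t0 :: real
  assumes "0 < \<delta>" "\<delta> \<le> \<bar>A\<bar>" "0 \<le> t0" "t0 \<le> 1"
  obtains i :: int and t where "0 < t" "t < 1" "A * t + c = of_int i * (\<delta> / 2)"
    "\<bar>of_int i * (\<delta> / 2) - (A * t0 + c)\<bar> \<le> \<delta>"
proof -
  define x lo hi where "x = A * t0 + c" and "lo = min c (A + c)" and "hi = max c (A + c)"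
  have x: "lo \<le> x" "x \<le> hi"
  proof -
    have "A * t0 \<in> {min 0 A..max 0 A}" using assms(3,4) mult_left_le[of t0 A] mult_nonneg_nonneg[of A t0]
        mult_left_le[of t0 "-A"] mult_nonneg_nonneg[of "-A" t0] by (auto simp: min_def max_def)
    then show "lo \<le> x" "x \<le> hi" by (auto simp: x_def lo_def hi_def min_def max_def split: if_splits)
  qed
  have len: "hi - lo = \<bar>A\<bar>" by (auto simp: lo_def hi_def)
  \<comment> \<open>Left end of a subinterval of length \<delta> that contains \<open>x\<close> and
    stays inside the image interval.\<close>
  define l where "l = min x (hi - \<delta>)"
  have l: "lo \<le> l" "l \<le> x" "x \<le> l + \<delta>" "l + \<delta> \<le> hi" using x len assms(1,2) by (auto simp: l_def)
  \<comment> \<open>The first lattice point strictly to the right of \<open>l\<close>. Spacing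
    \<open>\<delta> / 2\<close> keeps it strictly below \<open>l + \<delta>\<close>; with spacing
    \<delta> it could be the endpoint.\<close>
  define i where "i = \<lfloor>2 * l / \<delta>\<rfloor> + 1"
  have "2 * l / \<delta> < of_int i" "of_int i \<le> 2 * l / \<delta> + 1" unfolding i_def by linarith+
  then have i: "l < of_int i * (\<delta> / 2)" "of_int i * (\<delta> / 2) < l + \<delta>"
    using assms(1) by (simp_all add: field_simps)
  define t where "t = (of_int i * (\<delta> / 2) - c) / A"
  have A: "A \<noteq> 0" using assms(1,2) by auto
  have eq: "A * t + c = of_int i * (\<delta> / 2)" using A by (simp add: t_def)
  have "lo < A * t + c" "A * t + c < hi" using i l eq by linarith+
  then have "0 < t \<and> t < 1"
  proof (cases "0 < A")
    case True
    then have "0 < A * t" "A * t < A * 1" using \<open>lo < A * t + c\<close> \<open>A * t + c < hi\<close> by (auto simp: lo_def hi_def)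
    then show ?thesis using True by (simp add: zero_less_mult_iff)
  next
    case False
    then have "A < 0" using A by simp
    then have "A * t < 0" "A * 1 < A * t" using \<open>lo < A * t + c\<close> \<open>A * t + c < hi\<close> by (auto simp: lo_def hi_def)
    then show ?thesis using \<open>A < 0\<close> by (simp add: mult_less_0_iff)
  qed
  moreover have "\<bar>of_int i * (\<delta> / 2) - (A * t0 + c)\<bar> \<le> \<delta>" using i l by (simp add: x_def[symmetric])
  ultimately show ?thesis using that eq by blast
qed

text \<open>
  A closed rectangle with sides of length at least \<open>\<delta>\<close> that meets a given \<open>\<delta>\<close>-cell has an
  interior point of the lattice \<open>(\<delta>/2)\<int>\<^sup>2\<close> within \<open>\<delta>\<close> of that cell, and disjoint interiors
  use different lattice points.
\<close>

lemma card_rectangles_meeting_cell: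
  fixes g :: "'v \<Rightarrow> real^2 \<Rightarrow> real^2"
  assumes \<delta>: "0 < \<delta>"
    and aff: "\<And>v. v \<in> V \<Longrightarrow> \<exists>A B c d. \<delta> \<le> \<bar>A\<bar> \<and> \<delta> \<le> \<bar>B\<bar> \<and> (\<forall>x. g v x $ 1 = A * x $ 1 + c \<and> g v x $ 2 = B * x $ 2 + d)"
    and disj: "\<And>v v'. v \<in> V \<Longrightarrow> v' \<in> V \<Longrightarrow> v \<noteq> v' \<Longrightarrow> g v ` box 0 1 \<inter> g v' ` box 0 1 = {}"
  shows "card {v\<in>V. \<exists>x\<in>unit_square. cell \<delta> (g v x) = q} \<le> 36"
proof -
  let ?U = "{v\<in>V. \<exists>x\<in>unit_square. cell \<delta> (g v x) = q}"
  \<comment> \<open>Lattice points within \<delta> of the half-open interval from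
    \<open>k * \<delta>\<close> to \<open>(k + 1) * \<delta>\<close> have index at least
    \<open>2 * k - 2\<close> and less than \<open>2 * k + 4\<close>. These are six candidates per
    coordinate, hence 36.\<close>
  let ?L = "{2 * fst q - 2..2 * fst q + 3} \<times> {2 * snd q - 2..2 * snd q + 3}"
  have range: "i \<in> {2 * k - 2..2 * k + 3}" if "\<bar>of_int i * (\<delta> / 2) - y\<bar> \<le> \<delta>" "\<lfloor>y / \<delta>\<rfloor> = k" for i k y
  proof -
    have "of_int k \<le> y / \<delta>" "y / \<delta> < of_int k + 1" using that(2) by linarith+
    then have "of_int k * \<delta> \<le> y" "y < of_int k * \<delta> + \<delta>" using \<delta> by (simp_all add: field_simps)
    then have "(of_int k - 1) * \<delta> \<le> of_int i / 2 * \<delta>" "of_int i / 2 * \<delta> < (of_int k + 2) * \<delta>"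
      using that(1) by (simp_all add: algebra_simps abs_le_iff)
    then have "(of_int k - 1) \<le> (of_int i / 2 :: real)" "of_int i / 2 < (of_int k + 2 :: real)"
      using \<delta> by (simp_all only: mult_le_cancel_right_pos mult_less_cancel_right_pos)
    then have "of_int (2 * k - 2) \<le> (of_int i :: real)" "(of_int i :: real) < of_int (2 * k + 4)" by simp_all
    then have "2 * k - 2 \<le> i" "i < 2 * k + 4" by (simp_all only: of_int_le_iff of_int_less_iff)
    then show ?thesis by simp
  qed
  have "\<exists>h. h \<in> ?L \<and> (\<exists>y\<in>box 0 1. g v y $ 1 = of_int (fst h) * (\<delta> / 2) \<and> g v y $ 2 = of_int (snd h) * (\<delta> / 2))"
    if v: "v \<in> ?U" for v
  proof -
    obtain x where x: "x \<in> unit_square" "cell \<delta> (g v x) = q" using v by blast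
    obtain A B c d where AB: "\<delta> \<le> \<bar>A\<bar>" "\<delta> \<le> \<bar>B\<bar>" "\<And>x. g v x $ 1 = A * x $ 1 + c" "\<And>x. g v x $ 2 = B * x $ 2 + d"
      using aff v by blast
    have x01: "0 \<le> x $ 1" "x $ 1 \<le> 1" "0 \<le> x $ 2" "x $ 2 \<le> 1" using x(1) by (auto simp: mem_box_cart)
    obtain i t where i: "0 < t" "t < 1" "A * t + c = of_int i * (\<delta> / 2)" "\<bar>of_int i * (\<delta> / 2) - (A * x $ 1 + c)\<bar> \<le> \<delta>"
      using half_lattice_point[OF \<delta> AB(1) x01(1,2)] by blast
    obtain j u where j: "0 < u" "u < 1" "B * u + d = of_int j * (\<delta> / 2)" "\<bar>of_int j * (\<delta> / 2) - (B * x $ 2 + d)\<bar> \<le> \<delta>"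
      using half_lattice_point[OF \<delta> AB(2) x01(3,4)] by blast
    have "i \<in> {2 * fst q - 2..2 * fst q + 3}" "j \<in> {2 * snd q - 2..2 * snd q + 3}"
      using x(2) by (auto intro!: range[OF i(4)] range[OF j(4)] simp: cell_def AB simp del: atLeastAtMost_iff)
    moreover have "(vector [t, u] :: real^2) \<in> box 0 1" using i j by (simp add: mem_box_cart forall_2)
    ultimately show ?thesis using i j AB by (intro exI[of _ "(i, j)"] conjI bexI[of _ "vector [t, u]"]) auto
  qed
  then have "\<forall>v\<in>?U. \<exists>h. h \<in> ?L \<and> (\<exists>y\<in>box 0 1. g v y $ 1 = of_int (fst h) * (\<delta> / 2) \<and> g v y $ 2 = of_int (snd h) * (\<delta> / 2))"
    by blast
  from bchoice[OF this] obtain h where h0: "\<forall>v\<in>?U. h v \<in> ?L \<and> (\<exists>y\<in>box 0 1. g v y $ 1 = of_int (fst (h v)) * (\<delta> / 2) \<and> g v y $ 2 = of_int (snd (h v)) * (\<delta> / 2))" ..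
  note h = h0[rule_format]
  have "h ` ?U \<subseteq> ?L" using h by blast
  have "inj_on h ?U"
  proof (rule inj_onI, rule ccontr)
    fix v v' assume v: "v \<in> ?U" "v' \<in> ?U" "h v = h v'" "v \<noteq> v'"
    obtain y where y: "y \<in> box 0 1" "g v y $ 1 = of_int (fst (h v)) * (\<delta> / 2)" "g v y $ 2 = of_int (snd (h v)) * (\<delta> / 2)"
      using h[OF v(1)] by blast
    obtain y' where y': "y' \<in> box 0 1" "g v' y' $ 1 = of_int (fst (h v')) * (\<delta> / 2)" "g v' y' $ 2 = of_int (snd (h v')) * (\<delta> / 2)"
      using h[OF v(2)] by blast
    have "g v y = g v' y'" using y y' v(3) by (simp add: vec_eq_iff forall_2)
    then show False using disj[of v v'] v y(1) y'(1) by blast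
  qed
  then have "card ?U \<le> card ?L" using \<open>h ` ?U \<subseteq> ?L\<close> by (rule card_inj_on_le) simp
  then show ?thesis by simp
qed

text \<open>For logarithms of counts, the constant \<open>C\<close>, which may depend on \<epsilon>,
  absorbs bounded factors, and \<open>\<epsilon> * real k\<close> absorbs subexponential
  ones.\<close>

lemma tendsto_div_nat_if_sublinear_diff:
  fixes f h :: "nat \<Rightarrow> real"
  assumes lim: "(\<lambda>k. h k / real k) \<longlonglongrightarrow> l"
    and close: "\<And>\<epsilon>. 0 < \<epsilon> \<Longrightarrow> \<exists>C. \<forall>\<^sub>F k in sequentially. \<bar>f k - h k\<bar> \<le> \<epsilon> * real k + C"
  shows "(\<lambda>k. f k / real k) \<longlonglongrightarrow> l"
proof -
  have "(\<lambda>k. f k / real k - h k / real k) \<longlonglongrightarrow> 0"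
  proof (rule LIMSEQ_I)
    fix r :: real assume r: "0 < r"
    then obtain C where C: "\<forall>\<^sub>F k in sequentially. \<bar>f k - h k\<bar> \<le> r / 2 * real k + C"
      using close[of "r / 2"] by auto
    have "\<forall>\<^sub>F k in sequentially. C < r / 2 * real k" using r by real_asymp
    then have "\<forall>\<^sub>F k in sequentially. norm (f k / real k - h k / real k - 0) < r"
      using C eventually_gt_at_top[of 0]
    proof eventually_elim
      case (elim k)
      have "\<bar>f k / real k - h k / real k\<bar> = \<bar>f k - h k\<bar> / real k"
        using elim by (simp add: abs_divide flip: diff_divide_distrib)
      also have "\<dots> < r" using elim by (simp add: divide_less_eq)
      finally show ?case by simp
    qed
    then show "\<exists>no. \<forall>n\<ge>no. norm (f n / real n - h n / real n - 0) < r"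
      by (simp add: eventually_sequentially)
  qed
  from tendsto_add[OF this lim] show ?thesis by simp
qed

text \<open>Fekete's lemma: the limit is the supremum of the quotients, and a near-optimal quotient
  at \<open>m\<close> propagates to all large \<open>n\<close> by division with remainder.\<close>

lemma superadditive_tendsto:
  fixes h :: "nat \<Rightarrow> real"
  assumes super: "\<And>m n. 1 \<le> m \<Longrightarrow> 1 \<le> n \<Longrightarrow> h m + h n \<le> h (m + n)"
    and bound: "\<And>n. 1 \<le> n \<Longrightarrow> h n \<le> B * real n"
  shows "\<exists>l. (\<lambda>n. h n / real n) \<longlonglongrightarrow> l"
proof -
  define l where "l = (SUP n\<in>{1..}. h n / real n)"
  have bdd: "bdd_above ((\<lambda>n. h n / real n) ` {1..})"
    using bound by (intro bdd_aboveI2[of _ _ B]) (auto simp: divide_le_eq)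
  have "(\<lambda>n. h n / real n) \<longlonglongrightarrow> l"
  proof (rule order_tendstoI)
    fix a assume "a < l"
    then obtain m where m: "1 \<le> m" "a < h m / real m"
      using less_cSUP_iff[OF _ bdd] unfolding l_def by auto
    define M where "M = (\<Sum>r\<in>{1..m}. \<bar>h r\<bar>)"
    have "h n \<ge> real n * (h m / real m) - \<bar>h m\<bar> - M" if n: "1 \<le> n" for n
    proof -
      have mult: "real q * h m + h r \<le> h (q * m + r)" if "1 \<le> r" for q r
      proof (induction q)
        case (Suc q)
        have "h m + h (q * m + r) \<le> h (m + (q * m + r))" using m that by (intro super) auto
        then show ?case using Suc by (simp add: algebra_simps)
      qed simp
      \<comment> \<open>The remainder runs through \<open>{1..m}\<close> instead of
        \<open>{0..<m}\<close>, since superadditivity is assumed for positive arguments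
        only.\<close>
      define q r where "q = (n - 1) div m" and "r = (n - 1) mod m + 1"
      have nqr: "n = q * m + r" and r: "1 \<le> r" "r \<le> m"
        using n m by (auto simp: q_def r_def Suc_leI div_mult_mod_eq[symmetric])
      have "\<bar>h r\<bar> \<le> M" unfolding M_def using r by (intro member_le_sum) auto
      moreover have "real q * h m + h r \<le> h n" using mult[OF r(1)] nqr by simp
      moreover have "real n * (h m / real m) - real q * h m \<le> \<bar>h m\<bar>"
      proof -
        have "real n * (h m / real m) - real q * h m = (real r / real m) * h m"
          using m by (simp add: nqr field_simps)
        also have "\<dots> \<le> (real r / real m) * \<bar>h m\<bar>" by (intro mult_left_mono) auto
        also have "\<dots> \<le> 1 * \<bar>h m\<bar>" using r m by (intro mult_right_mono) auto
        finally show ?thesis by simp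
      qed
      ultimately show ?thesis by linarith
    qed
    note lower = this
    define b where "b = h m / real m - a"
    have "0 < b" using m(2) by (simp add: b_def)
    then have "\<forall>\<^sub>F n in sequentially. \<bar>h m\<bar> + M < real n * b" by real_asymp
    then show "\<forall>\<^sub>F n in sequentially. a < h n / real n"
      using eventually_ge_at_top[of 1]
    proof eventually_elim
      case (elim n)
      have "real n * b = real n * (h m / real m) - a * real n" by (simp add: b_def algebra_simps)
      then have "a * real n < h n" using lower[OF elim(2)] elim(1) by linarith
      then show ?case using elim(2) by (simp add: less_divide_eq)
    qed
  next
    fix a assume "l < a"
    moreover have "h n / real n \<le> l" if "1 \<le> n" for n
      unfolding l_def using that by (intro cSUP_upper[OF _ bdd]) auto
    ultimately show "\<forall>\<^sub>F n in sequentially. h n / real n < a"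
      by (intro eventually_sequentiallyI[of 1]) force
  qed
  then show ?thesis by blast
qed

section \<open>Systems without axis interchange\<close>

locale diagonal_rifs =
  fixes \<I> :: "'i::finite rifs" and p :: "'i pmf" and \<eta> :: real
  assumes box: "box_like_rifs \<I> p" and uorc: "UORC \<I>"
    and \<eta>: "0 < \<eta>" "\<eta> < 1"
    and diag: "e \<in> symbols \<I> i \<Longrightarrow> orient \<I> e \<in> diagonal_signs"
    and ratio_y: "e \<in> symbols \<I> i \<Longrightarrow> ratio_y \<I> e = \<eta>"
    and ratio_x_ge: "e \<in> symbols \<I> i \<Longrightarrow> \<eta> \<le> ratio_x \<I> e"
begin

section \<open>Side lengths of cylinders\<close>

definition width :: "('i \<times> nat) list \<Rightarrow> real" where
  "width w = prod_list (map (ratio_x \<I>) w)"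

definition L :: real where "L = - ln \<eta>"

lemma L_pos: "0 < L"
  using \<eta> by (simp add: L_def ln_less_zero)

lemma \<eta>_pow: "0 < \<eta> ^ n" "\<eta> ^ n \<le> 1"
  using \<eta> by (auto intro: power_le_one)

lemma ratio_x_bounds: "e \<in> symbols \<I> i \<Longrightarrow> 0 < ratio_x \<I> e \<and> ratio_x \<I> e < 1"
  using box unfolding box_like_rifs_def by blast

lemma width_append: "width (v @ w) = width v * width w"
  by (simp add: width_def)

lemma width_Nil [simp]: "width [] = 1"
  by (simp add: width_def)

lemma width_bounds:
  assumes "w \<in> words \<I> \<omega> k"
  shows "\<eta> ^ k \<le> width w" "0 < width w" "width w \<le> 1"
proof -
  have "set w \<subseteq> (\<Union>i. symbols \<I> i) \<Longrightarrow> \<eta> ^ length w \<le> width w \<and> 0 < width w \<and> width w \<le> 1" for w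
  proof (induction w)
    case (Cons e w)
    then obtain i where "e \<in> symbols \<I> i" by auto
    then have "\<eta> \<le> ratio_x \<I> e" "0 < ratio_x \<I> e" "ratio_x \<I> e \<le> 1"
      using ratio_x_ge ratio_x_bounds less_imp_le by blast+
    then show ?case using Cons \<eta> by (auto simp: width_def intro!: mult_mono mult_le_one)
  qed (simp add: width_def)
  moreover have "length w = k" using assms by (simp add: words_def)
  ultimately show "\<eta> ^ k \<le> width w" "0 < width w" "width w \<le> 1"
    using set_word_subset[OF assms] by blast+
qed

lemma word_coords:
  assumes "w \<in> words \<I> \<omega> k"
  shows "\<exists>A B c d. \<bar>A\<bar> = width w \<and> \<bar>B\<bar> = \<eta> ^ k \<and>
    (\<forall>x. word_map \<I> w x $ 1 = A * x $ 1 + c \<and> word_map \<I> w x $ 2 = B * x $ 2 + d)"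
proof -
  have sub: "set w \<subseteq> (\<Union>i. symbols \<I> i)" by (rule set_word_subset[OF assms])
  have "\<forall>e\<in>set w. orient \<I> e \<in> diagonal_signs \<and> 0 < ratio_x \<I> e \<and> 0 < ratio_y \<I> e"
    using sub diag ratio_x_bounds ratio_y \<eta> by fastforce
  moreover have "set w \<subseteq> (\<Union>i. symbols \<I> i) \<Longrightarrow> prod_list (map (ratio_y \<I>) w) = \<eta> ^ length w" for w
    using ratio_y by (induction w) auto
  then have "prod_list (map (ratio_y \<I>) w) = \<eta> ^ k" using sub assms by (simp add: words_def)
  ultimately show ?thesis using word_map_diagonal[of w \<I>] by (simp add: width_def)
qed

lemma word_dist_x:
  assumes "w \<in> words \<I> \<omega> k"
  shows "\<bar>word_map \<I> w x $ 1 - word_map \<I> w y $ 1\<bar> = width w * \<bar>x $ 1 - y $ 1\<bar>"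
proof -
  obtain A c where "\<bar>A\<bar> = width w" "\<And>x. word_map \<I> w x $ 1 = A * x $ 1 + c"
    using word_coords[OF assms] by blast
  then show ?thesis by (metis abs_mult add_diff_cancel_right right_diff_distrib)
qed

lemma word_dist_y:
  assumes "w \<in> words \<I> \<omega> k"
  shows "\<bar>word_map \<I> w x $ 2 - word_map \<I> w y $ 2\<bar> = \<eta> ^ k * \<bar>x $ 2 - y $ 2\<bar>"
proof -
  obtain B d where "\<bar>B\<bar> = \<eta> ^ k" "\<And>x. word_map \<I> w x $ 2 = B * x $ 2 + d"
    using word_coords[OF assms] by blast
  then show ?thesis by (metis abs_mult add_diff_cancel_right right_diff_distrib)
qed

lemma unit_square_diff: "x \<in> unit_square \<Longrightarrow> y \<in> unit_square \<Longrightarrow> \<bar>x $ i - y $ i\<bar> \<le> 1"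
proof -
  assume "x \<in> unit_square" "y \<in> unit_square"
  then have "0 \<le> x $ i \<and> x $ i \<le> 1" "0 \<le> y $ i \<and> y $ i \<le> 1" by (simp_all add: mem_box_cart)
  then show ?thesis by linarith
qed

lemma word_zero_in_unit_square: "w \<in> words \<I> \<omega> k \<Longrightarrow> word_map \<I> w 0 \<in> unit_square"
  by (rule word_map_unit_square[OF box _ zero_in_unit_square])

lemma word_dist_x_le:
  assumes "w \<in> words \<I> \<omega> k" "x \<in> unit_square" "y \<in> unit_square"
  shows "\<bar>word_map \<I> w x $ 1 - word_map \<I> w y $ 1\<bar> \<le> width w"
  unfolding word_dist_x[OF assms(1)]
  using mult_left_mono[OF unit_square_diff[OF assms(2,3), of 1], of "width w"] width_bounds(2)[OF assms(1)] by simp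

lemma word_dist_y_le:
  assumes "w \<in> words \<I> \<omega> k" "x \<in> unit_square" "y \<in> unit_square"
  shows "\<bar>word_map \<I> w x $ 2 - word_map \<I> w y $ 2\<bar> \<le> \<eta> ^ k"
  unfolding word_dist_y[OF assms(1)]
  using mult_left_mono[OF unit_square_diff[OF assms(2,3), of 2], of "\<eta> ^ k"] \<eta>_pow(1)[of k] by simp

text \<open>There are finitely many maps, so the ratios have a maximum \<open>a < 1\<close>, and
  \<open>c\<close> letters with \<open>a ^ c < \<eta>\<close> gain one scale. The constant does not
  depend on \<omega>.\<close>

lemma ex_depth: "\<exists>c. \<forall>\<omega> n N w. c * n \<le> N \<longrightarrow> w \<in> words \<I> \<omega> N \<longrightarrow> width w \<le> \<eta> ^ n"
proof -
  define a where "a = Max (ratio_x \<I> ` (\<Union>i. symbols \<I> i))"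
  have fin: "finite (ratio_x \<I> ` (\<Union>i. symbols \<I> i))" by simp
  have ne: "ratio_x \<I> ` (\<Union>i. symbols \<I> i) \<noteq> {}" using symbols_ne[OF box] by blast
  have "a \<in> ratio_x \<I> ` (\<Union>i. symbols \<I> i)" unfolding a_def using fin ne by (rule Max_in)
  then have a: "0 < a" "a < 1" using ratio_x_bounds by blast+
  have le: "ratio_x \<I> e \<le> a" if "e \<in> symbols \<I> i" for e i
    unfolding a_def using fin that by (intro Max_ge) auto
  obtain c where c: "a ^ c < \<eta>" using real_arch_pow_inv[OF \<eta>(1) a(2)] by blast
  have width: "set w \<subseteq> (\<Union>i. symbols \<I> i) \<Longrightarrow> 0 \<le> width w \<and> width w \<le> a ^ length w" for w
  proof (induction w)
    case (Cons e w)
    then obtain i where "e \<in> symbols \<I> i" by auto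
    then have "ratio_x \<I> e \<le> a" "0 < ratio_x \<I> e" using le ratio_x_bounds by blast+
    then show ?case using Cons a by (auto simp: width_def intro!: mult_mono)
  qed (simp add: width_def)
  show ?thesis
  proof (intro exI[of _ c] allI impI)
    fix \<omega> n N w assume *: "c * n \<le> N" "w \<in> words \<I> \<omega> N"
    then have "width w \<le> a ^ N" using width[OF set_word_subset[OF *(2)]] by (simp add: words_def)
    also have "\<dots> \<le> a ^ (c * n)" using *(1) a by (intro power_decreasing) auto
    also have "\<dots> = (a ^ c) ^ n" by (simp add: power_mult)
    also have "\<dots> \<le> \<eta> ^ n" using c a by (intro power_mono) auto
    finally show "width w \<le> \<eta> ^ n" .
  qed
qed

definition depth :: nat where
  "depth = (SOME c. \<forall>\<omega> n N w. c * n \<le> N \<longrightarrow> w \<in> words \<I> \<omega> N \<longrightarrow> width w \<le> \<eta> ^ n)"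

lemma width_le_if_depth: "depth * n \<le> N \<Longrightarrow> w \<in> words \<I> \<omega> N \<Longrightarrow> width w \<le> \<eta> ^ n"
  using someI_ex[OF ex_depth] unfolding depth_def by blast

text \<open>Scale and level are separate parameters because a prefix moves them differently: the
  level by its length, the scale according to its width.\<close>

definition xcount :: "(nat \<Rightarrow> 'i) \<Rightarrow> nat \<Rightarrow> nat \<Rightarrow> nat" where
  "xcount \<omega> n N = card ((\<lambda>w. \<lfloor>word_map \<I> w 0 $ 1 / \<eta> ^ n\<rfloor>) ` words \<I> \<omega> N)"

text \<open>The count at scale \<open>\<eta>\<^sup>n\<close> depends on finitely many coordinates of \<open>\<omega>\<close> only.\<close>

definition pcount :: "(nat \<Rightarrow> 'i) \<Rightarrow> nat \<Rightarrow> nat" where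
  "pcount \<omega> n = xcount \<omega> n (depth * n)"

lemma xcount_carpet:
  assumes "depth * n \<le> N"
  shows "card ((\<lambda>t. \<lfloor>t / \<eta> ^ n\<rfloor>) ` proj_x (carpet \<I> \<omega>)) \<le> 7 * xcount \<omega> n N"
    and "xcount \<omega> n N \<le> 7 * card ((\<lambda>t. \<lfloor>t / \<eta> ^ n\<rfloor>) ` proj_x (carpet \<I> \<omega>))"
  using proj_x_carpet_cells[OF box \<eta>_pow(1), of \<omega> N n] word_dist_x_le width_le_if_depth[OF assms]
  unfolding xcount_def by (meson order_trans)+

text \<open>Both sides are compared with the count for the projected carpet, in which no level
  occurs; each comparison costs a factor 7.\<close>

lemma xcount_pcount:
  assumes "depth * n \<le> N"
  shows "xcount \<omega> n N \<le> 49 * pcount \<omega> n" "pcount \<omega> n \<le> 49 * xcount \<omega> n N"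
  using xcount_carpet[OF assms, of \<omega>] xcount_carpet[of n "depth * n" \<omega>] unfolding pcount_def by linarith+

lemma pcount_pos: "0 < pcount \<omega> n"
  unfolding pcount_def xcount_def using words_ne[OF box] by (simp add: card_gt_0_iff)

lemma pcount_le: "real (pcount \<omega> n) \<le> 2 / \<eta> ^ n"
proof -
  have "(\<lambda>w. \<lfloor>word_map \<I> w 0 $ 1 / \<eta> ^ n\<rfloor>) ` words \<I> \<omega> (depth * n) \<subseteq> {0..\<lfloor>1 / \<eta> ^ n\<rfloor>}"
  proof (rule image_subsetI)
    fix w assume "w \<in> words \<I> \<omega> (depth * n)"
    then have "0 \<le> word_map \<I> w 0 $ 1" "word_map \<I> w 0 $ 1 \<le> 1"
      using word_zero_in_unit_square by (auto simp: mem_box_cart)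
    then show "\<lfloor>word_map \<I> w 0 $ 1 / \<eta> ^ n\<rfloor> \<in> {0..\<lfloor>1 / \<eta> ^ n\<rfloor>}"
      using \<eta>_pow(1)[of n] by (auto intro!: floor_mono divide_right_mono)
  qed
  then have "pcount \<omega> n \<le> card {0..\<lfloor>1 / \<eta> ^ n\<rfloor>}" unfolding pcount_def xcount_def by (intro card_mono) auto
  then have "real (pcount \<omega> n) \<le> real (card {0..\<lfloor>1 / \<eta> ^ n\<rfloor>})" by (rule of_nat_mono)
  also have "\<dots> \<le> 1 / \<eta> ^ n + 1"
  proof -
    have "0 \<le> 1 / \<eta> ^ n" using \<eta>_pow(1)[of n] by simp
    then have "0 \<le> \<lfloor>1 / \<eta> ^ n\<rfloor>" by (simp only: zero_le_floor)
    then have "real (card {0..\<lfloor>1 / \<eta> ^ n\<rfloor>}) = real_of_int \<lfloor>1 / \<eta> ^ n\<rfloor> + 1" by simp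
    then show ?thesis by linarith
  qed
  finally have "real (pcount \<omega> n) \<le> 1 / \<eta> ^ n + 1" .
  moreover have "1 \<le> 1 / \<eta> ^ n" using \<eta>_pow[of n] by simp
  moreover have "2 / \<eta> ^ n = 1 / \<eta> ^ n + 1 / \<eta> ^ n"
    by (simp only: add_divide_distrib[symmetric] one_add_one)
  ultimately show ?thesis by linarith
qed

lemma ln_pcount_bounds: "0 \<le> ln (pcount \<omega> n)" "ln (pcount \<omega> n) \<le> real n * L + ln 2"
proof -
  show "0 \<le> ln (pcount \<omega> n)" using pcount_pos[of \<omega> n] by simp
  have "ln (pcount \<omega> n) \<le> ln (2 / \<eta> ^ n)" using pcount_le[of \<omega> n] pcount_pos[of \<omega> n] by (intro ln_mono) auto
  also have "\<dots> = real n * L + ln 2" using \<eta> by (simp add: ln_div ln_realpow L_def)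
  finally show "ln (pcount \<omega> n) \<le> real n * L + ln 2" .
qed

text \<open>A prefix contracts, so within one cylinder no more intervals are needed than for the
  shifted system at the same scale. Treating the cylinders as if their projections were disjoint is
  wasteful, but affordable for short prefixes.\<close>

lemma xcount_prefix_upper:
  "xcount \<omega> n (d + N) \<le> 3 * card (words \<I> \<omega> d) * xcount (shift d \<omega>) n N"
proof -
  let ?X = "(\<lambda>u. \<lfloor>word_map \<I> u 0 $ 1 / \<eta> ^ n\<rfloor>) ` words \<I> (shift d \<omega>) N"
  let ?\<kappa> = "\<lambda>w. (take d w, \<lfloor>word_map \<I> (drop d w) 0 $ 1 / \<eta> ^ n\<rfloor>)"
  have sub: "?\<kappa> ` words \<I> \<omega> (d + N) \<subseteq> words \<I> \<omega> d \<times> ?X"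
    using take_in_words by blast
  have "xcount \<omega> n (d + N) \<le> (2 * 1 + 1) * card (?\<kappa> ` words \<I> \<omega> (d + N))"
    unfolding xcount_def
  proof (rule card_grid_le[OF \<eta>_pow(1)])
    fix v w assume v: "v \<in> words \<I> \<omega> (d + N)" and w: "w \<in> words \<I> \<omega> (d + N)" and eq: "?\<kappa> v = ?\<kappa> w"
    have "word_map \<I> v 0 = word_map \<I> (take d v) (word_map \<I> (drop d v) 0)"
      "word_map \<I> w 0 = word_map \<I> (take d v) (word_map \<I> (drop d w) 0)"
      using eq by (metis Pair_inject append_take_drop_id word_map_append)+
    then have "\<bar>word_map \<I> v 0 $ 1 - word_map \<I> w 0 $ 1\<bar>
        = width (take d v) * \<bar>word_map \<I> (drop d v) 0 $ 1 - word_map \<I> (drop d w) 0 $ 1\<bar>"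
      using word_dist_x[OF take_in_words(1)[OF v]] by simp
    also have "\<dots> \<le> 1 * \<eta> ^ n"
      using eq width_bounds[OF take_in_words(1)[OF v]]
      by (intro mult_mono abs_diff_le_if_floor_eq[OF \<eta>_pow(1)]) auto
    finally show "\<bar>word_map \<I> v 0 $ 1 - word_map \<I> w 0 $ 1\<bar> \<le> real 1 * \<eta> ^ n" by simp
  qed simp
  also have "\<dots> \<le> 3 * card (words \<I> \<omega> d \<times> ?X)" using sub by (intro mult_mono card_mono) auto
  finally show ?thesis by (simp add: card_cartesian_product xcount_def mult.assoc)
qed

text \<open>Magnification by \<open>1 / width v\<close> turns intervals of length
  \<open>\<eta> ^ n\<close> into intervals no longer than \<open>\<eta> ^ n'\<close>, so the part of
  the projection below \<open>v\<close> at scale \<open>n\<close> is as rich as the shifted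
  projection at scale \<open>n'\<close>.\<close>

lemma xcount_subcylinder:
  assumes v: "v \<in> words \<I> \<omega> d" and le: "\<eta> ^ n \<le> \<eta> ^ n' * width v"
  shows "xcount (shift d \<omega>) n' N \<le> 3 * card ((\<lambda>u. \<lfloor>word_map \<I> (v @ u) 0 $ 1 / \<eta> ^ n\<rfloor>) ` words \<I> (shift d \<omega>) N)"
proof -
  have "xcount (shift d \<omega>) n' N \<le> (2 * 1 + 1) * card ((\<lambda>u. \<lfloor>word_map \<I> (v @ u) 0 $ 1 / \<eta> ^ n\<rfloor>) ` words \<I> (shift d \<omega>) N)"
    unfolding xcount_def
  proof (rule card_grid_le[OF \<eta>_pow(1)])
    fix u u' assume "u \<in> words \<I> (shift d \<omega>) N" "u' \<in> words \<I> (shift d \<omega>) N"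
      and eq: "\<lfloor>word_map \<I> (v @ u) 0 $ 1 / \<eta> ^ n\<rfloor> = \<lfloor>word_map \<I> (v @ u') 0 $ 1 / \<eta> ^ n\<rfloor>"
    have "width v * \<bar>word_map \<I> u 0 $ 1 - word_map \<I> u' 0 $ 1\<bar> \<le> \<eta> ^ n"
      using abs_diff_le_if_floor_eq[OF \<eta>_pow(1) eq] by (simp add: word_map_append word_dist_x[OF v])
    also have "\<dots> \<le> width v * \<eta> ^ n'" using le by (simp add: mult.commute)
    finally show "\<bar>word_map \<I> u 0 $ 1 - word_map \<I> u' 0 $ 1\<bar> \<le> real 1 * \<eta> ^ n'"
      using width_bounds(2)[OF v] by simp
  qed simp
  then show ?thesis by simp
qed

lemma xcount_prefix_lower:
  assumes "v \<in> words \<I> \<omega> d" and "\<eta> ^ n \<le> \<eta> ^ n' * width v"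
  shows "xcount (shift d \<omega>) n' N \<le> 3 * xcount \<omega> n (d + N)"
proof -
  have "card ((\<lambda>u. \<lfloor>word_map \<I> (v @ u) 0 $ 1 / \<eta> ^ n\<rfloor>) ` words \<I> (shift d \<omega>) N) \<le> xcount \<omega> n (d + N)"
    unfolding xcount_def using append_in_words[OF assms(1)] by (intro card_mono) auto
  then show ?thesis using xcount_subcylinder[OF assms, of N] by linarith
qed

definition max_symbols :: nat where
  "max_symbols = Max (range (\<lambda>i. card (symbols \<I> i)))"

lemma card_words_le: "card (words \<I> \<omega> d) \<le> max_symbols ^ d"
proof (induction d)
  case (Suc d)
  have "card (words \<I> \<omega> (Suc d)) \<le> card (words \<I> \<omega> d) * card (symbols \<I> (\<omega> d))"
    unfolding words_Suc card_cartesian_product[symmetric] by (intro card_image_le) simp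
  also have "\<dots> \<le> max_symbols ^ d * max_symbols"
    using Suc by (intro mult_mono) (auto simp: max_symbols_def)
  finally show ?case by (simp add: mult.commute)
qed simp

lemma max_symbols_pos: "0 < max_symbols"
  using card_symbols_pos[OF box] Max_ge[of "range (\<lambda>i. card (symbols \<I> i))"]
  unfolding max_symbols_def by (metis finite finite_imageI gr0I le_zero_eq less_not_refl rangeI)

text \<open>\<open>7203 = 49 * 3 * 49\<close>: a change of level, the prefix, and a change of level
  back. The remaining factor is exponential in \<open>d\<close>, hence subexponential in
  \<open>k\<close> when \<open>d\<close> is a small fraction of \<open>k\<close>.\<close>

lemma pcount_shift_upper: "pcount \<omega> n \<le> 7203 * max_symbols ^ d * pcount (shift d \<omega>) n"
proof -
  have "pcount \<omega> n \<le> 49 * xcount \<omega> n (d + depth * n)" by (rule xcount_pcount) simp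
  also have "\<dots> \<le> 49 * (3 * max_symbols ^ d * xcount (shift d \<omega>) n (depth * n))"
    using xcount_prefix_upper[of \<omega> n d "depth * n"] card_words_le[of \<omega> d]
    by (meson le_trans mult_le_mono order_refl)
  also have "\<dots> \<le> 49 * (3 * max_symbols ^ d * (49 * pcount (shift d \<omega>) n))"
    by (intro mult_mono xcount_pcount) auto
  finally show ?thesis by simp
qed

text \<open>One cylinder suffices for a lower bound. Any word of length \<open>d\<close> has width
  at least \<open>\<eta> ^ d\<close>, so the loss is at most \<open>d\<close> scales.\<close>

lemma pcount_shift_lower:
  assumes "d \<le> n"
  shows "pcount (shift d \<omega>) (n - d) \<le> 7203 * pcount \<omega> n"
proof -
  obtain v where v: "v \<in> words \<I> \<omega> d" using words_ne[OF box] by blast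
  have "\<eta> ^ n = \<eta> ^ (n - d) * \<eta> ^ d" using assms by (simp flip: power_add)
  also have "\<dots> \<le> \<eta> ^ (n - d) * width v" using width_bounds(1)[OF v] \<eta> by (intro mult_left_mono) auto
  finally have "xcount (shift d \<omega>) (n - d) (depth * n) \<le> 3 * xcount \<omega> n (d + depth * n)"
    by (rule xcount_prefix_lower[OF v])
  moreover have "pcount (shift d \<omega>) (n - d) \<le> 49 * xcount (shift d \<omega>) (n - d) (depth * n)"
    by (rule xcount_pcount) simp
  moreover have "xcount \<omega> n (d + depth * n) \<le> 49 * pcount \<omega> n" by (rule xcount_pcount) simp
  ultimately show ?thesis by linarith
qed

lemma has_box_dim_proj_iff:
  "has_box_dim (proj_x (carpet \<I> \<omega>)) s \<longleftrightarrow> (\<lambda>n. ln (pcount \<omega> n) / real n) \<longlonglongrightarrow> s * L"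
proof -
  let ?N = "\<lambda>n. card ((\<lambda>t. \<lfloor>t / \<eta> ^ n\<rfloor>) ` proj_x (carpet \<I> \<omega>))"
  have bz: "?N n \<le> 7 * pcount \<omega> n" "pcount \<omega> n \<le> 7 * ?N n" for n
    using xcount_carpet[of n "depth * n" \<omega>] by (simp_all add: pcount_def)
  have Npos: "0 < ?N n" for n using bz(2)[of n] pcount_pos[of \<omega> n] by (intro Nat.gr0I) simp
  have ne: "proj_x (carpet \<I> \<omega>) \<noteq> {}" using carpet_ne[OF box] by (simp add: proj_x_def)
  have "has_box_dim (proj_x (carpet \<I> \<omega>)) s \<longleftrightarrow> (\<lambda>n. ln (?N n) / (real n * - ln \<eta>)) \<longlonglongrightarrow> s"
    by (rule has_box_dim_iff_seq[OF bounded_proj_x_carpet[OF box] ne \<eta>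
        covering_number_grid_bounds[OF bounded_proj_x_carpet[OF box] \<eta>_pow(1)]])
  also have "\<dots> \<longleftrightarrow> (\<lambda>n. ln (pcount \<omega> n) / (real n * L)) \<longlonglongrightarrow> s"
    unfolding L_def[symmetric]
  proof (rule Lim_null_comparison_iff)
    show "(\<lambda>n. ln 7 / (real n * L)) \<longlonglongrightarrow> 0" using L_pos by real_asymp
    fix n
    have "ln (real (?N n)) \<le> ln (7 * real (pcount \<omega> n))"
      using of_nat_mono[OF bz(1)[of n], where 'a = real] Npos[of n] by (intro ln_mono) auto
    moreover have "ln (real (pcount \<omega> n)) \<le> ln (7 * real (?N n))"
      using of_nat_mono[OF bz(2)[of n], where 'a = real] pcount_pos[of \<omega> n] by (intro ln_mono) auto
    ultimately have "\<bar>ln (?N n) - ln (pcount \<omega> n)\<bar> \<le> ln 7"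
      using Npos[of n] pcount_pos[of \<omega> n] by (simp add: ln_mult)
    then have "\<bar>ln (?N n) - ln (pcount \<omega> n)\<bar> / (real n * L) \<le> ln 7 / (real n * L)"
      using L_pos by (intro divide_right_mono) auto
    then show "\<bar>ln (?N n) / (real n * L) - ln (pcount \<omega> n) / (real n * L)\<bar> \<le> ln 7 / (real n * L)"
      using L_pos by (simp add: abs_divide abs_mult flip: diff_divide_distrib)
  qed
  also have "\<dots> \<longleftrightarrow> (\<lambda>n. ln (pcount \<omega> n) / real n) \<longlonglongrightarrow> s * L"
  proof
    assume "(\<lambda>n. ln (pcount \<omega> n) / (real n * L)) \<longlonglongrightarrow> s"
    from tendsto_mult_right[OF this, of L] show "(\<lambda>n. ln (pcount \<omega> n) / real n) \<longlonglongrightarrow> s * L"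
      using L_pos by (simp add: field_simps)
  next
    assume "(\<lambda>n. ln (pcount \<omega> n) / real n) \<longlonglongrightarrow> s * L"
    from tendsto_divide[OF this tendsto_const[of L]] show "(\<lambda>n. ln (pcount \<omega> n) / (real n * L)) \<longlonglongrightarrow> s"
      using L_pos by simp
  qed
  finally show ?thesis .
qed

subsection \<open>Tempered growth of the projected counts along the orbit\<close>

text \<open>The error is relative to \<open>k\<close>, not to \<open>n\<close>, because small
  \<open>n\<close> occur as well: they belong to cylinders that are nearly square.
  \<open>Suc k\<close> leaves room for rounding a scale up.\<close>

definition tempered :: "(nat \<Rightarrow> 'i) \<Rightarrow> real \<Rightarrow> bool" where
  "tempered \<omega> s \<longleftrightarrow> (\<forall>\<epsilon>>0. \<forall>\<^sub>F k in sequentially. \<forall>n\<le>Suc k. \<bar>ln (pcount (shift k \<omega>) n) - s * L * real n\<bar> \<le> \<epsilon> * real k)"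

text \<open>The threshold \<open>M\<close> is common to all \<open>k\<close>. Below it the trivial
  bounds cost a constant; above it the estimate at time \<open>k + d\<close> is carried back to time
  \<open>k\<close> across a prefix of length \<open>d\<close>.\<close>

lemma tempered_if_good_times:
  assumes good: "\<And>\<epsilon>. 0 < \<epsilon> \<Longrightarrow> \<exists>M. \<forall>\<^sub>F k in sequentially. \<exists>d. real d \<le> \<epsilon> * real k \<and>
      (\<forall>n\<ge>M. \<bar>ln (pcount (shift (k + d) \<omega>) n) - s * L * real n\<bar> \<le> \<epsilon> * real n)"
  shows "tempered \<omega> s"
  unfolding tempered_def
proof (intro allI impI)
  fix \<epsilon>0 :: real assume \<epsilon>0: "0 < \<epsilon>0"
  \<comment> \<open>The three coefficients of \<open>\<epsilon> * real k\<close> that arise: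
    \<open>ln (real max_symbols)\<close> from removing \<open>d\<close> letters, 1 from the error at
    the good time, and \<open>\<bar>s\<bar> * L\<close> from the \<open>d\<close> scales lost in the
    lower bound. With \<open>\<epsilon>0 / (2 * D)\<close> they use half of the allowance, and
    \<open>C\<close> has the other half.\<close>
  define D where "D = ln (real max_symbols) + 1 + \<bar>s\<bar> * L"
  have lnK: "0 \<le> ln (real max_symbols)" using max_symbols_pos by simp
  then have D: "0 < D" using L_pos by (simp add: D_def add_nonneg_pos add_pos_nonneg)
  define \<epsilon> where "\<epsilon> = \<epsilon>0 / (2 * D)"
  have \<epsilon>: "0 < \<epsilon>" using \<epsilon>0 D by (simp add: \<epsilon>_def)
  obtain M where M: "\<forall>\<^sub>F k in sequentially. \<exists>d. real d \<le> \<epsilon> * real k \<and>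
      (\<forall>n\<ge>M. \<bar>ln (pcount (shift (k + d) \<omega>) n) - s * L * real n\<bar> \<le> \<epsilon> * real n)"
    using good[OF \<epsilon>] by blast
  \<comment> \<open>Bounded costs: the factor of the shift lemmas, the excess of
    \<open>n \<le> Suc k\<close> over \<open>k\<close>, and the trivial bounds for scales below
    \<open>M\<close>.\<close>
  define C where "C = ln 7203 + \<epsilon> + \<bar>s\<bar> * L * real M + real M * L + ln 2"
  have C': "\<epsilon> * D * real k + C \<le> \<epsilon>0 * real k" if "2 * C \<le> \<epsilon>0 * real k" for k
    using that D by (simp add: \<epsilon>_def)
  have "\<forall>\<^sub>F k in sequentially. 2 * C \<le> \<epsilon>0 * real k" using \<epsilon>0 by real_asymp
  with M show "\<forall>\<^sub>F k in sequentially. \<forall>n\<le>Suc k. \<bar>ln (pcount (shift k \<omega>) n) - s * L * real n\<bar> \<le> \<epsilon>0 * real k"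
  proof eventually_elim
    case (elim k)
    then obtain d where d: "real d \<le> \<epsilon> * real k"
      and dn: "\<And>n. M \<le> n \<Longrightarrow> \<bar>ln (pcount (shift (k + d) \<omega>) n) - s * L * real n\<bar> \<le> \<epsilon> * real n" by blast
    let ?pcount = "\<lambda>n. ln (real (pcount (shift k \<omega>) n))" and ?z' = "\<lambda>n. ln (real (pcount (shift (k + d) \<omega>) n))"
    have up: "?pcount n \<le> ln 7203 + real d * ln (real max_symbols) + ?z' n" for n
    proof -
      have "real (pcount (shift k \<omega>) n) \<le> 7203 * real max_symbols ^ d * real (pcount (shift (k + d) \<omega>) n)"
        using of_nat_mono[OF pcount_shift_upper[of "shift k \<omega>" n d], where 'a = real] by simp
      then have "?pcount n \<le> ln (7203 * real max_symbols ^ d * real (pcount (shift (k + d) \<omega>) n))"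
        using pcount_pos by (intro ln_mono) auto
      then show ?thesis using pcount_pos max_symbols_pos by (simp add: ln_mult ln_realpow)
    qed
    have lo: "?z' (n - d) - ln 7203 \<le> ?pcount n" if "d \<le> n" for n
    proof -
      have "real (pcount (shift (k + d) \<omega>) (n - d)) \<le> 7203 * real (pcount (shift k \<omega>) n)"
        using of_nat_mono[OF pcount_shift_lower[OF that, of "shift k \<omega>"], where 'a = real] by simp
      then have "?z' (n - d) \<le> ln (7203 * real (pcount (shift k \<omega>) n))"
        using pcount_pos by (intro ln_mono) auto
      then show ?thesis using pcount_pos by (simp add: ln_mult)
    qed
    have dK: "real d * ln (real max_symbols) \<le> \<epsilon> * real k * ln (real max_symbols)"
      using d lnK by (rule mult_right_mono)
    have sd: "\<bar>s\<bar> * L * real d \<le> \<bar>s\<bar> * L * (\<epsilon> * real k)"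
      using d L_pos by (intro mult_left_mono) auto
    have sM: "0 \<le> \<bar>s\<bar> * L * real M" "0 \<le> real M * L" using L_pos by auto
    have s_le: "\<bar>s * L * real n\<bar> \<le> \<bar>s\<bar> * L * real m" if "n \<le> m" for n m
      using that L_pos by (simp add: abs_mult mult_left_mono)
    have eD: "\<epsilon> * D * real k = \<epsilon> * real k * ln (real max_symbols) + \<epsilon> * real k + \<bar>s\<bar> * L * (\<epsilon> * real k)"
      by (simp add: D_def algebra_simps)
    have \<epsilon>k: "0 \<le> \<epsilon> * real k" "0 \<le> \<epsilon> * real k * ln (real max_symbols)" "0 \<le> \<bar>s\<bar> * L * (\<epsilon> * real k)"
      using \<epsilon> lnK L_pos by auto
    have ln7: "0 \<le> ln (7203::real)" "0 \<le> ln (2::real)" by auto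
    show ?case
    proof (intro allI impI)
      fix n assume n: "n \<le> Suc k"
      have \<epsilon>n: "\<epsilon> * real m \<le> \<epsilon> * real k + \<epsilon>" if "m \<le> n" for m
        using mult_left_mono[of "real m" "real k + 1" \<epsilon>] that n \<epsilon> by (simp add: algebra_simps)
      have "?pcount n - s * L * real n \<le> \<epsilon> * D * real k + C"
      proof (cases "M \<le> n")
        case True
        then show ?thesis using up[of n] dn[OF True] dK \<epsilon>n[of n] sM eD \<epsilon>k ln7 unfolding C_def by linarith
      next
        case False
        then have "real n * L \<le> real M * L" using L_pos by simp
        then have "?pcount n \<le> real M * L + ln 2"
          using ln_pcount_bounds(2)[of "shift k \<omega>" n] by linarith
        then show ?thesis using s_le[of n M] False sM eD \<epsilon>k ln7 \<epsilon> unfolding C_def by linarith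
      qed
      moreover have "s * L * real n - ?pcount n \<le> \<epsilon> * D * real k + C"
      \<comment> \<open>The lower bound uses the good time at scale \<open>n - d\<close>, so its
        threshold is \<open>d + M\<close>. Below that, \<open>s * L * real n\<close> itself is small
        enough and the count is only known to be at least 1.\<close>
      proof (cases "d + M \<le> n")
        case True
        then have "M \<le> n - d" "d \<le> n" by auto
        moreover have "s * L * real n = s * L * real (n - d) + s * L * real d"
          using \<open>d \<le> n\<close> by (simp add: of_nat_diff algebra_simps)
        ultimately show ?thesis
          using lo[of n] dn[of "n - d"] \<epsilon>n[of "n - d"] s_le[of d d] sd sM eD \<epsilon>k ln7 unfolding C_def by linarith
      next
        case False
        then have "\<bar>s * L * real n\<bar> \<le> \<bar>s\<bar> * L * real d + \<bar>s\<bar> * L * real M"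
          using s_le[of n "d + M"] by (simp add: algebra_simps)
        then show ?thesis using ln_pcount_bounds(1)[of "shift k \<omega>" n] sd sM eD \<epsilon>k ln7 \<epsilon> unfolding C_def by linarith
      qed
      ultimately show "\<bar>?pcount n - s * L * real n\<bar> \<le> \<epsilon>0 * real k"
        using C'[OF elim(2)] by linarith
    qed
  qed
qed

subsection \<open>Constant sequences\<close>

text \<open>
  Supermultiplicativity: one cylinder of width comparable to \<open>\<eta>\<^sup>n\<close> is chosen in each occupied
  \<open>\<eta>\<^sup>n\<close>-interval, so that the cylinders overlap boundedly often although the projected system
  need not satisfy any separation condition.
\<close>

lemma pcount_const_supermult:
  fixes i :: 'i
  defines "\<omega> \<equiv> \<lambda>_::nat. i"
  shows "pcount \<omega> n * pcount \<omega> m \<le> 1029 * pcount \<omega> (n + m + 1)"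
proof -
  define N where "N = depth * (n + m + 1)"
  define W where "W = words \<I> \<omega> (depth * n)"
  define \<phi> where "\<phi> w = \<lfloor>word_map \<I> w 0 $ 1 / \<eta> ^ n\<rfloor>" for w
  have sh: "shift d \<omega> = \<omega>" for d by (simp add: \<omega>_def)
  have "\<exists>j. j \<le> depth * n \<and> width (take j w) \<le> \<eta> ^ n \<and> \<eta> ^ (n + 1) \<le> width (take j w)" if w: "w \<in> W" for w
  proof -
    let ?P = "\<lambda>j. width (take j w) \<le> \<eta> ^ n"
    have len: "length w = depth * n" using w by (simp add: W_def words_def)
    have P: "?P (depth * n)" using width_le_if_depth[of n "depth * n" w \<omega>] w len by (simp add: W_def)
    \<comment> \<open>Stopping at the first prefix of width at most \<open>\<eta> ^ n\<close>: its
      last letter shrinks the width by no more than \<eta>, so the width is still at least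
      \<open>\<eta> ^ (n + 1)\<close>.\<close>
    define j where "j = (LEAST j. ?P j)"
    have j: "?P j" "j \<le> depth * n" unfolding j_def using P by (rule LeastI, rule Least_le)
    have "\<eta> ^ (n + 1) \<le> width (take j w)"
    proof (cases j)
      case 0
      then show ?thesis using \<eta>_pow(2)[of "n + 1"] by simp
    next
      case (Suc j')
      then have "\<not> ?P j'" using not_less_Least[of j' ?P] by (simp add: j_def)
      have "w ! j' \<in> symbols \<I> i" using w Suc j(2) by (auto simp: W_def words_def \<omega>_def)
      then have "\<eta> ^ n * \<eta> \<le> width (take j' w) * ratio_x \<I> (w ! j')"
        using \<open>\<not> ?P j'\<close> \<eta> ratio_x_ge by (intro mult_mono) (auto intro: order_trans[OF less_imp_le[OF \<eta>_pow(1)[of n]]])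
      also have "\<dots> = width (take j w)"
        using Suc j(2) len by (simp add: take_Suc_conv_app_nth width_append width_def)
      finally show ?thesis by (simp add: mult.commute)
    qed
    with j show ?thesis by blast
  qed
  then have "\<forall>w\<in>W. \<exists>j. j \<le> depth * n \<and> width (take j w) \<le> \<eta> ^ n \<and> \<eta> ^ (n + 1) \<le> width (take j w)" by blast
  from bchoice[OF this] obtain J where
    J: "\<And>w. w \<in> W \<Longrightarrow> J w \<le> depth * n \<and> width (take (J w) w) \<le> \<eta> ^ n \<and> \<eta> ^ (n + 1) \<le> width (take (J w) w)"
    by blast
  \<comment> \<open>One representative word for each occupied interval \<open>q\<close>; its stopped
    prefix \<open>v q\<close> is the chosen cylinder.\<close>
  define r where "r q = (SOME w. w \<in> W \<and> \<phi> w = q)" for q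
  have r: "r q \<in> W \<and> \<phi> (r q) = q" if "q \<in> \<phi> ` W" for q
    unfolding r_def by (rule someI_ex) (use that in blast)
  define v where "v q = take (J (r q)) (r q)" for q
  define j where "j q = J (r q)" for q
  have W_split: "w \<in> words \<I> \<omega> (J w + (depth * n - J w))" if "w \<in> W" for w
    using J[OF that] that by (simp add: W_def)
  have v: "v q \<in> words \<I> \<omega> (j q)" "drop (j q) (r q) \<in> words \<I> \<omega> (depth * n - j q)" if "q \<in> \<phi> ` W" for q
    using take_in_words[OF W_split[of "r q"]] r[OF that] by (auto simp: v_def j_def sh)
  have jN: "j q \<le> depth * n" "width (v q) \<le> \<eta> ^ n" "\<eta> ^ (n + 1) \<le> width (v q)" if "q \<in> \<phi> ` W" for q
    using J[of "r q"] r[OF that] by (auto simp: v_def j_def)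
  have Nge: "depth * m + depth * n \<le> N" by (simp add: N_def algebra_simps)
  \<comment> \<open>The intervals occupied by descendants of \<open>v q\<close>. The extra 1 in the
    scale pays for a width that may be as small as \<open>\<eta> ^ (n + 1)\<close>.\<close>
  define S where "S q = (\<lambda>u. \<lfloor>word_map \<I> (v q @ u) 0 $ 1 / \<eta> ^ (n + m + 1)\<rfloor>) ` words \<I> \<omega> (N - j q)" for q
  have zS: "pcount \<omega> m \<le> 147 * card (S q)" if q: "q \<in> \<phi> ` W" for q
  proof -
    have "\<eta> ^ (n + m + 1) = \<eta> ^ m * \<eta> ^ (n + 1)" by (simp add: power_add)
    also have "\<dots> \<le> \<eta> ^ m * width (v q)" using jN[OF q] \<eta> by (intro mult_left_mono) auto
    finally have "xcount (shift (j q) \<omega>) m (N - j q) \<le> 3 * card (S q)"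
      unfolding S_def using xcount_subcylinder[OF v(1)[OF q], of "n + m + 1" m "N - j q"] by (simp add: sh)
    moreover have "pcount \<omega> m \<le> 49 * xcount \<omega> m (N - j q)" using Nge jN(1)[OF q] by (intro xcount_pcount) linarith
    ultimately show ?thesis by (simp add: sh)
  qed
  have close: "\<bar>word_map \<I> (v q @ u) 0 $ 1 - word_map \<I> (r q) 0 $ 1\<bar> \<le> \<eta> ^ n"
    if q: "q \<in> \<phi> ` W" and u: "u \<in> words \<I> \<omega> (N - j q)" for q u
  proof -
    have "word_map \<I> (r q) 0 = word_map \<I> (v q) (word_map \<I> (drop (j q) (r q)) 0)"
      unfolding v_def j_def by (metis append_take_drop_id word_map_append)
    then show ?thesis
      using word_dist_x_le[OF v(1)[OF q] word_zero_in_unit_square[OF u] word_zero_in_unit_square[OF v(2)[OF q]]] jN(2)[OF q]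
      by (simp add: word_map_append)
  qed
  \<comment> \<open>If two chosen cylinders share an interval, their representatives are within
    \<open>3 * \<eta> ^ n\<close>: each is within \<open>\<eta> ^ n\<close> of a descendant, and the
    two descendants are at most \<open>\<eta> ^ n\<close> apart. The indices then differ by at most
    3. Together with 147 this overlap gives \<open>1029 = 147 * 7\<close>.\<close>
  have mult: "card {q \<in> \<phi> ` W. y \<in> S q} \<le> 7" for y
  proof -
    have "finite {q \<in> \<phi> ` W. y \<in> S q} \<and> card {q \<in> \<phi> ` W. y \<in> S q} \<le> 2 * 3 + 1"
    proof (rule card_int_le_if_close)
      fix q q' assume "q \<in> {q \<in> \<phi> ` W. y \<in> S q}" "q' \<in> {q \<in> \<phi> ` W. y \<in> S q}"
      then have q: "q \<in> \<phi> ` W" "q' \<in> \<phi> ` W" "y \<in> S q" "y \<in> S q'" by auto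
      obtain u where u: "u \<in> words \<I> \<omega> (N - j q)" "y = \<lfloor>word_map \<I> (v q @ u) 0 $ 1 / \<eta> ^ (n + m + 1)\<rfloor>"
        using q(3) by (auto simp: S_def)
      obtain u' where u': "u' \<in> words \<I> \<omega> (N - j q')" "y = \<lfloor>word_map \<I> (v q' @ u') 0 $ 1 / \<eta> ^ (n + m + 1)\<rfloor>"
        using q(4) by (auto simp: S_def)
      have "\<bar>word_map \<I> (v q @ u) 0 $ 1 - word_map \<I> (v q' @ u') 0 $ 1\<bar> \<le> \<eta> ^ (n + m + 1)"
        using u(2) u'(2) by (intro abs_diff_le_if_floor_eq[OF \<eta>_pow(1)]) simp
      also have "\<dots> \<le> \<eta> ^ n" using \<eta> by (intro power_decreasing) auto
      finally have "\<bar>word_map \<I> (r q) 0 $ 1 - word_map \<I> (r q') 0 $ 1\<bar> \<le> of_int 3 * \<eta> ^ n"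
        using close[OF q(1) u(1)] close[OF q(2) u'(1)] by simp
      from floor_divide_diff_le[OF \<eta>_pow(1) this] show "\<bar>q - q'\<bar> \<le> int 3"
        using r[OF q(1)] r[OF q(2)] by (simp add: \<phi>_def)
    qed
    then show ?thesis by simp
  qed
  have sub: "(\<Union>q\<in>\<phi> ` W. S q) \<subseteq> (\<lambda>w. \<lfloor>word_map \<I> w 0 $ 1 / \<eta> ^ (n + m + 1)\<rfloor>) ` words \<I> \<omega> N"
  proof (rule UN_least)
    fix q assume q: "q \<in> \<phi> ` W"
    have "j q + (N - j q) = N" using Nge jN(1)[OF q] by linarith
    then have "v q @ u \<in> words \<I> \<omega> N" if "u \<in> words \<I> \<omega> (N - j q)" for u
      using append_in_words[OF v(1)[OF q], of u "N - j q"] that by (simp add: sh)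
    then show "S q \<subseteq> (\<lambda>w. \<lfloor>word_map \<I> w 0 $ 1 / \<eta> ^ (n + m + 1)\<rfloor>) ` words \<I> \<omega> N"
      by (auto simp: S_def)
  qed
  have "pcount \<omega> n * pcount \<omega> m = (\<Sum>q\<in>\<phi> ` W. pcount \<omega> m)" by (simp add: pcount_def xcount_def \<phi>_def W_def)
  also have "\<dots> \<le> (\<Sum>q\<in>\<phi> ` W. 147 * card (S q))" by (intro sum_mono zS)
  also have "\<dots> = 147 * (\<Sum>q\<in>\<phi> ` W. card (S q))" by (simp add: sum_distrib_left)
  also have "\<dots> \<le> 147 * (7 * card (\<Union>q\<in>\<phi> ` W. S q))"
    using mult by (intro mult_left_mono sum_card_le_mult) (auto simp: W_def S_def)
  also have "\<dots> \<le> 147 * (7 * pcount \<omega> (n + m + 1))"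
    unfolding pcount_def xcount_def N_def[symmetric] using sub by (intro mult_left_mono card_mono) auto
  finally show ?thesis by simp
qed

lemma pcount_const_growth: "\<exists>s. (\<lambda>n. ln (pcount (\<lambda>_. i) n) / real n) \<longlonglongrightarrow> s * L"
proof -
  let ?a = "\<lambda>n. ln (real (pcount (\<lambda>_. i) n))"
  \<comment> \<open>The index shift absorbs the additional scale in
    \<open>pcount_const_supermult\<close>, since \<open>(m - 1) + (n - 1) + 1 = (m + n) - 1\<close>,
    and the subtracted constant absorbs the factor.\<close>
  define h where "h n = ?a (n - 1) - ln 1029" for n
  have "\<exists>l. (\<lambda>n. h n / real n) \<longlonglongrightarrow> l"
  proof (rule superadditive_tendsto)
    fix m n :: nat assume mn: "1 \<le> m" "1 \<le> n"
    have eq: "m - 1 + (n - 1) + 1 = m + n - 1" using mn by simp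
    have "real (pcount (\<lambda>_. i) (m - 1)) * real (pcount (\<lambda>_. i) (n - 1)) \<le> 1029 * real (pcount (\<lambda>_. i) (m + n - 1))"
      using of_nat_mono[OF pcount_const_supermult[of i "m - 1" "n - 1"], where 'a = real] by (simp only: eq) simp
    then have "ln (real (pcount (\<lambda>_. i) (m - 1)) * real (pcount (\<lambda>_. i) (n - 1))) \<le> ln (1029 * real (pcount (\<lambda>_. i) (m + n - 1)))"
      using pcount_pos by (intro ln_mono) auto
    then show "h m + h n \<le> h (m + n)" using pcount_pos by (simp add: h_def ln_mult)
  next
    fix n :: nat assume n: "1 \<le> n"
    have "h n \<le> real (n - 1) * L + ln 2"
      using ln_pcount_bounds(2)[of "\<lambda>_. i" "n - 1"] by (simp add: h_def) (smt (verit) ln_ge_zero)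
    also have "\<dots> \<le> real n * L + real n * ln 2" using n L_pos by (intro add_mono mult_right_mono) auto
    finally show "h n \<le> (L + ln 2) * real n" by (simp add: algebra_simps)
  qed
  then obtain l where l: "(\<lambda>n. h n / real n) \<longlonglongrightarrow> l" by blast
  have "(\<lambda>n. h (Suc n) / real (Suc n) * (real (Suc n) / real n) + ln 1029 / real n) \<longlonglongrightarrow> l * 1 + 0"
    by (intro tendsto_add tendsto_mult LIMSEQ_Suc[OF l]) real_asymp+
  moreover have "\<forall>\<^sub>F n in sequentially. h (Suc n) / real (Suc n) * (real (Suc n) / real n) + ln 1029 / real n = ?a n / real n"
    using eventually_gt_at_top[of 0]
  proof eventually_elim
    case (elim n)
    then have "h (Suc n) / real (Suc n) * (real (Suc n) / real n) = h (Suc n) / real n" by simp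
    also have "\<dots> = ?a n / real n - ln 1029 / real n" by (simp add: h_def diff_divide_distrib)
    finally show ?case by simp
  qed
  ultimately have "(\<lambda>n. ?a n / real n) \<longlonglongrightarrow> l * 1 + 0" by (rule Lim_transform_eventually)
  then show ?thesis using L_pos by (intro exI[of _ "l / L"]) simp
qed

lemma abs_ln_pcount_le_if_growth:
  assumes "(\<lambda>n. ln (pcount \<omega> n) / real n) \<longlonglongrightarrow> s * L" "0 < \<epsilon>"
  shows "\<exists>M. \<forall>n\<ge>M. \<bar>ln (pcount \<omega> n) - s * L * real n\<bar> \<le> \<epsilon> * real n"
proof -
  obtain M where M: "\<And>n. M \<le> n \<Longrightarrow> \<bar>ln (pcount \<omega> n) / real n - s * L\<bar> < \<epsilon>"
    using LIMSEQ_D[OF assms] by auto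
  have "\<bar>ln (pcount \<omega> n) - s * L * real n\<bar> \<le> \<epsilon> * real n" if "M + 1 \<le> n" for n
  proof -
    have "ln (pcount \<omega> n) - s * L * real n = (ln (pcount \<omega> n) / real n - s * L) * real n"
      using that by (simp add: field_simps)
    also have "\<bar>\<dots>\<bar> \<le> \<epsilon> * real n"
      unfolding abs_mult using M[of n] that by (intro mult_mono) auto
    finally show ?thesis .
  qed
  then show ?thesis by blast
qed

text \<open>A constant sequence is fixed by the shift, so every time is good and
  \<open>d = 0\<close> works.\<close>

lemma tempered_const:
  assumes "(\<lambda>n. ln (pcount (\<lambda>_. i) n) / real n) \<longlonglongrightarrow> s * L"
  shows "tempered (\<lambda>_. i) s"
proof (rule tempered_if_good_times)
  fix \<epsilon> :: real assume "0 < \<epsilon>"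
  from abs_ln_pcount_le_if_growth[OF assms this] obtain M where
    "\<forall>n\<ge>M. \<bar>ln (pcount (\<lambda>_. i) n) - s * L * real n\<bar> \<le> \<epsilon> * real n" by blast
  with \<open>0 < \<epsilon>\<close> show "\<exists>M. \<forall>\<^sub>F k in sequentially. \<exists>d. real d \<le> \<epsilon> * real k \<and>
      (\<forall>n\<ge>M. \<bar>ln (pcount (shift (k + d) (\<lambda>_. i)) n) - s * L * real n\<bar> \<le> \<epsilon> * real n)"
    by (intro exI[of _ M] always_eventually allI exI[of _ 0]) auto
qed

subsection \<open>The dimension formula\<close>

definition gcount :: "(nat \<Rightarrow> 'i) \<Rightarrow> nat \<Rightarrow> nat \<Rightarrow> nat" where
  "gcount \<omega> k N = card ((\<lambda>w. cell (\<eta> ^ k) (word_map \<I> w 0)) ` words \<I> \<omega> N)"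

lemma gcount_carpet:
  assumes "depth * k \<le> N" "k \<le> N"
  shows "card (cell (\<eta> ^ k) ` carpet \<I> \<omega>) \<le> 49 * gcount \<omega> k N"
    and "gcount \<omega> k N \<le> 49 * card (cell (\<eta> ^ k) ` carpet \<I> \<omega>)"
proof -
  have close: "\<bar>word_map \<I> w x $ i - word_map \<I> w y $ i\<bar> \<le> \<eta> ^ k"
    if "w \<in> words \<I> \<omega> N" "x \<in> unit_square" "y \<in> unit_square" for w x y i
  proof -
    have "\<eta> ^ N \<le> \<eta> ^ k" using assms(2) \<eta> by (intro power_decreasing) auto
    then have "\<bar>word_map \<I> w x $ 2 - word_map \<I> w y $ 2\<bar> \<le> \<eta> ^ k"
      using word_dist_y_le[OF that] by linarith
    moreover have "\<bar>word_map \<I> w x $ 1 - word_map \<I> w y $ 1\<bar> \<le> \<eta> ^ k"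
      using word_dist_x_le[OF that] width_le_if_depth[OF assms(1) that(1)] by linarith
    ultimately show ?thesis using exhaust_2[of i] by auto
  qed
  show "card (cell (\<eta> ^ k) ` carpet \<I> \<omega>) \<le> 49 * gcount \<omega> k N"
    unfolding gcount_def by (rule carpet_cells(1)[OF box \<eta>_pow(1) close])
  show "gcount \<omega> k N \<le> 49 * card (cell (\<eta> ^ k) ` carpet \<I> \<omega>)"
    unfolding gcount_def by (rule carpet_cells(2)[OF box \<eta>_pow(1) close])
qed

text \<open>A cylinder of level \<open>k\<close> is as high as a grid cell, so only its horizontal
  extent matters, and \<open>v\<close> contracts the scale \<open>\<nu> v\<close> of the shifted
  projection to at most the cell size.\<close>

lemma gcount_upper:
  assumes "\<And>v. v \<in> words \<I> \<omega> k \<Longrightarrow> \<eta> ^ \<nu> v * width v \<le> \<eta> ^ k"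
  shows "gcount \<omega> k (k + m) \<le> (\<Sum>v\<in>words \<I> \<omega> k. 9 * xcount (shift k \<omega>) (\<nu> v) m)"
proof -
  let ?S = "\<lambda>v. (\<lambda>u. cell (\<eta> ^ k) (word_map \<I> (v @ u) 0)) ` words \<I> (shift k \<omega>) m"
  have sub: "(\<lambda>w. cell (\<eta> ^ k) (word_map \<I> w 0)) ` words \<I> \<omega> (k + m) \<subseteq> (\<Union>v\<in>words \<I> \<omega> k. ?S v)"
  proof (rule image_subsetI)
    fix w assume w: "w \<in> words \<I> \<omega> (k + m)"
    have "cell (\<eta> ^ k) (word_map \<I> w 0) \<in> ?S (take k w)"
      using take_in_words(2)[OF w] by (intro image_eqI[of _ _ "drop k w"]) simp_all
    then show "cell (\<eta> ^ k) (word_map \<I> w 0) \<in> (\<Union>v\<in>words \<I> \<omega> k. ?S v)"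
      using take_in_words(1)[OF w] by blast
  qed
  have S: "card (?S v) \<le> 9 * xcount (shift k \<omega>) (\<nu> v) m" if v: "v \<in> words \<I> \<omega> k" for v
  proof -
    have "card (?S v) \<le> (2 * 1 + 1)\<^sup>2 * card ((\<lambda>u. \<lfloor>word_map \<I> u 0 $ 1 / \<eta> ^ \<nu> v\<rfloor>) ` words \<I> (shift k \<omega>) m)"
    proof (rule card_cell_le[OF \<eta>_pow(1)])
      fix u u' i assume u: "u \<in> words \<I> (shift k \<omega>) m" "u' \<in> words \<I> (shift k \<omega>) m"
        and eq: "\<lfloor>word_map \<I> u 0 $ 1 / \<eta> ^ \<nu> v\<rfloor> = \<lfloor>word_map \<I> u' 0 $ 1 / \<eta> ^ \<nu> v\<rfloor>"
      have "\<bar>word_map \<I> (v @ u) 0 $ 1 - word_map \<I> (v @ u') 0 $ 1\<bar> \<le> width v * \<eta> ^ \<nu> v"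
        unfolding word_map_append word_dist_x[OF v]
        using abs_diff_le_if_floor_eq[OF \<eta>_pow(1) eq] width_bounds(2)[OF v] by (intro mult_left_mono) auto
      also have "\<dots> \<le> \<eta> ^ k" using assms[OF v] by (simp add: mult.commute)
      finally have 1: "\<bar>word_map \<I> (v @ u) 0 $ 1 - word_map \<I> (v @ u') 0 $ 1\<bar> \<le> \<eta> ^ k" .
      have 2: "\<bar>word_map \<I> (v @ u) 0 $ 2 - word_map \<I> (v @ u') 0 $ 2\<bar> \<le> \<eta> ^ k"
        unfolding word_map_append by (intro word_dist_y_le[OF v] word_zero_in_unit_square[OF u(1)] word_zero_in_unit_square[OF u(2)])
      show "\<bar>word_map \<I> (v @ u) 0 $ i - word_map \<I> (v @ u') 0 $ i\<bar> \<le> real 1 * \<eta> ^ k"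
        using 1 2 exhaust_2[of i] by auto
    qed simp
    then show ?thesis by (simp add: xcount_def)
  qed
  have "gcount \<omega> k (k + m) \<le> card (\<Union>v\<in>words \<I> \<omega> k. ?S v)"
    unfolding gcount_def using sub by (intro card_mono) auto
  also have "\<dots> \<le> (\<Sum>v\<in>words \<I> \<omega> k. card (?S v))" by (intro card_UN_le) simp
  also have "\<dots> \<le> (\<Sum>v\<in>words \<I> \<omega> k. 9 * xcount (shift k \<omega>) (\<nu> v) m)" by (intro sum_mono S)
  finally show ?thesis .
qed

text \<open>Here the UORC enters: the cylinders of level \<open>k\<close> have disjoint interiors
  and both sides at least \<open>\<eta> ^ k\<close>, so a cell meets at most 36 of them.
  \<open>108 = 3 * 36\<close>.\<close>

lemma gcount_lower:
  assumes "\<And>v. v \<in> words \<I> \<omega> k \<Longrightarrow> \<eta> ^ k \<le> \<eta> ^ \<nu> v * width v"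
  shows "(\<Sum>v\<in>words \<I> \<omega> k. xcount (shift k \<omega>) (\<nu> v) m) \<le> 108 * gcount \<omega> k (k + m)"
proof -
  let ?S = "\<lambda>v. (\<lambda>u. cell (\<eta> ^ k) (word_map \<I> (v @ u) 0)) ` words \<I> (shift k \<omega>) m"
  have S: "xcount (shift k \<omega>) (\<nu> v) m \<le> 3 * card (?S v)" if v: "v \<in> words \<I> \<omega> k" for v
  proof -
    have "xcount (shift k \<omega>) (\<nu> v) m \<le> (2 * 1 + 1) * card (?S v)"
      unfolding xcount_def
    proof (rule card_grid_le[OF \<eta>_pow(1)])
      fix u u' assume u: "u \<in> words \<I> (shift k \<omega>) m" "u' \<in> words \<I> (shift k \<omega>) m"
        and eq: "cell (\<eta> ^ k) (word_map \<I> (v @ u) 0) = cell (\<eta> ^ k) (word_map \<I> (v @ u') 0)"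
      have "width v * \<bar>word_map \<I> u 0 $ 1 - word_map \<I> u' 0 $ 1\<bar> \<le> \<eta> ^ k"
        using abs_diff_le_if_cell_eq[OF \<eta>_pow(1) eq, of 1] by (simp add: word_map_append word_dist_x[OF v])
      also have "\<dots> \<le> width v * \<eta> ^ \<nu> v" using assms[OF v] by (simp add: mult.commute)
      finally show "\<bar>word_map \<I> u 0 $ 1 - word_map \<I> u' 0 $ 1\<bar> \<le> real 1 * \<eta> ^ \<nu> v"
        using width_bounds(2)[OF v] by simp
    qed simp
    then show ?thesis by simp
  qed
  have mult: "card {v \<in> words \<I> \<omega> k. q \<in> ?S v} \<le> 36" for q
  proof -
    have "{v \<in> words \<I> \<omega> k. q \<in> ?S v} \<subseteq> {v \<in> words \<I> \<omega> k. \<exists>x\<in>unit_square. cell (\<eta> ^ k) (word_map \<I> v x) = q}"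
      using word_zero_in_unit_square by (auto simp: word_map_append simp del: mem_box_cart)
    then have "card {v \<in> words \<I> \<omega> k. q \<in> ?S v} \<le> card {v \<in> words \<I> \<omega> k. \<exists>x\<in>unit_square. cell (\<eta> ^ k) (word_map \<I> v x) = q}"
      by (intro card_mono) auto
    also have "\<dots> \<le> 36"
    proof (rule card_rectangles_meeting_cell[OF \<eta>_pow(1)])
      fix v assume v: "v \<in> words \<I> \<omega> k"
      show "\<exists>A B c d. \<eta> ^ k \<le> \<bar>A\<bar> \<and> \<eta> ^ k \<le> \<bar>B\<bar> \<and> (\<forall>x. word_map \<I> v x $ 1 = A * x $ 1 + c \<and> word_map \<I> v x $ 2 = B * x $ 2 + d)"
        using word_coords[OF v] width_bounds(1)[OF v] by (metis order_refl)
    qed (use word_map_disjoint[OF box uorc] in blast)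
    finally show ?thesis .
  qed
  have sub: "(\<Union>v\<in>words \<I> \<omega> k. ?S v) \<subseteq> (\<lambda>w. cell (\<eta> ^ k) (word_map \<I> w 0)) ` words \<I> \<omega> (k + m)"
    using append_in_words by blast
  have "(\<Sum>v\<in>words \<I> \<omega> k. xcount (shift k \<omega>) (\<nu> v) m) \<le> (\<Sum>v\<in>words \<I> \<omega> k. 3 * card (?S v))"
    by (intro sum_mono S)
  also have "\<dots> = 3 * (\<Sum>v\<in>words \<I> \<omega> k. card (?S v))" by (simp add: sum_distrib_left)
  also have "\<dots> \<le> 3 * (36 * card (\<Union>v\<in>words \<I> \<omega> k. ?S v))"
    using mult by (intro mult_left_mono sum_card_le_mult) auto
  also have "\<dots> \<le> 3 * (36 * gcount \<omega> k (k + m))"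
    unfolding gcount_def using sub by (intro mult_left_mono card_mono) auto
  finally show ?thesis by simp
qed

lemma width_powr:
  assumes "w \<in> words \<I> \<omega> k"
  shows "width w powr s = prod_list (map (\<lambda>e. ratio_x \<I> e powr s) w)"
proof -
  have "set w \<subseteq> (\<Union>i. symbols \<I> i) \<Longrightarrow> 0 \<le> width w \<and> width w powr s = prod_list (map (\<lambda>e. ratio_x \<I> e powr s) w)" for w
  proof (induction w)
    case (Cons e w)
    then obtain i where "e \<in> symbols \<I> i" by auto
    then have "0 < ratio_x \<I> e" using ratio_x_bounds by blast
    then show ?case using Cons by (auto simp: width_def powr_mult)
  qed (simp add: width_def)
  then show ?thesis using set_word_subset[OF assms] by blast
qed

lemma sum_powr_pos: "0 < (\<Sum>e\<in>symbols \<I> i. ratio_x \<I> e powr s)"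
  using symbols_ne[OF box] ratio_x_bounds by (intro sum_pos) (auto simp: less_le)

text \<open>A statement about one fixed sequence, so that it serves random and constant sequences
  alike; chance enters only in verifying its two hypotheses.\<close>

lemma carpet_dim:
  assumes temp: "tempered \<omega> s"
    and lim: "(\<lambda>k. (\<Sum>j<k. ln (\<Sum>e\<in>symbols \<I> (\<omega> j). ratio_x \<I> e powr s)) / real k) \<longlonglongrightarrow> E"
  shows "has_box_dim (carpet \<I> \<omega>) (s + E / L)"
proof -
  define S where "S k = (\<Sum>j<k. ln (\<Sum>e\<in>symbols \<I> (\<omega> j). ratio_x \<I> e powr s))" for k
  define N where "N k = card (cell (\<eta> ^ k) ` carpet \<I> \<omega>)" for k
  have sum_width: "(\<Sum>v\<in>words \<I> \<omega> k. width v powr s) = exp (S k)" for k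
  proof -
    have "(\<Sum>v\<in>words \<I> \<omega> k. width v powr s) = (\<Prod>j<k. \<Sum>e\<in>symbols \<I> (\<omega> j). ratio_x \<I> e powr s)"
      unfolding sum_words_prod[symmetric] by (intro sum.cong refl width_powr)
    also have "\<dots> = exp (S k)" unfolding S_def by (simp add: exp_sum sum_powr_pos)
    finally show ?thesis .
  qed
  have close: "\<exists>C. \<forall>\<^sub>F k in sequentially. \<bar>ln (N k) - (s * L * real k + S k)\<bar> \<le> \<epsilon> * real k + C" if \<epsilon>: "0 < \<epsilon>" for \<epsilon>
  proof -
    have "\<forall>\<^sub>F k in sequentially. \<forall>n\<le>Suc k. \<bar>ln (pcount (shift k \<omega>) n) - s * L * real n\<bar> \<le> \<epsilon> * real k"
      using temp \<epsilon> by (auto simp: tempered_def)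
    \<comment> \<open>\<open>259308 = 49 * 49 * 108\<close> is the larger of the two accumulated
      factors, the one of the lower bound; \<open>\<bar>s\<bar> * L\<close> pays for rounding scales
      to integers.\<close>
    then have "\<forall>\<^sub>F k in sequentially. \<bar>ln (N k) - (s * L * real k + S k)\<bar> \<le> \<epsilon> * real k + (ln 259308 + \<bar>s\<bar> * L)"
    proof eventually_elim
      case (elim k)
      \<comment> \<open>Deep enough to resolve the shifted projection at every scale up to
        \<open>Suc k\<close>.\<close>
      define m where "m = depth * Suc k"
      \<comment> \<open>The real exponent for which \<eta> to that power times
        \<open>width v\<close> equals \<open>\<eta> ^ k\<close>. Its floor serves the lower bound
        and the floor plus 1 the upper bound.\<close>
      define \<tau> where "\<tau> v = real k + ln (width v) / L" for v
      define \<nu> where "\<nu> v = nat \<lfloor>\<tau> v\<rfloor>" for v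
      have \<tau>: "real (\<nu> v) \<le> \<tau> v" "\<tau> v \<le> real (\<nu> v) + 1" "\<nu> v \<le> k" if v: "v \<in> words \<I> \<omega> k" for v
      proof -
        have "ln (\<eta> ^ k) \<le> ln (width v)" "ln (width v) \<le> 0"
          using width_bounds[OF v] \<eta>_pow by (auto intro: ln_mono)
        then have "- (real k * L) \<le> ln (width v)" using \<eta> by (simp add: ln_realpow L_def)
        then have "- real k \<le> ln (width v) / L" "ln (width v) / L \<le> 0"
          using \<open>ln (width v) \<le> 0\<close> L_pos by (auto simp: field_simps divide_le_0_iff)
        then have "0 \<le> \<tau> v" "\<tau> v \<le> real k" by (auto simp: \<tau>_def)
        then show "real (\<nu> v) \<le> \<tau> v" "\<tau> v \<le> real (\<nu> v) + 1" "\<nu> v \<le> k" unfolding \<nu>_def by linarith+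
      qed
      have lnw: "ln (\<eta> ^ n * width v) = L * (\<tau> v - real n) + ln (\<eta> ^ k)" if v: "v \<in> words \<I> \<omega> k" for v n
        using width_bounds(2)[OF v] \<eta> L_pos by (simp add: ln_mult ln_realpow \<tau>_def field_simps L_def)
      have ge: "\<eta> ^ k \<le> \<eta> ^ \<nu> v * width v" if v: "v \<in> words \<I> \<omega> k" for v
      proof -
        have "0 \<le> L * (\<tau> v - real (\<nu> v))" using \<tau>[OF v] L_pos by simp
        then have "ln (\<eta> ^ k) \<le> ln (\<eta> ^ \<nu> v * width v)" using lnw[OF v, of "\<nu> v"] by linarith
        then show ?thesis using \<eta>_pow width_bounds(2)[OF v] by (subst (asm) ln_le_cancel_iff) auto
      qed
      have le: "\<eta> ^ (\<nu> v + 1) * width v \<le> \<eta> ^ k" if v: "v \<in> words \<I> \<omega> k" for v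
      proof -
        have pos: "0 < \<eta> ^ (\<nu> v + 1) * width v" by (intro mult_pos_pos \<eta>_pow(1) width_bounds(2)[OF v])
        have "L * (\<tau> v - real (\<nu> v + 1)) \<le> 0" using \<tau>[OF v] L_pos by (intro mult_nonneg_nonpos) auto
        then have "ln (\<eta> ^ (\<nu> v + 1) * width v) \<le> ln (\<eta> ^ k)" using lnw[OF v, of "\<nu> v + 1"] by linarith
        then show ?thesis using ln_le_cancel_iff[OF pos \<eta>_pow(1)] by blast
      qed
      \<comment> \<open>The growth of the projection at the exact scale produces the factor
        \<open>width v powr s\<close>, and these sum to \<open>exp (S k)\<close>.\<close>
      have exp\<tau>: "exp (s * L * \<tau> v) = exp (s * L * real k) * width v powr s" if v: "v \<in> words \<I> \<omega> k" for v
        using width_bounds(2)[OF v] L_pos by (simp add: \<tau>_def powr_def algebra_simps flip: exp_add)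
      have s1: "\<bar>s * L * real n - s * L * \<tau> v\<bar> \<le> \<bar>s\<bar> * L" if "\<bar>real n - \<tau> v\<bar> \<le> 1" for n v
      proof -
        have "\<bar>s * L * real n - s * L * \<tau> v\<bar> = \<bar>s\<bar> * L * \<bar>real n - \<tau> v\<bar>"
          using L_pos by (simp add: abs_mult flip: right_diff_distrib)
        also have "\<dots> \<le> \<bar>s\<bar> * L * 1" using that L_pos by (intro mult_left_mono) auto
        finally show ?thesis by simp
      qed
      have kNm: "depth * k \<le> k + m" "k \<le> k + m" by (auto simp: m_def)
      have zexp: "real (pcount (shift k \<omega>) n) = exp (ln (real (pcount (shift k \<omega>) n)))" for n
        using pcount_pos[of "shift k \<omega>" n] by simp
      let ?E = "exp (s * L * real k + S k)"
      have "real (gcount \<omega> k (k + m)) \<le> real (\<Sum>v\<in>words \<I> \<omega> k. 9 * xcount (shift k \<omega>) (\<nu> v + 1) m)"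
        by (rule of_nat_mono[OF gcount_upper[OF le]])
      also have "\<dots> = (\<Sum>v\<in>words \<I> \<omega> k. 9 * real (xcount (shift k \<omega>) (\<nu> v + 1) m))" by simp
      also have "\<dots> \<le> (\<Sum>v\<in>words \<I> \<omega> k. 441 * exp (\<epsilon> * real k + \<bar>s\<bar> * L) * (exp (s * L * real k) * width v powr s))"
      proof (rule sum_mono)
        fix v assume v: "v \<in> words \<I> \<omega> k"
        have "depth * (\<nu> v + 1) \<le> m" unfolding m_def by (rule mult_le_mono2) (use \<tau>(3)[OF v] in simp)
        then have "9 * real (xcount (shift k \<omega>) (\<nu> v + 1) m) \<le> 441 * real (pcount (shift k \<omega>) (\<nu> v + 1))"
          using of_nat_mono[OF xcount_pcount(1)[of "\<nu> v + 1" m "shift k \<omega>"], where 'a = real] by simp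
        also have "real (pcount (shift k \<omega>) (\<nu> v + 1)) \<le> exp (\<epsilon> * real k + \<bar>s\<bar> * L + s * L * \<tau> v)"
        proof (subst zexp, subst exp_le_cancel_iff)
          have "\<bar>ln (pcount (shift k \<omega>) (\<nu> v + 1)) - s * L * real (\<nu> v + 1)\<bar> \<le> \<epsilon> * real k"
            by (rule elim[rule_format]) (use \<tau>(3)[OF v] in simp)
          moreover have "\<bar>s * L * real (\<nu> v + 1) - s * L * \<tau> v\<bar> \<le> \<bar>s\<bar> * L"
            using \<tau>(1,2)[OF v] by (intro s1) auto
          ultimately show "ln (real (pcount (shift k \<omega>) (\<nu> v + 1))) \<le> \<epsilon> * real k + \<bar>s\<bar> * L + s * L * \<tau> v"
            by linarith
        qed
        finally show "9 * real (xcount (shift k \<omega>) (\<nu> v + 1) m)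
            \<le> 441 * exp (\<epsilon> * real k + \<bar>s\<bar> * L) * (exp (s * L * real k) * width v powr s)"
          by (simp add: exp_add[of _ "s * L * \<tau> v"] exp\<tau>[OF v])
      qed
      also have "\<dots> = 441 * exp (\<epsilon> * real k + \<bar>s\<bar> * L) * ?E"
        by (simp add: sum_distrib_left[symmetric] sum_width exp_add)
      finally have up: "real (gcount \<omega> k (k + m)) \<le> 441 * exp (\<epsilon> * real k + \<bar>s\<bar> * L) * ?E" .
      have "exp (- (\<epsilon> * real k + \<bar>s\<bar> * L)) * ?E
          = (\<Sum>v\<in>words \<I> \<omega> k. exp (- (\<epsilon> * real k + \<bar>s\<bar> * L)) * (exp (s * L * real k) * width v powr s))"
        by (simp add: sum_distrib_left[symmetric] sum_width exp_add)
      also have "\<dots> \<le> (\<Sum>v\<in>words \<I> \<omega> k. 49 * real (xcount (shift k \<omega>) (\<nu> v) m))"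
      proof (rule sum_mono)
        fix v assume v: "v \<in> words \<I> \<omega> k"
        have "depth * \<nu> v \<le> m" unfolding m_def by (rule mult_le_mono2) (use \<tau>(3)[OF v] in simp)
        then have "real (pcount (shift k \<omega>) (\<nu> v)) \<le> 49 * real (xcount (shift k \<omega>) (\<nu> v) m)"
          using of_nat_mono[OF xcount_pcount(2)[of "\<nu> v" m "shift k \<omega>"], where 'a = real] by simp
        moreover have "exp (- (\<epsilon> * real k + \<bar>s\<bar> * L) + s * L * \<tau> v) \<le> real (pcount (shift k \<omega>) (\<nu> v))"
        proof (subst zexp, subst exp_le_cancel_iff)
          have "\<bar>ln (pcount (shift k \<omega>) (\<nu> v)) - s * L * real (\<nu> v)\<bar> \<le> \<epsilon> * real k"
            by (rule elim[rule_format]) (use \<tau>(3)[OF v] in simp)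
          moreover have "\<bar>s * L * real (\<nu> v) - s * L * \<tau> v\<bar> \<le> \<bar>s\<bar> * L"
            using \<tau>(1,2)[OF v] by (intro s1) auto
          ultimately show "- (\<epsilon> * real k + \<bar>s\<bar> * L) + s * L * \<tau> v \<le> ln (real (pcount (shift k \<omega>) (\<nu> v)))"
            by linarith
        qed
        ultimately show "exp (- (\<epsilon> * real k + \<bar>s\<bar> * L)) * (exp (s * L * real k) * width v powr s)
            \<le> 49 * real (xcount (shift k \<omega>) (\<nu> v) m)"
          by (simp add: exp_add[of _ "s * L * \<tau> v"] exp\<tau>[OF v])
      qed
      also have "\<dots> = 49 * real (\<Sum>v\<in>words \<I> \<omega> k. xcount (shift k \<omega>) (\<nu> v) m)"
        by (simp add: sum_distrib_left)
      also have "\<dots> \<le> 49 * real (108 * gcount \<omega> k (k + m))"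
        by (intro mult_left_mono of_nat_mono gcount_lower ge) auto
      finally have lo: "exp (- (\<epsilon> * real k + \<bar>s\<bar> * L)) * ?E \<le> 5292 * real (gcount \<omega> k (k + m))" by simp
      have NG: "real (N k) \<le> 49 * real (gcount \<omega> k (k + m))" "real (gcount \<omega> k (k + m)) \<le> 49 * real (N k)"
        using gcount_carpet[OF kNm, of \<omega>] unfolding N_def by linarith+
      have "0 < exp (- (\<epsilon> * real k + \<bar>s\<bar> * L)) * ?E" by simp
      then have Npos: "0 < real (N k)" using lo NG by linarith
      have "real (N k) \<le> 259308 * exp (\<epsilon> * real k + \<bar>s\<bar> * L) * ?E"
      proof -
        have "0 \<le> exp (\<epsilon> * real k + \<bar>s\<bar> * L) * ?E" by simp
        then show ?thesis using up NG(1) by linarith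
      qed
      then have "ln (N k) \<le> ln (259308 * exp (\<epsilon> * real k + \<bar>s\<bar> * L) * ?E)"
        using Npos by (intro ln_mono) auto
      then have 1: "ln (N k) \<le> ln 259308 + (\<epsilon> * real k + \<bar>s\<bar> * L) + (s * L * real k + S k)"
        by (simp add: ln_mult)
      have "exp (- (\<epsilon> * real k + \<bar>s\<bar> * L)) * ?E \<le> 259308 * real (N k)" using lo NG by linarith
      then have "ln (exp (- (\<epsilon> * real k + \<bar>s\<bar> * L)) * ?E) \<le> ln (259308 * real (N k))"
        by (intro ln_mono) auto
      then have 2: "- (\<epsilon> * real k + \<bar>s\<bar> * L) + (s * L * real k + S k) \<le> ln 259308 + ln (N k)"
        using Npos by (simp add: ln_mult)
      show ?case using 1 2 by (simp only: abs_le_iff) linarith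
    qed
    then show ?thesis by blast
  qed
  have "(\<lambda>k. s * L + S k / real k) \<longlonglongrightarrow> s * L + E"
    using lim unfolding S_def by (intro tendsto_add tendsto_const)
  moreover have "\<forall>\<^sub>F k in sequentially. s * L + S k / real k = (s * L * real k + S k) / real k"
    using eventually_gt_at_top[of 0] by eventually_elim (simp add: add_divide_distrib)
  ultimately have "(\<lambda>k. (s * L * real k + S k) / real k) \<longlonglongrightarrow> s * L + E"
    by (rule Lim_transform_eventually)
  from tendsto_div_nat_if_sublinear_diff[OF this close]
  have "(\<lambda>k. ln (N k) / real k) \<longlonglongrightarrow> s * L + E" by blast
  from tendsto_divide[OF this tendsto_const[of L]] have "(\<lambda>k. ln (N k) / (real k * L)) \<longlonglongrightarrow> s + E / L"
    using L_pos by (simp add: add_divide_distrib)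
  moreover have "has_box_dim (carpet \<I> \<omega>) (s + E / L) \<longleftrightarrow> (\<lambda>k. ln (N k) / (real k * - ln \<eta>)) \<longlonglongrightarrow> s + E / L"
    unfolding N_def
    by (rule has_box_dim_iff_seq[OF bounded_carpet[OF box] carpet_ne[OF box] \<eta>
        covering_number_cell_bounds[OF bounded_carpet[OF box] \<eta>_pow(1)]])
  ultimately show ?thesis by (simp add: L_def)
qed

end

section \<open>Sequences of independent symbols\<close>

abbreviation seq_measure :: "'i::finite pmf \<Rightarrow> (nat \<Rightarrow> 'i) measure" where
  "seq_measure p \<equiv> \<Pi>\<^sub>M n\<in>UNIV. measure_pmf p"

lemma prob_space_seq_measure: "prob_space (seq_measure p)"
  by (intro prob_space_PiM measure_pmf.prob_space_axioms)

lemma space_seq_measure [simp]: "space (seq_measure p) = UNIV"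
  by (simp add: space_PiM)

lemma measurable_seq_component: "(\<lambda>\<omega>. \<omega> n) \<in> measurable (seq_measure p) (measure_pmf p)"
  by (rule measurable_component_singleton) simp

lemma measurable_seq_component': "(\<lambda>\<omega>. \<omega> n) \<in> measurable (seq_measure p) (count_space UNIV)"
  using measurable_seq_component[of n p] by (simp cong: measurable_cong_sets)

text \<open>Fixing the last relevant coordinate leaves a function of fewer coordinates; the original
  function is glued from finitely many of these along the value of that coordinate.\<close>

lemma measurable_finitely_determined:
  fixes f :: "(nat \<Rightarrow> 'i::finite) \<Rightarrow> 'b"
  assumes "\<And>\<omega> \<omega>'. (\<And>m. m < N \<Longrightarrow> \<omega> m = \<omega>' m) \<Longrightarrow> f \<omega> = f \<omega>'"
  shows "f \<in> measurable (seq_measure p) (count_space UNIV)"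
  using assms
proof (induction N arbitrary: f)
  case 0
  then have "f = (\<lambda>\<omega>. f undefined)" by (intro ext) blast
  then show ?case by (metis measurable_count_space_const)
next
  case (Suc N)
  have "(\<lambda>\<omega>. f (fun_upd \<omega> N i)) \<in> measurable (seq_measure p) (count_space UNIV)" for i
    by (rule Suc.IH) (auto intro!: Suc.prems simp: less_Suc_eq)
  from measurable_compose_countable'[where f = "\<lambda>i \<omega>. f (fun_upd \<omega> N i)" and g = "\<lambda>\<omega>. \<omega> N" and I = UNIV, OF this measurable_seq_component' countable_finite[OF finite]]
  show ?case by simp
qed

lemma distr_shift: "distr (seq_measure p) (seq_measure p) (shift d) = seq_measure p"
  using distr_PiM_reindex[of UNIV "\<lambda>_. measure_pmf p" "\<lambda>n. d + n" UNIV]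
  by (simp add: measure_pmf.prob_space_axioms shift_def[abs_def] restrict_UNIV inj_on_def)

lemma measurable_shift: "shift d \<in> measurable (seq_measure p) (seq_measure p)"
  unfolding shift_def[abs_def] by (rule measurable_PiM_single') (auto intro: measurable_seq_component simp: space_PiM)

lemma integral_shift:
  fixes f :: "(nat \<Rightarrow> 'i::finite) \<Rightarrow> real"
  assumes "f \<in> borel_measurable (seq_measure p)"
  shows "(\<integral>\<omega>. f (shift d \<omega>) \<partial>seq_measure p) = (\<integral>\<omega>. f \<omega> \<partial>seq_measure p)"
  using integral_distr[OF measurable_shift assms, of d] by (simp add: distr_shift)

text \<open>
  The maximal ergodic inequality for an indicator function, by Garsia's argument: \<open>h n\<close> is
  the maximum of the partial sums of length at most \<open>n\<close> (including the empty one) of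
  \<open>f = indicator B - \<theta>\<close> along the orbit, and \<open>f \<ge> h n - h n \<circ> shift 1\<close> where \<open>h n > 0\<close>.
\<close>

lemma maximal_inequality_indicator:
  fixes B :: "(nat \<Rightarrow> 'i::finite) set"
  assumes B: "B \<in> sets (seq_measure p)" and \<theta>: "0 < \<theta>" "\<theta> \<le> 1"
  defines "U \<equiv> {\<omega>. \<exists>n. \<theta> * real n < (\<Sum>j<n. indicator B (shift j \<omega>))}"
  shows "U \<in> sets (seq_measure p)" "measure (seq_measure p) U \<le> measure (seq_measure p) B / \<theta>"
proof -
  let ?M = "seq_measure p"
  interpret prob_space ?M by (rule prob_space_seq_measure)
  define f where "f \<omega> = indicator B \<omega> - \<theta>" for \<omega>
  have f_meas [measurable]: "f \<in> borel_measurable ?M" using B unfolding f_def[abs_def] by measurable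
  have f_abs: "\<bar>f \<omega>\<bar> \<le> 1" for \<omega> using \<theta> by (auto simp: f_def indicator_def)
  note shift_meas [measurable] = measurable_shift[of _ p]
  \<comment> \<open>A nonempty partial sum starting at \<omega> is \<open>f \<omega>\<close> plus a
    partial sum starting at \<open>shift 1 \<omega>\<close>, whence the recursion.\<close>
  define h where "h = rec_nat (\<lambda>_. 0) (\<lambda>_ g \<omega>. max 0 (f \<omega> + g (shift 1 \<omega>)))"
  have h0: "h 0 \<omega> = 0" and hSuc: "h (Suc n) \<omega> = max 0 (f \<omega> + h n (shift 1 \<omega>))" for n \<omega>
    by (simp_all add: h_def)
  have h_meas [measurable]: "h n \<in> borel_measurable ?M" for n
  proof (induction n)
    case 0
    then show ?case by (simp add: h_def)
  next
    case (Suc n)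
    then have "(\<lambda>\<omega>. h n (shift 1 \<omega>)) \<in> borel_measurable ?M" by (rule measurable_compose[OF measurable_shift])
    then show ?case unfolding hSuc[abs_def] by measurable
  qed
  have h_nonneg: "0 \<le> h n \<omega>" for n \<omega> by (cases n) (simp_all add: h0 hSuc)
  have h_le: "h n \<omega> \<le> real n" for n \<omega>
  proof (induction n arbitrary: \<omega>)
    case (Suc n)
    have "f \<omega> + h n (shift 1 \<omega>) \<le> 1 + real n"
      using f_abs[of \<omega>] Suc.IH[of "shift 1 \<omega>"] by linarith
    then show ?case unfolding hSuc by (intro max.boundedI) auto
  qed (simp add: h0)
  have h_mono: "h n \<omega> \<le> h (Suc n) \<omega>" for n \<omega>
  proof (induction n arbitrary: \<omega>)
    case (Suc n)
    then show ?case using Suc.IH[of "shift 1 \<omega>"] unfolding hSuc[of "Suc n"] hSuc[of n] by linarith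
  qed (simp add: h0 hSuc)
  have sum_le_h: "(\<Sum>j<k. f (shift j \<omega>)) \<le> h n \<omega>" if "k \<le> n" for k n \<omega>
    using that
  proof (induction n arbitrary: k \<omega>)
    case (Suc n)
    show ?case
    proof (cases k)
      case 0
      then show ?thesis using h_nonneg by simp
    next
      case k: (Suc k')
      have "(\<Sum>j<k. f (shift j \<omega>)) = f \<omega> + (\<Sum>j<k'. f (shift j (shift 1 \<omega>)))"
        unfolding k sum.lessThan_Suc_shift by simp
      also have "\<dots> \<le> f \<omega> + h n (shift 1 \<omega>)" by (rule add_left_mono, rule Suc.IH) (use Suc.prems k in simp)
      finally show ?thesis by (simp add: hSuc)
    qed
  qed (simp add: h0)
  define A where "A n = {\<omega>. 0 < h n \<omega>}" for n
  have A_meas [measurable]: "A n \<in> sets ?M" for n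
    using measurable_sets[OF h_meas, of "{0<..}" n] by (simp add: A_def vimage_def)
  have int: "integrable ?M g" if "g \<in> borel_measurable ?M" "\<And>\<omega>. \<bar>g \<omega>\<bar> \<le> c" for g :: "_ \<Rightarrow> real" and c
    using that by (intro integrable_const_bound[of _ c]) auto
  have A_le: "measure ?M (A n) \<le> measure ?M B / \<theta>" for n
  proof -
    have hs_meas [measurable]: "(\<lambda>\<omega>. h n (shift 1 \<omega>)) \<in> borel_measurable ?M"
      by (rule measurable_compose[OF measurable_shift h_meas])
    have i1: "integrable ?M (h n)" using h_le h_nonneg by (intro int[of _ "real n"]) auto
    have i2: "integrable ?M (\<lambda>\<omega>. h n (shift 1 \<omega>))" using h_le h_nonneg by (intro int[of _ "real n"]) auto
    have i3: "integrable ?M (\<lambda>\<omega>. indicator (A n) \<omega> * f \<omega>)"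
      using f_abs by (intro int[of _ 1]) (auto simp: indicator_def)
    \<comment> \<open>Shift invariance makes the coboundary integrate to zero. On \<open>A n\<close>
      it is at most \<open>f\<close>, by the recursion and monotonicity in \<open>n\<close>; off
      \<open>A n\<close> it is nonpositive, since \<open>h n\<close> vanishes there.\<close>
    have "0 = (\<integral>\<omega>. h n \<omega> - h n (shift 1 \<omega>) \<partial>?M)"
      using i1 i2 by (simp add: integral_shift)
    also have "\<dots> \<le> (\<integral>\<omega>. indicator (A n) \<omega> * f \<omega> \<partial>?M)"
    proof (rule integral_mono[OF Bochner_Integration.integrable_diff[OF i1 i2] i3])
      fix \<omega>
      show "h n \<omega> - h n (shift 1 \<omega>) \<le> indicator (A n) \<omega> * f \<omega>"
      proof (cases "\<omega> \<in> A n")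
        case True
        have "n \<noteq> 0" by (rule notI) (use True in \<open>simp add: A_def h0\<close>)
        then obtain m where m: "n = Suc m" using not0_implies_Suc by blast
        have "h n \<omega> = f \<omega> + h m (shift 1 \<omega>)" using True by (auto simp: A_def m hSuc max_def split: if_splits)
        then show ?thesis using True h_mono[of m "shift 1 \<omega>"] by (simp add: m)
      next
        case False
        then have "h n \<omega> \<le> 0" by (simp add: A_def)
        then show ?thesis using False h_nonneg[of n "shift 1 \<omega>"] by simp
      qed
    qed
    also have "\<dots> \<le> (\<integral>\<omega>. indicator B \<omega> - \<theta> * indicator (A n) \<omega> \<partial>?M)"
    proof (rule integral_mono[OF i3])
      show "integrable ?M (\<lambda>\<omega>. indicator B \<omega> - \<theta> * indicator (A n) \<omega>)"
        using B \<theta> by (intro int[of _ 2]) (auto simp: indicator_def)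
    qed (auto simp: f_def indicator_def)
    also have "\<dots> = measure ?M B - \<theta> * measure ?M (A n)"
    proof -
      have "integrable ?M (indicat_real B)" "integrable ?M (\<lambda>\<omega>. \<theta> * indicat_real (A n) \<omega>)"
        using B \<theta> by (auto intro!: int[of _ 1] simp: indicator_def)
      then have "(\<integral>\<omega>. indicat_real B \<omega> - \<theta> * indicat_real (A n) \<omega> \<partial>?M)
          = (\<integral>\<omega>. indicat_real B \<omega> \<partial>?M) - (\<integral>\<omega>. \<theta> * indicat_real (A n) \<omega> \<partial>?M)"
        by (rule Bochner_Integration.integral_diff)
      then show ?thesis using B by simp
    qed
    finally show ?thesis using \<theta> by (simp add: le_divide_eq mult.commute)
  qed
  \<comment> \<open>Truncation to orbit segments of length at most \<open>n\<close>: each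
    \<open>V n\<close> lies in \<open>A n\<close>, and the increasing union of the
    \<open>V n\<close> is \<open>U\<close>, with the same bound.\<close>
  define V where "V n = {\<omega>. \<exists>k\<le>n. \<theta> * real k < (\<Sum>j<k. indicator B (shift j \<omega>))}" for n
  have V_meas: "V n \<in> sets ?M" for n
  proof -
    have "(\<lambda>\<omega>. \<Sum>j<k. indicat_real B (shift j \<omega>)) \<in> borel_measurable ?M" for k
      by (intro borel_measurable_sum measurable_compose[OF measurable_shift borel_measurable_indicator[OF B]])
    then have "{\<omega> \<in> space ?M. \<theta> * real k < (\<Sum>j<k. indicator B (shift j \<omega>))} \<in> sets ?M" for k
      by measurable
    moreover have "V n = (\<Union>k\<le>n. {\<omega> \<in> space ?M. \<theta> * real k < (\<Sum>j<k. indicator B (shift j \<omega>))})"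
      by (auto simp: V_def)
    ultimately show ?thesis by auto
  qed
  have U_eq: "U = (\<Union>n. V n)" by (auto simp: U_def V_def)
  then show "U \<in> sets ?M" using V_meas by auto
  have V_le: "measure ?M (V n) \<le> measure ?M B / \<theta>" for n
  proof -
    have "V n \<subseteq> A n"
    proof
      fix \<omega> assume "\<omega> \<in> V n"
      then obtain k where k: "k \<le> n" "\<theta> * real k < (\<Sum>j<k. indicator B (shift j \<omega>))" by (auto simp: V_def)
      have "(\<Sum>j<k. f (shift j \<omega>)) = (\<Sum>j<k. indicator B (shift j \<omega>)) - \<theta> * real k"
        by (simp add: f_def sum_subtractf)
      then show "\<omega> \<in> A n" using sum_le_h[OF k(1), of \<omega>] k(2) by (simp add: A_def)
    qed
    then have "measure ?M (V n) \<le> measure ?M (A n)" by (intro finite_measure_mono) auto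
    then show ?thesis using A_le[of n] by simp
  qed
  have "incseq V" by (auto simp: incseq_def V_def) (meson order_trans)
  then have "(\<lambda>n. measure ?M (V n)) \<longlonglongrightarrow> measure ?M U"
    unfolding U_eq using V_meas by (intro finite_Lim_measure_incseq) auto
  then show "measure ?M U \<le> measure ?M B / \<theta>"
    by (rule LIMSEQ_le_const2) (use V_le in blast)
qed

text \<open>The maximal inequality bounds the exceptional set of \<open>B M\<close> by
  \<open>measure (B M) / \<theta>\<close>, which tends to 0 as the \<open>B M\<close> shrink to a
  null set. So almost every \<omega> escapes some exceptional set, with \<open>M\<close> depending
  on \<omega> and the bound valid for every \<open>n\<close>.\<close>

lemma AE_visits_sparse:
  fixes B :: "nat \<Rightarrow> (nat \<Rightarrow> 'i::finite) set"
  assumes B: "\<And>n. B n \<in> sets (seq_measure p)" "decseq B"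
    and null: "AE \<omega> in seq_measure p. \<exists>n. \<omega> \<notin> B n"
    and \<theta>: "0 < \<theta>" "\<theta> \<le> 1"
  shows "AE \<omega> in seq_measure p. \<exists>M. \<forall>n. (\<Sum>j<n. indicator (B M) (shift j \<omega>)) \<le> \<theta> * real n"
proof -
  let ?M = "seq_measure p"
  interpret prob_space ?M by (rule prob_space_seq_measure)
  define U where "U M = {\<omega>. \<exists>n. \<theta> * real n < (\<Sum>j<n. indicator (B M) (shift j \<omega>))}" for M
  have U: "U M \<in> sets ?M" "measure ?M (U M) \<le> measure ?M (B M) / \<theta>" for M
    unfolding U_def using maximal_inequality_indicator[OF B(1) \<theta>] by auto
  have "AE \<omega> in ?M. \<omega> \<notin> (\<Inter>n. B n)" using null by auto
  then have "measure ?M (\<Inter>n. B n) = 0"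
    using B(1) by (intro measure_eq_0_null_sets) (auto simp: AE_iff_null_sets)
  moreover have "(\<lambda>n. measure ?M (B n)) \<longlonglongrightarrow> measure ?M (\<Inter>n. B n)"
    using B by (intro finite_Lim_measure_decseq) auto
  ultimately have lim: "(\<lambda>n. measure ?M (B n) / \<theta>) \<longlonglongrightarrow> 0 / \<theta>" by (intro tendsto_divide) (use \<theta> in auto)
  have "measure ?M (\<Inter>M. U M) \<le> measure ?M (B n) / \<theta>" for n
  proof -
    have "measure ?M (\<Inter>M. U M) \<le> measure ?M (U n)" using U(1) by (intro finite_measure_mono) auto
    then show ?thesis using U(2)[of n] by linarith
  qed
  then have "measure ?M (\<Inter>M. U M) \<le> 0"
    using LIMSEQ_le_const[OF lim] by auto
  then have "measure ?M (\<Inter>M. U M) = 0" using measure_nonneg[of ?M "\<Inter>M. U M"] by linarith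
  then have "(\<Inter>M. U M) \<in> null_sets ?M"
    using U(1) by (auto simp: null_sets_def emeasure_eq_measure)
  then have "AE \<omega> in ?M. \<omega> \<notin> (\<Inter>M. U M)" by (rule AE_not_in)
  then show ?thesis by (rule AE_mp) (auto simp: U_def not_less)
qed

section \<open>Independence of the coordinates and the strong law of large numbers\<close>

lemma distr_seq_component: "distr (seq_measure p) (measure_pmf p) (\<lambda>\<omega>. \<omega> n) = measure_pmf p"
  by (rule distr_PiM_component) (auto intro: measure_pmf.prob_space_axioms)

lemma indep_vars_seq_component:
  fixes \<phi> :: "'i::finite \<Rightarrow> real"
  shows "prob_space.indep_vars (seq_measure p) (\<lambda>_. borel) (\<lambda>n \<omega>. \<phi> (\<omega> n)) UNIV"
proof -
  interpret prob_space "seq_measure p" by (rule prob_space_seq_measure)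
  have "indep_vars (\<lambda>_. measure_pmf p) (\<lambda>n \<omega>. \<omega> n) UNIV"
  proof (subst indep_vars_iff_distr_eq_PiM')
    show "distr (seq_measure p) (seq_measure p) (\<lambda>x. \<lambda>i\<in>UNIV. x i)
        = (\<Pi>\<^sub>M n\<in>UNIV. distr (seq_measure p) (measure_pmf p) (\<lambda>\<omega>. \<omega> n))"
      unfolding distr_seq_component by (simp add: restrict_UNIV)
  qed (auto intro: measurable_seq_component)
  then show ?thesis
    by (rule indep_vars_compose2) simp
qed

lemma measurable_seq_component_fun:
  fixes \<phi> :: "'i::finite \<Rightarrow> real"
  shows "(\<lambda>\<omega>. \<phi> (\<omega> n)) \<in> borel_measurable (seq_measure p)"
  by (rule measurable_compose[OF measurable_seq_component]) simp

lemma integral_seq_component: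
  fixes \<phi> :: "'i::finite \<Rightarrow> real"
  shows "(\<integral>\<omega>. \<phi> (\<omega> n) \<partial>seq_measure p) = (\<Sum>i\<in>UNIV. pmf p i * \<phi> i)"
proof -
  have "(\<integral>\<omega>. \<phi> (\<omega> n) \<partial>seq_measure p) = (\<integral>i. \<phi> i \<partial>distr (seq_measure p) (measure_pmf p) (\<lambda>\<omega>. \<omega> n))"
    by (rule integral_distr[symmetric]) (auto intro: measurable_seq_component)
  also have "\<dots> = (\<Sum>i\<in>UNIV. pmf p i * \<phi> i)"
    unfolding distr_seq_component by (subst integral_measure_pmf_real[of UNIV]) (auto simp: mult.commute)
  finally show ?thesis .
qed

text \<open>On a finite alphabet \<phi> is bounded, so Hoeffding's inequality makes the probability
  of a deviation geometrically small, and the Borel-Cantelli lemma applies.\<close>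

lemma AE_averages_tendsto:
  fixes \<phi> :: "'i::finite \<Rightarrow> real"
  shows "AE \<omega> in seq_measure p. (\<lambda>n. (\<Sum>j<n. \<phi> (\<omega> j)) / real n) \<longlonglongrightarrow> (\<Sum>i\<in>UNIV. pmf p i * \<phi> i)"
proof -
  let ?M = "seq_measure p"
  interpret prob_space ?M by (rule prob_space_seq_measure)
  define \<mu> where "\<mu> = (\<Sum>i\<in>UNIV. pmf p i * \<phi> i)"
  define b where "b = (\<Sum>i\<in>UNIV. \<bar>\<phi> i\<bar>) + 1"
  have b: "\<bar>\<phi> i\<bar> \<le> b" "0 < b" for i
    unfolding b_def using member_le_sum[of i UNIV "\<lambda>i. \<bar>\<phi> i\<bar>"] by (auto simp: add_nonneg_pos sum_nonneg)
  note meas [measurable] = measurable_seq_component_fun[of \<phi> _ p]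
  define A where "A \<epsilon> n = {\<omega>\<in>space ?M. \<bar>(\<Sum>j<n. \<phi> (\<omega> j)) - real n * \<mu>\<bar> \<ge> \<epsilon> * real n}" for \<epsilon> n
  \<comment> \<open>\<open>Suc n\<close> keeps the index set nonempty, as Hoeffding's inequality
    requires.\<close>
  have A_le: "measure ?M (A \<epsilon> (Suc n)) \<le> 2 * exp (- (2 * \<epsilon>\<^sup>2 / (2 * b)\<^sup>2)) ^ Suc n" if "0 < \<epsilon>" for \<epsilon> n
  proof -
    interpret H: Hoeffding_ineq_iid ?M "{..<Suc n}" "\<lambda>j \<omega>. \<phi> (\<omega> j)" "\<lambda>\<omega>. \<phi> (\<omega> 0)" "- b" b "\<mu>"
    proof unfold_locales
      show "indep_vars (\<lambda>_. borel) (\<lambda>j \<omega>. \<phi> (\<omega> j)) {..<Suc n}"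
        by (rule indep_vars_subset[OF indep_vars_seq_component]) simp
      have d: "distr ?M borel (\<lambda>\<omega>. \<phi> (\<omega> i)) = distr (measure_pmf p) borel \<phi>" for i
        using distr_distr[OF _ measurable_seq_component[of i p], of \<phi> borel] by (simp add: distr_seq_component comp_def)
      show "distr ?M borel (\<lambda>\<omega>. \<phi> (\<omega> i)) = distr ?M borel (\<lambda>\<omega>. \<phi> (\<omega> 0))" for i
        unfolding d ..
      show "AE x in ?M. \<phi> (x 0) \<in> {- b..b}"
        by (rule AE_I2) (use b in \<open>auto simp: abs_le_iff minus_le_iff\<close>)
      show "\<mu> \<equiv> expectation (\<lambda>\<omega>. \<phi> (\<omega> 0))"
        unfolding \<mu>_def integral_seq_component .
    qed (rule finite_lessThan, rule meas)
    have "measure ?M (A \<epsilon> (Suc n)) \<le> 2 * exp (- 2 * (\<epsilon> * real (Suc n))\<^sup>2 / (real (Suc n) * (b - - b)\<^sup>2))"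
    proof -
      have "{..<Suc n} \<noteq> {}" "0 \<le> \<epsilon> * real (Suc n)" "- b < b" using that b(2) by auto
      from H.Hoeffding_ineq_abs_ge[OF this(2,3,1)] show ?thesis unfolding A_def card_lessThan .
    qed
    also have "- 2 * (\<epsilon> * real (Suc n))\<^sup>2 / (real (Suc n) * (b - - b)\<^sup>2) = real (Suc n) * (- (2 * \<epsilon>\<^sup>2 / (2 * b)\<^sup>2))"
      using b(2) by (simp add: power2_eq_square field_simps del: of_nat_Suc)
    finally show ?thesis by (simp only: exp_of_nat_mult)
  qed
  have ev: "AE \<omega> in ?M. \<forall>\<^sub>F n in sequentially. \<bar>(\<Sum>j<n. \<phi> (\<omega> j)) - real n * \<mu>\<bar> < \<epsilon> * real n" if \<epsilon>: "0 < \<epsilon>" for \<epsilon>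
  proof -
    have A_meas: "A \<epsilon> n \<in> sets ?M" for n unfolding A_def by measurable
    have "summable (\<lambda>n. measure ?M (A \<epsilon> (Suc n)))"
    proof (rule summable_comparison_test')
      have "\<bar>exp (- (2 * \<epsilon>\<^sup>2 / (2 * b)\<^sup>2))\<bar> < 1" using \<epsilon> b(2) by simp
      then have "summable (\<lambda>n. exp (- (2 * \<epsilon>\<^sup>2 / (2 * b)\<^sup>2)) ^ n)" by (intro summable_geometric) simp
      then show "summable (\<lambda>n. 2 * exp (- (2 * \<epsilon>\<^sup>2 / (2 * b)\<^sup>2)) ^ Suc n)"
        by (intro summable_mult) (simp only: summable_Suc_iff)
      show "norm (measure ?M (A \<epsilon> (Suc n))) \<le> 2 * exp (- (2 * \<epsilon>\<^sup>2 / (2 * b)\<^sup>2)) ^ Suc n" for n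
        using A_le[OF \<epsilon>, of n] by simp
    qed
    then have "AE \<omega> in ?M. \<forall>\<^sub>F n in sequentially. \<omega> \<in> space ?M - A \<epsilon> (Suc n)"
      by (intro borel_cantelli_AE1) (auto simp: A_meas emeasure_eq_measure)
    then show ?thesis
    proof (rule AE_mp, intro AE_I2 impI)
      fix \<omega> assume "\<forall>\<^sub>F n in sequentially. \<omega> \<in> space ?M - A \<epsilon> (Suc n)"
      then have "\<forall>\<^sub>F n in sequentially. \<bar>(\<Sum>j<Suc n. \<phi> (\<omega> j)) - real (Suc n) * \<mu>\<bar> < \<epsilon> * real (Suc n)"
        by eventually_elim (simp add: A_def del: of_nat_Suc sum.lessThan_Suc)
      then show "\<forall>\<^sub>F n in sequentially. \<bar>(\<Sum>j<n. \<phi> (\<omega> j)) - real n * \<mu>\<bar> < \<epsilon> * real n"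
        by (subst (asm) eventually_sequentially_Suc)
    qed
  qed
  have "AE \<omega> in ?M. \<forall>q. \<forall>\<^sub>F n in sequentially. \<bar>(\<Sum>j<n. \<phi> (\<omega> j)) - real n * \<mu>\<bar> < (1 / real (Suc q)) * real n"
    by (subst AE_all_countable) (intro allI ev, simp)
  then show ?thesis unfolding \<mu>_def[symmetric]
  proof (rule AE_mp, intro AE_I2 impI)
    fix \<omega> assume *: "\<forall>q. \<forall>\<^sub>F n in sequentially. \<bar>(\<Sum>j<n. \<phi> (\<omega> j)) - real n * \<mu>\<bar> < (1 / real (Suc q)) * real n"
    show "(\<lambda>n. (\<Sum>j<n. \<phi> (\<omega> j)) / real n) \<longlonglongrightarrow> \<mu>"
    proof (rule tendstoI)
      fix e :: real assume "0 < e"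
      then obtain q where q: "1 / real (Suc q) < e" by (metis nat_approx_posE)
      show "\<forall>\<^sub>F n in sequentially. dist ((\<Sum>j<n. \<phi> (\<omega> j)) / real n) \<mu> < e"
        using *[rule_format, of q] eventually_gt_at_top[of 0]
      proof eventually_elim
        case (elim n)
        have "dist ((\<Sum>j<n. \<phi> (\<omega> j)) / real n) \<mu> = \<bar>(\<Sum>j<n. \<phi> (\<omega> j)) - real n * \<mu>\<bar> / real n"
        proof -
          have "(\<Sum>j<n. \<phi> (\<omega> j)) / real n - \<mu> = ((\<Sum>j<n. \<phi> (\<omega> j)) - real n * \<mu>) / real n"
            using elim(2) by (simp add: diff_divide_distrib)
          then show ?thesis by (simp add: dist_real_def abs_divide)
        qed
        also have "\<dots> < 1 / real (Suc q)" using elim by (simp add: pos_divide_less_eq del: of_nat_Suc)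
        finally show ?case using q by linarith
      qed
    qed
  qed
qed

section \<open>Integration against the completed Bernoulli measure\<close>

lemma bernoulli_measure_eq: "bernoulli_measure p = completion (seq_measure p)"
  by (simp add: bernoulli_measure_def)

text \<open>No measurability of \<open>f\<close> is assumed: it is meant for functions of the
  dimension of a carpet, which are known almost everywhere only. Completeness makes \<open>f\<close>
  measurable because it agrees with \<open>g\<close> off a null set.\<close>

lemma integral_bernoulli_cong_AE:
  fixes f g :: "(nat \<Rightarrow> 'i::finite) \<Rightarrow> real"
  assumes eq: "AE \<omega> in bernoulli_measure p. f \<omega> = g \<omega>" and g: "g \<in> borel_measurable (seq_measure p)"
  shows "(\<integral>\<omega>. f \<omega> \<partial>bernoulli_measure p) = (\<integral>\<omega>. g \<omega> \<partial>bernoulli_measure p)"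
proof (rule integral_cong_AE)
  show g': "g \<in> borel_measurable (bernoulli_measure p)"
    unfolding bernoulli_measure_eq by (rule measurable_completion[OF g])
  show "f \<in> borel_measurable (bernoulli_measure p)"
  proof (rule measurableI)
    fix A :: "real set" assume "A \<in> sets borel"
    then have 1: "g -` A \<inter> space (bernoulli_measure p) \<in> sets (bernoulli_measure p)"
      by (rule measurable_sets[OF g'])
    have 2: "AE \<omega> in bernoulli_measure p. \<omega> \<in> g -` A \<inter> space (bernoulli_measure p) \<longleftrightarrow> \<omega> \<in> f -` A \<inter> space (bernoulli_measure p)"
      using eq by (rule AE_mp) (intro AE_I2 impI, simp)
    show "f -` A \<inter> space (bernoulli_measure p) \<in> sets (bernoulli_measure p)"
      unfolding bernoulli_measure_eq
      by (rule completion.in_sets_AE[OF 2[unfolded bernoulli_measure_eq] 1[unfolded bernoulli_measure_eq]]) simp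
  qed simp
qed (rule eq)

lemma AE_bernoulli_iff: "(AE \<omega> in bernoulli_measure p. P \<omega>) \<longleftrightarrow> (AE \<omega> in seq_measure p. P \<omega>)"
  by (simp only: bernoulli_measure_eq AE_completion_iff)

lemma integral_bernoulli_component:
  fixes \<phi> :: "'i::finite \<Rightarrow> real"
  shows "(\<integral>\<omega>. \<phi> (\<omega> 0) \<partial>bernoulli_measure p) = (\<Sum>i\<in>UNIV. pmf p i * \<phi> i)"
  unfolding bernoulli_measure_eq integral_completion[OF measurable_seq_component_fun] by (rule integral_seq_component)

context diagonal_rifs
begin

subsection \<open>Random sequences\<close>

lemma measurable_pcount: "(\<lambda>\<omega>. pcount \<omega> n) \<in> measurable (seq_measure q) (count_space UNIV)"
proof (rule measurable_finitely_determined)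
  fix \<omega> \<omega>' :: "nat \<Rightarrow> 'i" assume "\<And>m. m < depth * n \<Longrightarrow> \<omega> m = \<omega>' m"
  then have "words \<I> \<omega> (depth * n) = words \<I> \<omega>' (depth * n)" by (auto simp: words_def)
  then show "pcount \<omega> n = pcount \<omega>' n" by (simp add: pcount_def xcount_def)
qed

text \<open>\<open>B M\<close> is the set of sequences whose counts go wrong at some scale from
  \<open>M\<close> on. If all times from \<open>k\<close> to \<open>k + \<epsilon> * k\<close> were
  bad, they alone would exceed the number of visits to \<open>B M\<close> allowed up to
  then.\<close>

lemma AE_good_times:
  assumes AE: "AE \<omega> in seq_measure q. (\<lambda>n. ln (pcount \<omega> n) / real n) \<longlonglongrightarrow> s * L"
    and \<epsilon>: "0 < \<epsilon>" "\<epsilon> \<le> 1"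
  shows "AE \<omega> in seq_measure q. \<exists>M. \<forall>\<^sub>F k in sequentially. \<exists>d. real d \<le> \<epsilon> * real k \<and>
      (\<forall>n\<ge>M. \<bar>ln (pcount (shift (k + d) \<omega>) n) - s * L * real n\<bar> \<le> \<epsilon> * real n)"
proof -
  define B where "B M = {\<omega>. \<exists>n\<ge>M. \<epsilon> * real n < \<bar>ln (pcount \<omega> n) - s * L * real n\<bar>}" for M
  have B_sets: "B M \<in> sets (seq_measure q)" for M
  proof -
    have "(\<lambda>\<omega>. ln (real (pcount \<omega> n))) \<in> borel_measurable (seq_measure q)" for n
      by (rule measurable_compose[OF measurable_pcount]) simp
    then have "{\<omega> \<in> space (seq_measure q). \<epsilon> * real n < \<bar>ln (real (pcount \<omega> n)) - s * L * real n\<bar>} \<in> sets (seq_measure q)" for n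
      by measurable
    moreover have "B M = (\<Union>n\<in>{M..}. {\<omega> \<in> space (seq_measure q). \<epsilon> * real n < \<bar>ln (real (pcount \<omega> n)) - s * L * real n\<bar>})"
      by (auto simp: B_def)
    ultimately show ?thesis by (auto intro!: sets.countable_UN')
  qed
  have B_decseq: "decseq B" by (auto simp: decseq_def B_def) (meson order_trans)
  have B_null: "AE \<omega> in seq_measure q. \<exists>M. \<omega> \<notin> B M"
    using AE
  proof (rule AE_mp, intro AE_I2 impI)
    fix \<omega> assume "(\<lambda>n. ln (pcount \<omega> n) / real n) \<longlonglongrightarrow> s * L"
    from abs_ln_pcount_le_if_growth[OF this \<epsilon>(1)] show "\<exists>M. \<omega> \<notin> B M" by (force simp: B_def not_less)
  qed
  \<comment> \<open>A bad window has more than \<open>\<epsilon> * real k\<close> members and ends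
    before time \<open>3 * real k\<close>, as \<epsilon> is at most 1; so any density bound up to
    \<open>\<epsilon> / 3\<close> gives a contradiction.\<close>
  have \<theta>: "0 < \<epsilon> / 4" "\<epsilon> / 4 \<le> 1" using \<epsilon> by auto
  from AE_visits_sparse[OF B_sets B_decseq B_null \<theta>] show ?thesis
  proof (rule AE_mp, intro AE_I2 impI)
    fix \<omega> assume "\<exists>M. \<forall>n. (\<Sum>j<n. indicator (B M) (shift j \<omega>)) \<le> \<epsilon> / 4 * real n"
    then obtain M where M: "\<And>n. (\<Sum>j<n. indicat_real (B M) (shift j \<omega>)) \<le> \<epsilon> / 4 * real n" by blast
    have "\<exists>d. real d \<le> \<epsilon> * real k \<and> shift (k + d) \<omega> \<notin> B M" if k: "1 \<le> k" for k
    proof (rule ccontr)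
      assume "\<not> ?thesis"
      then have bad: "shift (k + d) \<omega> \<in> B M" if "real d \<le> \<epsilon> * real k" for d using that by blast
      define D where "D = nat \<lfloor>\<epsilon> * real k\<rfloor>"
      have "0 \<le> \<epsilon> * real k" using \<epsilon> by simp
      then have D: "real D \<le> \<epsilon> * real k" "\<epsilon> * real k < real D + 1" unfolding D_def by linarith+
      have in_B: "shift j \<omega> \<in> B M" if "j \<in> {k..<k + D + 1}" for j
      proof -
        have "real (j - k) \<le> \<epsilon> * real k" using that D(1) by auto
        from bad[OF this] show ?thesis using that by simp
      qed
      have "real D + 1 = (\<Sum>j\<in>{k..<k + D + 1}. indicat_real (B M) (shift j \<omega>))"
        using in_B by (simp add: indicator_def)
      also have "\<dots> \<le> (\<Sum>j<k + D + 1. indicat_real (B M) (shift j \<omega>))"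
        by (intro sum_mono2) auto
      also have "\<dots> \<le> \<epsilon> / 4 * real (k + D + 1)" by (rule M)
      also have "\<dots> \<le> \<epsilon> / 4 * (3 * real k)"
      proof (rule mult_left_mono)
        have "\<epsilon> * real k \<le> 1 * real k" using \<epsilon> by (intro mult_right_mono) auto
        moreover have "1 \<le> real k" using k by simp
        ultimately show "real (k + D + 1) \<le> 3 * real k" using D(1) unfolding of_nat_add of_nat_1 by linarith
      qed (use \<epsilon> in simp)
      also have "\<dots> \<le> \<epsilon> * real k" using \<epsilon> by simp
      finally show False using D(2) by simp
    qed
    then have "\<forall>\<^sub>F k in sequentially. \<exists>d. real d \<le> \<epsilon> * real k \<and>
        (\<forall>n\<ge>M. \<bar>ln (pcount (shift (k + d) \<omega>) n) - s * L * real n\<bar> \<le> \<epsilon> * real n)"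
      by (intro eventually_sequentiallyI[of 1]) (force simp: B_def not_less)
    then show "\<exists>M. \<forall>\<^sub>F k in sequentially. \<exists>d. real d \<le> \<epsilon> * real k \<and>
        (\<forall>n\<ge>M. \<bar>ln (pcount (shift (k + d) \<omega>) n) - s * L * real n\<bar> \<le> \<epsilon> * real n)" by blast
  qed
qed

lemma AE_tempered:
  assumes "AE \<omega> in seq_measure q. (\<lambda>n. ln (pcount \<omega> n) / real n) \<longlonglongrightarrow> s * L"
  shows "AE \<omega> in seq_measure q. tempered \<omega> s"
proof -
  let ?good = "\<lambda>\<epsilon> \<omega>. \<exists>M. \<forall>\<^sub>F k in sequentially. \<exists>d. real d \<le> \<epsilon> * real k \<and>
      (\<forall>n\<ge>M. \<bar>ln (pcount (shift (k + d) \<omega>) n) - s * L * real n\<bar> \<le> \<epsilon> * real n)"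
  \<comment> \<open>Only countably many null sets can be discarded at once, so \<epsilon> runs
    through reciprocals of positive integers.\<close>
  have "AE \<omega> in seq_measure q. \<forall>m. ?good (1 / real (Suc m)) \<omega>"
    by (subst AE_all_countable) (intro allI AE_good_times[OF assms], auto)
  then show ?thesis
  proof (rule AE_mp, intro AE_I2 impI)
    fix \<omega> assume good: "\<forall>m. ?good (1 / real (Suc m)) \<omega>"
    show "tempered \<omega> s"
    proof (rule tempered_if_good_times)
      fix \<epsilon> :: real assume "0 < \<epsilon>"
      then obtain m where m: "1 / real (Suc m) < \<epsilon>" by (metis nat_approx_posE)
      have le: "1 / real (Suc m) * real n \<le> \<epsilon> * real n" for n using m by (intro mult_right_mono) auto
      obtain M where M: "\<forall>\<^sub>F k in sequentially. \<exists>d. real d \<le> 1 / real (Suc m) * real k \<and>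
          (\<forall>n\<ge>M. \<bar>ln (pcount (shift (k + d) \<omega>) n) - s * L * real n\<bar> \<le> 1 / real (Suc m) * real n)"
        using good by blast
      have "\<forall>\<^sub>F k in sequentially. \<exists>d. real d \<le> \<epsilon> * real k \<and>
          (\<forall>n\<ge>M. \<bar>ln (pcount (shift (k + d) \<omega>) n) - s * L * real n\<bar> \<le> \<epsilon> * real n)"
        using M
      proof eventually_elim
        case (elim k)
        then obtain d where d: "real d \<le> 1 / real (Suc m) * real k"
          "\<And>n. M \<le> n \<Longrightarrow> \<bar>ln (pcount (shift (k + d) \<omega>) n) - s * L * real n\<bar> \<le> 1 / real (Suc m) * real n" by blast
        show ?case
          by (intro exI[of _ d] conjI allI impI) (rule order_trans[OF d(1) le], rule order_trans[OF d(2) le])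
      qed
      then show "?good \<epsilon> \<omega>" by blast
    qed
  qed
qed

lemma AE_carpet_dim:
  assumes "AE \<omega> in seq_measure q. has_box_dim (proj_x (carpet \<I> \<omega>)) s"
  shows "AE \<omega> in seq_measure q. has_box_dim (carpet \<I> \<omega>)
    (s + (\<Sum>i\<in>UNIV. pmf q i * ln (\<Sum>e\<in>symbols \<I> i. ratio_x \<I> e powr s)) / L)"
proof -
  have "AE \<omega> in seq_measure q. tempered \<omega> s"
    by (rule AE_tempered) (use assms in \<open>simp only: has_box_dim_proj_iff\<close>)
  from AE_conjI[OF this AE_averages_tendsto[where \<phi> = "\<lambda>i. ln (\<Sum>e\<in>symbols \<I> i. ratio_x \<I> e powr s)"]]
  show ?thesis
  proof (rule AE_mp, intro AE_I2 impI, elim conjE)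
    fix \<omega> assume "tempered \<omega> s"
      and "(\<lambda>k. (\<Sum>j<k. ln (\<Sum>e\<in>symbols \<I> (\<omega> j). ratio_x \<I> e powr s)) / real k)
        \<longlonglongrightarrow> (\<Sum>i\<in>UNIV. pmf q i * ln (\<Sum>e\<in>symbols \<I> i. ratio_x \<I> e powr s))"
    then show "has_box_dim (carpet \<I> \<omega>)
        (s + (\<Sum>i\<in>UNIV. pmf q i * ln (\<Sum>e\<in>symbols \<I> i. ratio_x \<I> e powr s)) / L)"
      by (rule carpet_dim)
  qed
qed

text \<open>Both dimensions are shown to exist; for constant sequences this is a conclusion, not a
  hypothesis.\<close>

lemma carpet_dim_const:
  obtains s where "has_box_dim (proj_x (carpet \<I> (\<lambda>_. i))) s"
    "has_box_dim (carpet \<I> (\<lambda>_. i)) (s + ln (\<Sum>e\<in>symbols \<I> i. ratio_x \<I> e powr s) / L)"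
proof -
  obtain s where s: "(\<lambda>n. ln (pcount (\<lambda>_. i) n) / real n) \<longlonglongrightarrow> s * L" using pcount_const_growth by blast
  have "(\<lambda>k. (\<Sum>j<k. ln (\<Sum>e\<in>symbols \<I> i. ratio_x \<I> e powr s)) / real k) \<longlonglongrightarrow> ln (\<Sum>e\<in>symbols \<I> i. ratio_x \<I> e powr s)"
    by (rule tendsto_eventually) (rule eventually_mono[OF eventually_gt_at_top[of 0]], simp)
  from carpet_dim[OF tempered_const[OF s] this] show ?thesis
    using that[of s] s by (simp only: has_box_dim_proj_iff)
qed

lemma alpha_letter:
  assumes "e \<in> symbols \<I> i"
  shows "alpha_max \<I> [e] = ratio_x \<I> e"
proof -
  have "\<forall>e'\<in>set [e]. orient \<I> e' \<in> diagonal_signs \<and> 0 < ratio_x \<I> e' \<and> 0 < ratio_y \<I> e'"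
    using diag[OF assms] ratio_x_bounds[OF assms] ratio_y[OF assms] \<eta> by simp
  from lengths_diagonal[OF this] show ?thesis
    using ratio_x_ge[OF assms] ratio_y[OF assms] by (simp add: alpha_max_def)
qed

lemma averaged_dimension:
  defines "d \<equiv> \<lambda>i. box_dim (carpet \<I> (\<lambda>_. i))" and "s \<equiv> \<Sum>i\<in>UNIV. pmf p i * sx (carpet \<I> (\<lambda>_. i))"
  assumes AE_s: "AE \<omega> in bernoulli_measure p. has_box_dim (proj_x (carpet \<I> \<omega>)) s"
    and eq: "(\<integral>\<omega>. ln (\<Sum>e\<in>symbols \<I> (\<omega> 0). alpha_max \<I> [e] powr sx (carpet \<I> \<omega>)) \<partial>bernoulli_measure p) =
         (\<integral>\<omega>. ln (\<Sum>e\<in>symbols \<I> (\<omega> 0). alpha_max \<I> [e] powr sx (carpet \<I> (\<lambda>_. \<omega> 0))) \<partial>bernoulli_measure p)"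
  shows "\<exists>d. has_box_dim (carpet \<I> (\<lambda>_. i)) d"
    and "AE \<omega> in bernoulli_measure p. has_box_dim (carpet \<I> \<omega>) (\<Sum>i\<in>UNIV. pmf p i * d i)"
proof -
  define t where "t i = sx (carpet \<I> (\<lambda>_. i))" for i
  define \<phi> where "\<phi> r i = ln (\<Sum>e\<in>symbols \<I> i. ratio_x \<I> e powr r)" for r i
  have dim: "has_box_dim (carpet \<I> (\<lambda>_. i)) (t i + \<phi> (t i) i / L)" for i
    by (rule carpet_dim_const[of i]) (auto simp: t_def sx_def \<phi>_def dest: has_box_dim_imp_box_dim)
  then show "\<exists>d. has_box_dim (carpet \<I> (\<lambda>_. i)) d" by blast
  have d: "d i = t i + \<phi> (t i) i / L" for i
    unfolding d_def by (rule has_box_dim_imp_box_dim[OF dim])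
  have alpha: "(\<Sum>e\<in>symbols \<I> i. alpha_max \<I> [e] powr r) = (\<Sum>e\<in>symbols \<I> i. ratio_x \<I> e powr r)" for i r
    by (intro sum.cong refl) (simp add: alpha_letter)
  \<comment> \<open>The exponent under the integral is almost surely the constant \<open>s\<close>,
    so the left side of \<open>eq\<close> reduces to a finite weighted sum over the letters of the
    first coordinate.\<close>
  have "(\<integral>\<omega>. \<phi> (sx (carpet \<I> \<omega>)) (\<omega> 0) \<partial>bernoulli_measure p) = (\<integral>\<omega>. \<phi> s (\<omega> 0) \<partial>bernoulli_measure p)"
  proof (rule integral_bernoulli_cong_AE)
    show "AE \<omega> in bernoulli_measure p. \<phi> (sx (carpet \<I> \<omega>)) (\<omega> 0) = \<phi> s (\<omega> 0)"
      using AE_s by (rule AE_mp) (auto simp: sx_def dest: has_box_dim_imp_box_dim)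
  qed (rule measurable_seq_component_fun)
  then have \<phi>_eq: "(\<Sum>i\<in>UNIV. pmf p i * \<phi> s i) = (\<Sum>i\<in>UNIV. pmf p i * \<phi> (t i) i)"
    using eq unfolding alpha \<phi>_def[symmetric] t_def[symmetric]
      integral_bernoulli_component[where \<phi> = "\<lambda>i. \<phi> (t i) i"] integral_bernoulli_component[where \<phi> = "\<phi> s"]
    by simp
  have "AE \<omega> in seq_measure p. has_box_dim (carpet \<I> \<omega>) (s + (\<Sum>i\<in>UNIV. pmf p i * \<phi> s i) / L)"
    unfolding \<phi>_def by (rule AE_carpet_dim) (use AE_s in \<open>simp only: AE_bernoulli_iff\<close>)
  moreover have "s + (\<Sum>i\<in>UNIV. pmf p i * \<phi> s i) / L = (\<Sum>i\<in>UNIV. pmf p i * d i)"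
  proof -
    have "(\<Sum>i\<in>UNIV. pmf p i * d i) = (\<Sum>i\<in>UNIV. pmf p i * t i) + (\<Sum>i\<in>UNIV. pmf p i * \<phi> (t i) i) / L"
      unfolding d by (simp add: distrib_left sum.distrib sum_divide_distrib)
    moreover have "s = (\<Sum>i\<in>UNIV. pmf p i * t i)" by (simp only: s_def t_def)
    ultimately show ?thesis unfolding \<phi>_eq by simp
  qed
  ultimately show "AE \<omega> in bernoulli_measure p. has_box_dim (carpet \<I> \<omega>) (\<Sum>i\<in>UNIV. pmf p i * d i)"
    by (simp only: AE_bernoulli_iff)
qed

end

section \<open>Systems in which every map interchanges the axes\<close>

locale antidiagonal_rifs =
  fixes \<I> :: "'i::finite rifs" and p :: "'i pmf" and \<eta> a :: real
  assumes box: "box_like_rifs \<I> p" and uorc: "UORC \<I>"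
    and \<eta>: "0 < \<eta>" "\<eta> < 1"
    and antidiag: "e \<in> symbols \<I> i \<Longrightarrow> orient \<I> e \<in> antidiagonal_signs"
    and ratio_y: "e \<in> symbols \<I> i \<Longrightarrow> ratio_y \<I> e = \<eta>"
    and ratio_x: "e \<in> symbols \<I> i \<Longrightarrow> ratio_x \<I> e = a"
begin

lemma a: "0 < a" "a < 1"
proof -
  obtain i :: 'i and e where "e \<in> symbols \<I> i" using symbols_ne[OF box] by blast
  moreover have "\<forall>i. \<forall>e\<in>symbols \<I> i. 0 < ratio_x \<I> e \<and> ratio_x \<I> e < 1"
    using box unfolding box_like_rifs_def by blast
  ultimately show "0 < a" "a < 1" using ratio_x by fastforce+
qed

text \<open>Two interchanging maps in succession preserve the axes, and in either direction the
  combined ratio is the width of one letter times the height of the other.\<close>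

definition \<theta> :: real where "\<theta> = a * \<eta>"

lemma \<theta>: "0 < \<theta>" "\<theta> < 1"
  using a \<eta> mult_strict_mono[of a 1 \<eta> 1] by (auto simp: \<theta>_def)

lemma letter_coords:
  assumes "e \<in> symbols \<I> i"
  shows "\<exists>A B c d. \<bar>A\<bar> = a \<and> \<bar>B\<bar> = \<eta> \<and> (\<forall>x. rifs_map \<I> e x $ 1 = A * x $ 2 + c \<and> rifs_map \<I> e x $ 2 = B * x $ 1 + d)"
proof -
  obtain s t where st: "orient \<I> e = mat2 0 s t 0" "\<bar>s\<bar> = 1" "\<bar>t\<bar> = 1"
    using antidiag[OF assms] by (auto simp: antidiagonal_signs_def)
  have "\<bar>a * s\<bar> = a" "\<bar>\<eta> * t\<bar> = \<eta>" using a \<eta> st by (simp_all add: abs_mult)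
  moreover have "rifs_map \<I> e x $ 1 = (a * s) * x $ 2 + transl \<I> e $ 1"
    "rifs_map \<I> e x $ 2 = (\<eta> * t) * x $ 1 + transl \<I> e $ 2" for x
    using ratio_x[OF assms] ratio_y[OF assms] by (simp_all add: rifs_map_def st mat2_mult_vec)
  ultimately show ?thesis by blast
qed

lemma even_word_coords:
  assumes "w \<in> words \<I> \<omega> (2 * k)"
  shows "\<exists>A B c d. \<bar>A\<bar> = \<theta> ^ k \<and> \<bar>B\<bar> = \<theta> ^ k \<and>
    (\<forall>x. word_map \<I> w x $ 1 = A * x $ 1 + c \<and> word_map \<I> w x $ 2 = B * x $ 2 + d)"
proof -
  have "length w = 2 * k \<Longrightarrow> set w \<subseteq> (\<Union>i. symbols \<I> i) \<Longrightarrow> ?thesis"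
  proof (induction k arbitrary: w)
    case 0
    then show ?case by (intro exI[of _ 1] exI[of _ 0]) simp
  next
    case (Suc k)
    then obtain e f v where w: "w = e # f # v" "length v = 2 * k"
      by (metis (no_types, lifting) Suc_length_conv mult_Suc_right add_2_eq_Suc)
    then obtain i j where ef: "e \<in> symbols \<I> i" "f \<in> symbols \<I> j" and "set v \<subseteq> (\<Union>i. symbols \<I> i)"
      using Suc.prems(2) by auto
    then obtain A B c d where v: "\<bar>A\<bar> = \<theta> ^ k" "\<bar>B\<bar> = \<theta> ^ k"
      "\<And>x. word_map \<I> v x $ 1 = A * x $ 1 + c" "\<And>x. word_map \<I> v x $ 2 = B * x $ 2 + d"
      using Suc.IH[OF w(2)] by blast
    obtain A1 B1 c1 d1 where e: "\<bar>A1\<bar> = a" "\<bar>B1\<bar> = \<eta>"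
      "\<And>x. rifs_map \<I> e x $ 1 = A1 * x $ 2 + c1" "\<And>x. rifs_map \<I> e x $ 2 = B1 * x $ 1 + d1"
      using letter_coords[OF ef(1)] by blast
    obtain A2 B2 c2 d2 where f: "\<bar>A2\<bar> = a" "\<bar>B2\<bar> = \<eta>"
      "\<And>x. rifs_map \<I> f x $ 1 = A2 * x $ 2 + c2" "\<And>x. rifs_map \<I> f x $ 2 = B2 * x $ 1 + d2"
      using letter_coords[OF ef(2)] by blast
    have "\<bar>A1 * B2 * A\<bar> = \<theta> ^ Suc k" "\<bar>B1 * A2 * B\<bar> = \<theta> ^ Suc k"
      by (simp_all add: abs_mult v e f \<theta>_def)
    moreover have "word_map \<I> w x $ 1 = (A1 * B2 * A) * x $ 1 + (A1 * (B2 * c + d2) + c1)"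
      "word_map \<I> w x $ 2 = (B1 * A2 * B) * x $ 2 + (B1 * (A2 * d + c2) + d1)" for x
      by (simp_all add: w v e f algebra_simps)
    ultimately show ?case by blast
  qed
  then show ?thesis using assms set_word_subset[OF assms] by (simp add: words_def)
qed

lemma even_word_dist:
  assumes w: "w \<in> words \<I> \<omega> (2 * k)" and x: "x \<in> unit_square" and y: "y \<in> unit_square"
  shows "\<bar>word_map \<I> w x $ i - word_map \<I> w y $ i\<bar> \<le> \<theta> ^ k"
proof -
  obtain A B c d where AB: "\<bar>A\<bar> = \<theta> ^ k" "\<bar>B\<bar> = \<theta> ^ k"
    "\<And>x. word_map \<I> w x $ 1 = A * x $ 1 + c" "\<And>x. word_map \<I> w x $ 2 = B * x $ 2 + d"
    using even_word_coords[OF w] by blast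
  have "\<bar>x $ j - y $ j\<bar> \<le> 1" for j
  proof -
    have "0 \<le> x $ j \<and> x $ j \<le> 1" "0 \<le> y $ j \<and> y $ j \<le> 1" using x y by (simp_all add: mem_box_cart)
    then show ?thesis by linarith
  qed
  then have le: "\<theta> ^ k * \<bar>x $ j - y $ j\<bar> \<le> \<theta> ^ k" for j
    using mult_left_mono[of "\<bar>x $ j - y $ j\<bar>" 1 "\<theta> ^ k"] \<theta> by simp
  have "\<bar>word_map \<I> w x $ 1 - word_map \<I> w y $ 1\<bar> = \<theta> ^ k * \<bar>x $ 1 - y $ 1\<bar>"
    "\<bar>word_map \<I> w x $ 2 - word_map \<I> w y $ 2\<bar> = \<theta> ^ k * \<bar>x $ 2 - y $ 2\<bar>"
    by (simp_all only: AB(3,4) add_diff_cancel_right right_diff_distrib[symmetric] abs_mult AB(1,2))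
  then show ?thesis using le exhaust_2[of i] by auto
qed

text \<open>Cylinders of level \<open>2 * k\<close> are squares of side \<open>\<theta> ^ k\<close>,
  essentially disjoint, so the grid count is comparable to the number of words. The factor 2 in the
  dimension reflects the two letters spent per scale.\<close>

lemma carpet_dim:
  assumes lim: "(\<lambda>k. (\<Sum>j<k. ln (card (symbols \<I> (\<omega> j)))) / real k) \<longlonglongrightarrow> E"
  shows "has_box_dim (carpet \<I> \<omega>) (2 * E / - ln \<theta>)"
proof -
  define N where "N k = card (cell (\<theta> ^ k) ` carpet \<I> \<omega>)" for k
  define W where "W k = card (words \<I> \<omega> (2 * k))" for k
  have \<theta>k: "0 < \<theta> ^ k" for k using \<theta> by simp
  have Wpos: "0 < W k" for k using words_ne[OF box] by (simp add: W_def card_gt_0_iff)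
  have lnW: "ln (W k) = (\<Sum>j<2 * k. ln (card (symbols \<I> (\<omega> j))))" for k
  proof -
    have "real (W k) = (\<Prod>j<2 * k. real (card (symbols \<I> (\<omega> j))))"
      using sum_words_prod[where g = "\<lambda>_. 1" and k = "2 * k" and \<omega> = \<omega> and \<I> = \<I>]
      by (simp add: W_def map_replicate_const)
    also have "ln \<dots> = (\<Sum>j<2 * k. ln (card (symbols \<I> (\<omega> j))))"
      by (rule ln_prod) (simp_all add: symbols_ne[OF box])
    finally show ?thesis .
  qed
  have bounds: "N k \<le> 49 * W k" "W k \<le> 1764 * N k" for k
  proof -
    let ?G = "(\<lambda>w. cell (\<theta> ^ k) (word_map \<I> w 0)) ` words \<I> \<omega> (2 * k)"
    have G: "N k \<le> 49 * card ?G" "card ?G \<le> 49 * N k"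
      unfolding N_def by (rule carpet_cells[OF box \<theta>k even_word_dist], assumption+)+
    have "card ?G \<le> W k" unfolding W_def by (intro card_image_le) simp
    with G(1) show "N k \<le> 49 * W k" by linarith
    \<comment> \<open>Each word contributes one cell, and by disjointness of the interiors no cell
      is used more than 36 times; \<open>1764 = 36 * 49\<close>.\<close>
    have "W k = (\<Sum>w\<in>words \<I> \<omega> (2 * k). card {cell (\<theta> ^ k) (word_map \<I> w 0)})" by (simp add: W_def)
    also have "\<dots> \<le> 36 * card (\<Union>w\<in>words \<I> \<omega> (2 * k). {cell (\<theta> ^ k) (word_map \<I> w 0)})"
    proof (rule sum_card_le_mult)
      fix q
      have "card {w \<in> words \<I> \<omega> (2 * k). q \<in> {cell (\<theta> ^ k) (word_map \<I> w 0)}}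
          \<le> card {w \<in> words \<I> \<omega> (2 * k). \<exists>x\<in>unit_square. cell (\<theta> ^ k) (word_map \<I> w x) = q}"
        using zero_in_unit_square by (intro card_mono) (auto simp del: mem_box_cart)
      also have "\<dots> \<le> 36"
      proof (rule card_rectangles_meeting_cell[OF \<theta>k])
        fix w assume "w \<in> words \<I> \<omega> (2 * k)"
        from even_word_coords[OF this] show "\<exists>A B c d. \<theta> ^ k \<le> \<bar>A\<bar> \<and> \<theta> ^ k \<le> \<bar>B\<bar> \<and>
            (\<forall>x. word_map \<I> w x $ 1 = A * x $ 1 + c \<and> word_map \<I> w x $ 2 = B * x $ 2 + d)"
          by (metis order_refl)
      qed (use word_map_disjoint[OF box uorc] in blast)
      finally show "card {w \<in> words \<I> \<omega> (2 * k). q \<in> {cell (\<theta> ^ k) (word_map \<I> w 0)}} \<le> 36" .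
    qed auto
    also have "(\<Union>w\<in>words \<I> \<omega> (2 * k). {cell (\<theta> ^ k) (word_map \<I> w 0)}) = ?G" by blast
    finally show "W k \<le> 1764 * N k" using G(2) by linarith
  qed
  have Npos: "0 < N k" for k using bounds(2)[of k] Wpos[of k] by (intro Nat.gr0I) simp
  have "(\<lambda>k. (\<Sum>j<2 * k. ln (card (symbols \<I> (\<omega> j)))) / real (2 * k)) \<longlonglongrightarrow> E"
    by (rule filterlim_compose[OF lim]) (intro filterlim_subseq strict_monoI, simp)
  from tendsto_mult[OF tendsto_const[of 2] this] have W_lim: "(\<lambda>k. ln (W k) / real k) \<longlonglongrightarrow> 2 * E"
    by (simp add: lnW)
  have "(\<lambda>k. ln (N k) / real k) \<longlonglongrightarrow> 2 * E"
  proof (rule tendsto_div_nat_if_sublinear_diff[OF W_lim])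
    fix \<epsilon> :: real assume "0 < \<epsilon>"
    have "\<bar>ln (N k) - ln (W k)\<bar> \<le> \<epsilon> * real k + ln 1764" for k
    proof -
      have "ln (real (N k)) \<le> ln (49 * real (W k))" "ln (real (W k)) \<le> ln (1764 * real (N k))"
        using of_nat_mono[OF bounds(1)[of k], where 'a = real] of_nat_mono[OF bounds(2)[of k], where 'a = real] Npos[of k] Wpos[of k]
        by (auto intro!: ln_mono)
      then have "ln (N k) \<le> ln 49 + ln (W k)" "ln (W k) \<le> ln 1764 + ln (N k)"
        using Npos[of k] Wpos[of k] by (simp_all add: ln_mult)
      moreover have "ln 49 \<le> ln (1764::real)" by simp
      moreover have "0 \<le> \<epsilon> * real k" using \<open>0 < \<epsilon>\<close> by simp
      ultimately show ?thesis by linarith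
    qed
    then show "\<exists>C. \<forall>\<^sub>F k in sequentially. \<bar>ln (N k) - ln (W k)\<bar> \<le> \<epsilon> * real k + C"
      by (blast intro: always_eventually)
  qed
  from tendsto_divide[OF this tendsto_const[of "- ln \<theta>"]]
  have "(\<lambda>k. ln (N k) / (real k * - ln \<theta>)) \<longlonglongrightarrow> 2 * E / - ln \<theta>"
    using \<theta> by (simp add: ln_less_zero)
  then show ?thesis
    unfolding N_def
    by (subst has_box_dim_iff_seq[OF bounded_carpet[OF box] carpet_ne[OF box] \<theta>
        covering_number_cell_bounds[OF bounded_carpet[OF box] \<theta>k]])
qed

lemma averaged_dimension:
  defines "d \<equiv> \<lambda>i. box_dim (carpet \<I> (\<lambda>_. i))"
  shows "\<exists>d. has_box_dim (carpet \<I> (\<lambda>_. i)) d"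
    and "AE \<omega> in bernoulli_measure p. has_box_dim (carpet \<I> \<omega>) (\<Sum>i\<in>UNIV. pmf p i * d i)"
proof -
  have dim: "has_box_dim (carpet \<I> (\<lambda>_. i)) (2 * ln (card (symbols \<I> i)) / - ln \<theta>)" for i
  proof (rule carpet_dim)
    show "(\<lambda>k. (\<Sum>j<k. ln (card (symbols \<I> i))) / real k) \<longlonglongrightarrow> ln (card (symbols \<I> i))"
      by (rule tendsto_eventually) (rule eventually_mono[OF eventually_gt_at_top[of 0]], simp)
  qed
  then show "\<exists>d. has_box_dim (carpet \<I> (\<lambda>_. i)) d" by blast
  have d: "d i = 2 * ln (card (symbols \<I> i)) / - ln \<theta>" for i
    unfolding d_def by (rule has_box_dim_imp_box_dim[OF dim])
  have eq: "2 * (\<Sum>i\<in>UNIV. pmf p i * ln (card (symbols \<I> i))) / - ln \<theta> = (\<Sum>i\<in>UNIV. pmf p i * d i)"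
    unfolding d by (simp add: sum_distrib_left sum_divide_distrib sum_negf[symmetric] mult_ac)
  show "AE \<omega> in bernoulli_measure p. has_box_dim (carpet \<I> \<omega>) (\<Sum>i\<in>UNIV. pmf p i * d i)"
    unfolding AE_bernoulli_iff eq[symmetric]
    by (rule AE_mp[OF AE_averages_tendsto[where \<phi> = "\<lambda>i. ln (card (symbols \<I> i))"]])
      (intro AE_I2 impI carpet_dim)
qed

end

section \<open>Side lengths for one and two interchanging maps\<close>

lemma lengths_antidiagonal_letter:
  assumes "orient \<I> e \<in> antidiagonal_signs" "0 < ratio_x \<I> e" "0 < ratio_y \<I> e"
  shows "length_x \<I> [e] = ratio_x \<I> e" "length_y \<I> [e] = ratio_y \<I> e"
proof -
  obtain s t where st: "orient \<I> e = mat2 0 s t 0" "\<bar>s\<bar> = 1" "\<bar>t\<bar> = 1"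
    using assms(1) by (auto simp: antidiagonal_signs_def)
  \<comment> \<open>Swapping the coordinates first preserves the unit square and brings the map into
    the axis-preserving form of \<open>proj_image_unit_square\<close>.\<close>
  define \<sigma> :: "real^2 \<Rightarrow> real^2" where "\<sigma> x = vector [x $ 2, x $ 1]" for x
  have \<sigma>: "\<sigma> ` unit_square = unit_square"
  proof
    show "\<sigma> ` unit_square \<subseteq> unit_square" by (auto simp: \<sigma>_def mem_box_cart forall_2)
    have "x = \<sigma> (\<sigma> x)" for x by (simp add: \<sigma>_def vec_eq_iff forall_2)
    then show "unit_square \<subseteq> \<sigma> ` unit_square"
      using \<open>\<sigma> ` unit_square \<subseteq> unit_square\<close> by blast
  qed
  have coords: "word_map \<I> [e] (\<sigma> x) $ 1 = (ratio_x \<I> e * s) * x $ 1 + transl \<I> e $ 1"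
    "word_map \<I> [e] (\<sigma> x) $ 2 = (ratio_y \<I> e * t) * x $ 2 + transl \<I> e $ 2" for x
    by (simp_all add: rifs_map_def st mat2_mult_vec \<sigma>_def)
  have im: "word_map \<I> [e] ` unit_square = (\<lambda>x. word_map \<I> [e] (\<sigma> x)) ` unit_square"
    by (metis \<sigma> image_image)
  have abs: "\<bar>ratio_x \<I> e * s\<bar> = ratio_x \<I> e" "\<bar>ratio_y \<I> e * t\<bar> = ratio_y \<I> e"
    using assms st by (simp_all add: abs_mult)
  show "length_x \<I> [e] = ratio_x \<I> e"
    unfolding length_x_def im proj_image_unit_square(1)[where f = "\<lambda>x. word_map \<I> [e] (\<sigma> x)", OF coords]
    by (subst measure_affine_interval) (use abs assms in auto)
  show "length_y \<I> [e] = ratio_y \<I> e"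
    unfolding length_y_def im proj_image_unit_square(2)[where f = "\<lambda>x. word_map \<I> [e] (\<sigma> x)", OF coords]
    by (subst measure_affine_interval) (use abs assms in auto)
qed

text \<open>The outer map sends the vertical extent of the inner rectangle to the horizontal axis,
  so the ratios pair crosswise; this is what makes dominance on two-letter words
  informative.\<close>

lemma lengths_antidiagonal_pair:
  assumes "orient \<I> e \<in> antidiagonal_signs" "0 < ratio_x \<I> e" "0 < ratio_y \<I> e"
    and "orient \<I> e' \<in> antidiagonal_signs" "0 < ratio_x \<I> e'" "0 < ratio_y \<I> e'"
  shows "length_x \<I> [e, e'] = ratio_x \<I> e * ratio_y \<I> e'" "length_y \<I> [e, e'] = ratio_y \<I> e * ratio_x \<I> e'"
proof -
  obtain s t where st: "orient \<I> e = mat2 0 s t 0" "\<bar>s\<bar> = 1" "\<bar>t\<bar> = 1"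
    using assms(1) by (auto simp: antidiagonal_signs_def)
  obtain s' t' where st': "orient \<I> e' = mat2 0 s' t' 0" "\<bar>s'\<bar> = 1" "\<bar>t'\<bar> = 1"
    using assms(4) by (auto simp: antidiagonal_signs_def)
  define A B where "A = ratio_x \<I> e * s * (ratio_y \<I> e' * t')" and "B = ratio_y \<I> e * t * (ratio_x \<I> e' * s')"
  have coords: "word_map \<I> [e, e'] x $ 1 = A * x $ 1 + (ratio_x \<I> e * s * transl \<I> e' $ 2 + transl \<I> e $ 1)"
    "word_map \<I> [e, e'] x $ 2 = B * x $ 2 + (ratio_y \<I> e * t * transl \<I> e' $ 1 + transl \<I> e $ 2)" for x
    by (simp_all add: rifs_map_def st st' mat2_mult_vec A_def B_def algebra_simps)
  have abs: "\<bar>A\<bar> = ratio_x \<I> e * ratio_y \<I> e'" "\<bar>B\<bar> = ratio_y \<I> e * ratio_x \<I> e'"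
    using assms st st' by (simp_all add: A_def B_def abs_mult)
  show "length_x \<I> [e, e'] = ratio_x \<I> e * ratio_y \<I> e'"
    unfolding length_x_def proj_image_unit_square(1)[where f = "word_map \<I> [e, e']", OF coords]
    by (subst measure_affine_interval) (use abs assms in auto)
  show "length_y \<I> [e, e'] = ratio_y \<I> e * ratio_x \<I> e'"
    unfolding length_y_def proj_image_unit_square(2)[where f = "word_map \<I> [e, e']", OF coords]
    by (subst measure_affine_interval) (use abs assms in auto)
qed

theorem corollary3p8:
  fixes \<I> :: "'i::finite rifs" and p :: "'i pmf" and \<eta> :: real
  assumes "box_like_rifs \<I> p"
    and "UORC \<I>"
    and "separated \<I>"
    and "x_dominant \<I>"
    and "0 < \<eta>" and "\<eta> < 1"
    and "\<forall>i. \<forall>e\<in>symbols \<I> i. alpha_min \<I> [e] = \<eta>"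
    and "AE \<omega> in bernoulli_measure p.
           has_box_dim (proj_x (carpet \<I> \<omega>)) (\<Sum>i\<in>UNIV. pmf p i * sx (carpet \<I> (\<lambda>_. i)))"
    and "(\<integral>\<omega>. ln (\<Sum>e\<in>symbols \<I> (\<omega> 0). alpha_max \<I> [e] powr sx (carpet \<I> \<omega>))
             \<partial>bernoulli_measure p) =
         (\<integral>\<omega>. ln (\<Sum>e\<in>symbols \<I> (\<omega> 0). alpha_max \<I> [e] powr sx (carpet \<I> (\<lambda>_. \<omega> 0)))
             \<partial>bernoulli_measure p)"
  shows "(\<forall>i. \<exists>d. has_box_dim (carpet \<I> (\<lambda>_. i)) d) \<and>
         (AE \<omega> in bernoulli_measure p.
            has_box_dim (carpet \<I> \<omega>) (\<Sum>i\<in>UNIV. pmf p i * box_dim (carpet \<I> (\<lambda>_. i)))) \<and>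
         (\<Sum>i\<in>UNIV. pmf p i * box_dim (carpet \<I> (\<lambda>_. i))) =
           (\<integral>\<omega>. box_dim (carpet \<I> (\<lambda>_. \<omega> 0)) \<partial>bernoulli_measure p)"
proof -
  have pos: "0 < ratio_x \<I> e \<and> 0 < ratio_y \<I> e" and orient: "orient \<I> e \<in> diagonal_signs \<union> antidiagonal_signs"
    if "e \<in> symbols \<I> i" for e i
    using assms(1) that unfolding box_like_rifs_def by blast+
  have dom: "length_y \<I> w \<le> length_x \<I> w" if "set w \<subseteq> (\<Union>i. symbols \<I> i)" for w
  proof -
    have "alpha_max \<I> w = length_x \<I> w" using assms(4) that by (simp add: x_dominant_def)
    then show ?thesis by (metis alpha_max_def max.cobounded2)
  qed
  \<comment> \<open>Dominance identifies the shorter side of each letter as the vertical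
    one.\<close>
  have letter: "length_y \<I> [e] = \<eta>" "\<eta> \<le> length_x \<I> [e]" if "e \<in> symbols \<I> i" for e i
  proof -
    have le: "length_y \<I> [e] \<le> length_x \<I> [e]" using that by (intro dom) auto
    moreover have "min (length_x \<I> [e]) (length_y \<I> [e]) = \<eta>"
      using assms(7) that by (simp add: alpha_min_def)
    ultimately show "length_y \<I> [e] = \<eta>" "\<eta> \<le> length_x \<I> [e]" by auto
  qed
  have mean: "(\<Sum>i\<in>UNIV. pmf p i * box_dim (carpet \<I> (\<lambda>_. i))) =
      (\<integral>\<omega>. box_dim (carpet \<I> (\<lambda>_. \<omega> 0)) \<partial>bernoulli_measure p)"
    using integral_bernoulli_component[where \<phi> = "\<lambda>i. box_dim (carpet \<I> (\<lambda>_. i))" and p = p] by simp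
  consider (diagonal) "\<forall>i. \<forall>e\<in>symbols \<I> i. orient \<I> e \<in> diagonal_signs"
    | (antidiagonal) "\<forall>i. \<forall>e\<in>symbols \<I> i. orient \<I> e \<in> antidiagonal_signs"
    using assms(3) orient unfolding separated_def non_separated_def by blast
  then show ?thesis
  proof cases
    case diagonal
    have len: "length_x \<I> [e] = ratio_x \<I> e" "length_y \<I> [e] = ratio_y \<I> e" if "e \<in> symbols \<I> i" for e i
    proof -
      have "\<forall>e'\<in>set [e]. orient \<I> e' \<in> diagonal_signs \<and> 0 < ratio_x \<I> e' \<and> 0 < ratio_y \<I> e'"
        using diagonal pos[OF that] that by simp
      from lengths_diagonal[OF this] show "length_x \<I> [e] = ratio_x \<I> e" "length_y \<I> [e] = ratio_y \<I> e" by simp_all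
    qed
    interpret diagonal_rifs \<I> p \<eta>
    proof
      show "ratio_y \<I> e = \<eta>" "\<eta> \<le> ratio_x \<I> e" if "e \<in> symbols \<I> i" for e i
        using letter[OF that] len[OF that] by simp_all
    qed (use assms(1,2,5,6) diagonal in blast)+
    show ?thesis using averaged_dimension[OF assms(8,9)] mean by blast
  next
    case antidiagonal
    have len: "length_x \<I> [e] = ratio_x \<I> e" "length_y \<I> [e] = ratio_y \<I> e" if "e \<in> symbols \<I> i" for e i
      using lengths_antidiagonal_letter[of \<I> e] antidiagonal pos[OF that] that by blast+
    have ry: "ratio_y \<I> e = \<eta>" if "e \<in> symbols \<I> i" for e i using letter[OF that] len[OF that] by simp
    \<comment> \<open>The two axes alternate in words of two letters, so dominance of the horizontal axis for
      both \<open>[e, e']\<close> and \<open>[e', e]\<close> forces equal ratios: all cylinders are nearly square.\<close>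
    have le: "ratio_x \<I> e' \<le> ratio_x \<I> e" if e: "e \<in> symbols \<I> i" "e' \<in> symbols \<I> i'" for e e' i i'
    proof -
      have "set [e, e'] \<subseteq> (\<Union>i. symbols \<I> i)" using e by auto
      then have "length_y \<I> [e, e'] \<le> length_x \<I> [e, e']" by (rule dom)
      moreover have "length_x \<I> [e, e'] = ratio_x \<I> e * \<eta>" "length_y \<I> [e, e'] = \<eta> * ratio_x \<I> e'"
        using lengths_antidiagonal_pair[of \<I> e e'] antidiagonal pos[OF e(1)] pos[OF e(2)] e ry[OF e(1)] ry[OF e(2)] by auto
      ultimately show ?thesis using assms(5) by (simp add: mult.commute)
    qed
    obtain i0 e0 where e0: "e0 \<in> symbols \<I> (i0 :: 'i)" using symbols_ne[OF assms(1)] by blast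
    interpret antidiagonal_rifs \<I> p \<eta> "ratio_x \<I> e0"
    proof
      show "ratio_x \<I> e = ratio_x \<I> e0" if "e \<in> symbols \<I> i" for e i
        using le[OF that e0] le[OF e0 that] by simp
    qed (use assms(1,2,5,6) antidiagonal ry in blast)+
    show ?thesis using averaged_dimension mean by blast
  qed
qed

end
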